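(* Let $p,q,r$ be positive integers with $q\le r$. If $G$ is a graph with $\kappa(G)\ge 10\big((p+q)r-q\big)$, then for every set $R\subseteq V(G)$ of $r$ terminals, $G$ has an $R$-CIST consisting of $p$ pendant and $q$ non-pendant $R$-Steiner trees.
   Context: Graphs are finite, may have parallel edges but no loops. $\kappa(G)$ is the vertex connectivity of $G$. For a tree $T$, $\mathrm{int}(T)$ is the set of vertices of degree at least 2 and $L(T)$ the set of leaves. An $R$-Steiner tree is a subtree $T$ of $G$ with $R\subseteq V(T)$ and $L(T)\subseteq R$; it is pendant if $L(T)=R$ and non-pendant if $\mathrm{int}(T)\cap R\ne\emptyset$. An $R$-CIST is a set $\{T_1,\dots,T_k\}$ of $R$-Steiner trees such that for all distinct $u,v\in R$ and distinct $i,j$, the $(u,v)$-paths in $T_i$ and $T_j$ are edge-disjoint and internally vertex-disjoint.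
   Formalization: The number r of terminals is required to be at least 3; for r = 1 or 2 the claim is false (e.g. the complete graph on 31 vertices with p = q = 1, r = 2), since every leaf lies in R and so no non-pendant R-Steiner tree exists. *)

theory Defs
  imports Main
begin

text \<open>
  A multigraph: every edge is an object of its own and \<open>ends\<close> gives its set of end vertices, so
  parallel edges are distinct edges with equal ends.
\<close>

record ('v, 'e) mgraph =
  verts :: "'v set"
  edges :: "'e set"
  ends :: "'e \<Rightarrow> 'v set"

text \<open>Two ends for every edge: loops are excluded.\<close>

definition finite_mgraph :: "('v, 'e) mgraph \<Rightarrow> bool" where
  "finite_mgraph G \<longleftrightarrow>
     finite (verts G) \<and> finite (edges G) \<and>
     (\<forall>e\<in>edges G. ends G e \<subseteq> verts G \<and> card (ends G e) = 2)"

text \<open>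
  The function \<open>ends\<close> is required to be literally the same in a subgraph, so a subgraph of a given
  graph is determined by its vertices and edges.
\<close>

definition subgraph :: "('v, 'e) mgraph \<Rightarrow> ('v, 'e) mgraph \<Rightarrow> bool" where
  "subgraph H G \<longleftrightarrow>
     finite_mgraph H \<and> verts H \<subseteq> verts G \<and> edges H \<subseteq> edges G \<and> ends H = ends G"

definition delete_verts :: "('v, 'e) mgraph \<Rightarrow> 'v set \<Rightarrow> ('v, 'e) mgraph" where
  "delete_verts G S =
     \<lparr>verts = verts G - S, edges = {e \<in> edges G. ends G e \<inter> S = {}}, ends = ends G\<rparr>"

definition degree :: "('v, 'e) mgraph \<Rightarrow> 'v \<Rightarrow> nat" where
  "degree G v = card {e \<in> edges G. v \<in> ends G e}"

text \<open>
  A path is given by its list \<open>xs\<close> of vertices and its list \<open>es\<close> of edges. The path from a vertex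
  to itself is \<open>xs = [u]\<close>, \<open>es = []\<close>.
\<close>

definition is_path :: "('v, 'e) mgraph \<Rightarrow> 'v \<Rightarrow> 'v list \<Rightarrow> 'e list \<Rightarrow> 'v \<Rightarrow> bool" where
  "is_path G u xs es v \<longleftrightarrow>
     length xs = Suc (length es) \<and> hd xs = u \<and> last xs = v \<and>
     distinct xs \<and> set xs \<subseteq> verts G \<and> set es \<subseteq> edges G \<and>
     (\<forall>i < length es. ends G (es ! i) = {xs ! i, xs ! Suc i})"

definition connected_mgraph :: "('v, 'e) mgraph \<Rightarrow> bool" where
  "connected_mgraph G \<longleftrightarrow>
     verts G \<noteq> {} \<and> (\<forall>u\<in>verts G. \<forall>v\<in>verts G. \<exists>xs es. is_path G u xs es v)"

text \<open>
  A cycle is a path together with a further edge joining its ends; two parallel edges form a cycle.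
\<close>

definition acyclic_mgraph :: "('v, 'e) mgraph \<Rightarrow> bool" where
  "acyclic_mgraph G \<longleftrightarrow>
     \<not> (\<exists>u v xs es e. is_path G u xs es v \<and> e \<in> edges G \<and> e \<notin> set es \<and> ends G e = {u, v})"

definition is_tree :: "('v, 'e) mgraph \<Rightarrow> bool" where
  "is_tree T \<longleftrightarrow> finite_mgraph T \<and> connected_mgraph T \<and> acyclic_mgraph T"

text \<open>
  The least number of vertices whose deletion leaves a disconnected graph or at most one vertex;
  in particular the complete graph on \<open>n \<ge> 1\<close> vertices has connectivity \<open>n - 1\<close>.
\<close>

definition vertex_connectivity :: "('v, 'e) mgraph \<Rightarrow> nat" where
  "vertex_connectivity G =
     (LEAST k. \<exists>S. S \<subseteq> verts G \<and> card S = k \<and>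
        (\<not> connected_mgraph (delete_verts G S) \<or> card (verts G - S) \<le> 1))"

definition inner_verts :: "('v, 'e) mgraph \<Rightarrow> 'v set" where
  "inner_verts T = {v \<in> verts T. 2 \<le> degree T v}"

definition leaves :: "('v, 'e) mgraph \<Rightarrow> 'v set" where
  "leaves T = {v \<in> verts T. degree T v = 1}"

definition steiner_tree :: "('v, 'e) mgraph \<Rightarrow> 'v set \<Rightarrow> ('v, 'e) mgraph \<Rightarrow> bool" where
  "steiner_tree G R T \<longleftrightarrow> subgraph T G \<and> is_tree T \<and> R \<subseteq> verts T \<and> leaves T \<subseteq> R"

definition pendant :: "'v set \<Rightarrow> ('v, 'e) mgraph \<Rightarrow> bool" where
  "pendant R T \<longleftrightarrow> leaves T = R"

text \<open>
  If \<open>R\<close> has at most two elements, no Steiner tree for \<open>R\<close> is non-pendant: a tree with an edge has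
  at least two leaves, all of them in \<open>R\<close>. So existence results need \<open>card R \<ge> 3\<close>.
\<close>

definition non_pendant :: "'v set \<Rightarrow> ('v, 'e) mgraph \<Rightarrow> bool" where
  "non_pendant R T \<longleftrightarrow> inner_verts T \<inter> R \<noteq> {}"

definition is_CIST :: "('v, 'e) mgraph \<Rightarrow> 'v set \<Rightarrow> ('v, 'e) mgraph set \<Rightarrow> bool" where
  "is_CIST G R \<T> \<longleftrightarrow>
     finite \<T> \<and> (\<forall>T\<in>\<T>. steiner_tree G R T) \<and>
     (\<forall>u\<in>R. \<forall>v\<in>R. \<forall>T\<in>\<T>. \<forall>T'\<in>\<T>. u \<noteq> v \<and> T \<noteq> T' \<longrightarrow>
        (\<forall>xs es xs' es'. is_path T u xs es v \<and> is_path T' u xs' es' v \<longrightarrow>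
           set es \<inter> set es' = {} \<and> (set xs - {u, v}) \<inter> (set xs' - {u, v}) = {}))"

end

theory Submission imports Defs
begin

text \<open>
  Delete \<open>R\<close>. For every tree \<open>t\<close> and every terminal \<open>x\<close> to be attached to it choose a private
  neighbour \<open>y (x, t)\<close> of \<open>x\<close>, and for the \<open>j\<close>-th non-pendant tree add copies of two terminals \<open>a j\<close>
  and \<open>b j\<close>. Disjoint connected sets \<open>U t\<close> through the \<open>y (x, t)\<close> and \<open>Pt j\<close> between the two copies
  give the trees: \<open>R\<close> hangs on \<open>U t\<close> in a pendant one, whereas in a non-pendant one \<open>b j\<close> is attached
  to \<open>Pt j\<close> only and \<open>Pt j\<close> is joined to \<open>U t\<close> only via \<open>a j\<close>, which becomes an inner vertex. All other
  terminals have degree 1, so the paths of different trees are disjoint.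

  The disjoint sets come from an argument in the style of Thomas and Wollan. A set \<open>X\<close> is massed if
  the rest of the graph has more than \<open>c\<close> edges per vertex and no separation of order less than
  \<open>card X\<close> cuts off such a dense part from \<open>X\<close>. In a smallest counterexample no separation of order
  at most \<open>card X\<close> cuts off a linked set, and contracting an edge destroys the density; hence a vertex
  of least degree outside \<open>X\<close> has a dense closed neighbourhood. An extremal partial linkage shows that
  this neighbourhood contains a large linked set, and Menger's theorem joins \<open>X\<close> to it.
\<close>

section \<open>Connected sets and Menger's theorem\<close>

text \<open>The linking argument needs only which vertex pairs are joined, so it runs on a set
  \<open>E\<close> of vertex pairs with connectivity expressed by cuts; edges of the multigraph
  return when the trees are built. The price of a partition of the terminals \<open>Z\<close> is
  \<open>card Z\<close> plus the number of parts with at least two elements, whence the two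
  parameters \<open>N\<close> and \<open>M\<close>. The obstacle is a separation that appears only
  after a contraction: undoing the contraction can raise its order by one. Hence separations of
  order exactly \<open>card X\<close> in front of a linked set must be excluded too. They are
  treated by paths from \<open>X\<close> to the linked set, those of smaller order by putting a
  clique in place of the linked side. With \<open>k = (p + q) * r - q\<close> private neighbours
  there are \<open>k + 2 * q\<close> linkage terminals in \<open>p + 2 * q\<close> parts, and about
  \<open>5 * k\<close> edges per vertex. The factor 10 is settled by the smallest case: for
  \<open>p = 1\<close> and \<open>q = r = 3\<close> all three density conditions in
  \<open>size_arith\<close> are equalities.\<close>

definition conn :: "'a set set \<Rightarrow> 'a set \<Rightarrow> bool" where
  "conn E C \<longleftrightarrow> C \<noteq> {} \<and>
     (\<forall>P. P \<subseteq> C \<and> P \<noteq> {} \<and> P \<noteq> C \<longrightarrow> (\<exists>a\<in>P. \<exists>b\<in>C - P. {a, b} \<in> E))"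

text \<open>An edge leaving \<open>P\<close> also leaves \<open>C - P\<close>, so of every cut only
  the side of a fixed vertex has to be examined.\<close>

lemma connI:
  assumes "x \<in> C"
    and "\<And>P. P \<subseteq> C \<Longrightarrow> x \<in> P \<Longrightarrow> P \<noteq> C \<Longrightarrow> \<exists>a\<in>P. \<exists>b\<in>C - P. {a, b} \<in> E"
  shows "conn E C"
  unfolding conn_def
proof (intro conjI allI impI)
  show "C \<noteq> {}" using assms(1) by auto
  fix P assume P: "P \<subseteq> C \<and> P \<noteq> {} \<and> P \<noteq> C"
  show "\<exists>a\<in>P. \<exists>b\<in>C - P. {a, b} \<in> E"
  proof (cases "x \<in> P")
    case True
    then show ?thesis using assms(2) P by blast
  next
    case False
    then have "\<exists>a\<in>C - P. \<exists>b\<in>C - (C - P). {a, b} \<in> E"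
      using assms P by (intro assms(2)) auto
    then show ?thesis using P by (metis DiffD1 DiffD2 DiffI insert_commute)
  qed
qed

lemma conn_cut:
  assumes "conn E C" "x \<in> C" "x \<in> P" "y \<in> C" "y \<notin> P"
  shows "\<exists>a b. a \<in> C \<and> a \<in> P \<and> b \<in> C \<and> b \<notin> P \<and> {a, b} \<in> E"
proof -
  have "P \<inter> C \<subseteq> C \<and> P \<inter> C \<noteq> {} \<and> P \<inter> C \<noteq> C" using assms by auto
  then have "\<exists>a\<in>P \<inter> C. \<exists>b\<in>C - P \<inter> C. {a, b} \<in> E" using assms(1) unfolding conn_def by blast
  then show ?thesis by blast
qed

lemma conn_nonempty: "conn E C \<Longrightarrow> C \<noteq> {}"
  by (simp add: conn_def)

lemma conn_single [simp]: "conn E {x}"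
  by (rule connI[of x]) auto

lemma conn_mono: "conn E C \<Longrightarrow> (\<And>a b. a \<in> C \<Longrightarrow> b \<in> C \<Longrightarrow> {a, b} \<in> E \<Longrightarrow> {a, b} \<in> E') \<Longrightarrow> conn E' C"
  unfolding conn_def by (meson DiffD1 subsetD)

lemma conn_Un_edge:
  assumes A: "conn E A" and B: "conn E B" and e: "a \<in> A" "b \<in> B" "{a, b} \<in> E"
  shows "conn E (A \<union> B)"
proof (rule connI[of a])
  show "a \<in> A \<union> B" using e by simp
  fix P assume P: "P \<subseteq> A \<union> B" "a \<in> P" "P \<noteq> A \<union> B"
  show "\<exists>a\<in>P. \<exists>b\<in>A \<union> B - P. {a, b} \<in> E"
  proof (cases "A \<subseteq> P")
    case False
    then obtain y where "y \<in> A" "y \<notin> P" by auto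
    then obtain a' b' where "a' \<in> A" "a' \<in> P" "b' \<in> A" "b' \<notin> P" "{a', b'} \<in> E"
        using conn_cut[OF A, of a P y] e P by blast
    then show ?thesis by auto
  next
    case True
    show ?thesis
    proof (cases "b \<in> P")
      case False
      then show ?thesis using e P by auto
    next
      case bP: True
      obtain y where "y \<in> B" "y \<notin> P" using True P by auto
      then obtain a' b' where "a' \<in> B" "a' \<in> P" "b' \<in> B" "b' \<notin> P" "{a', b'} \<in> E"
        using conn_cut[OF B, of b P y] e bP by blast
      then show ?thesis by auto
    qed
  qed
qed

lemma conn_Un:
  assumes A: "conn E A" and B: "conn E B" and x: "x \<in> A" "x \<in> B"
  shows "conn E (A \<union> B)"
proof (rule connI[of x])
  show "x \<in> A \<union> B" using x by simp
  fix P assume P: "P \<subseteq> A \<union> B" "x \<in> P" "P \<noteq> A \<union> B"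
  then obtain y where y: "y \<in> A \<union> B" "y \<notin> P" by auto
  then consider "y \<in> A" | "y \<in> B" by auto
  then show "\<exists>a\<in>P. \<exists>b\<in>A \<union> B - P. {a, b} \<in> E"
  proof cases
    case 1
    then obtain a' b' where "a' \<in> A" "a' \<in> P" "b' \<in> A" "b' \<notin> P" "{a', b'} \<in> E"
        using conn_cut[OF A, of x P y] x P y by blast
    then show ?thesis by auto
  next
    case 2
    then obtain a' b' where "a' \<in> B" "a' \<in> P" "b' \<in> B" "b' \<notin> P" "{a', b'} \<in> E"
        using conn_cut[OF B, of x P y] x P y by blast
    then show ?thesis by auto
  qed
qed

lemma conn_insert: "conn E C \<Longrightarrow> a \<in> C \<Longrightarrow> {a, v} \<in> E \<Longrightarrow> conn E (insert v C)"
  using conn_Un_edge[of E C "{v}" a v] by simp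

text \<open>Every piece \<open>F i\<close> is attached to \<open>A\<close> directly, so each cut can
  be examined inside \<open>A \<union> F i\<close> for a single \<open>i\<close>.\<close>

lemma conn_UN:
  assumes "\<And>i. i \<in> I \<Longrightarrow> conn E (F i)" and A: "conn E A"
    and "\<And>i. i \<in> I \<Longrightarrow> F i \<inter> A \<noteq> {} \<or> (\<exists>a\<in>A. \<exists>b\<in>F i. {a, b} \<in> E)"
  shows "conn E (A \<union> (\<Union>i\<in>I. F i))"
proof -
  obtain x where x: "x \<in> A" using A by (auto simp: conn_def)
  show ?thesis
  proof (rule connI[of x])
    show "x \<in> A \<union> \<Union> (F ` I)" using x by simp
    fix P assume P: "P \<subseteq> A \<union> \<Union> (F ` I)" "x \<in> P" "P \<noteq> A \<union> \<Union> (F ` I)"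
    then obtain y where y: "y \<in> A \<union> \<Union> (F ` I)" "y \<notin> P" by auto
    have *: "\<exists>a\<in>P. \<exists>b\<in>A \<union> \<Union> (F ` I) - P. {a, b} \<in> E"
      if B: "conn E B" "x \<in> B" "y \<in> B" "B \<subseteq> A \<union> \<Union> (F ` I)" for B
    proof -
      obtain a' b' where "a' \<in> B" "a' \<in> P" "b' \<in> B" "b' \<notin> P" "{a', b'} \<in> E"
        using conn_cut[OF B(1), of x P y] B x P y by blast
      then show ?thesis using B by blast
    qed
    show "\<exists>a\<in>P. \<exists>b\<in>A \<union> \<Union> (F ` I) - P. {a, b} \<in> E"
    proof (cases "y \<in> A")
      case True
      then show ?thesis using *[of A] A x by auto
    next
      case False
      then obtain i where i: "i \<in> I" "y \<in> F i" using y by auto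
      have "conn E (A \<union> F i)"
        using assms(1)[OF i(1)] A assms(3)[OF i(1)] by (metis conn_Un conn_Un_edge disjoint_iff)
      then show ?thesis using *[of "A \<union> F i"] x i by auto
    qed
  qed
qed

text \<open>Grow a connected piece around every neighbour of \<open>v\<close>; pieces without terminals are dropped.\<close>

lemma conn_prune:
  assumes U: "conn E U" and fin: "finite U" and v: "v \<in> U" and T: "T \<subseteq> U - {v}"
  shows "\<exists>U'\<subseteq>U. conn E U' \<and> v \<in> U' \<and> T \<subseteq> U' \<and>
           card U' + card {w \<in> U - {v}. {v, w} \<in> E} \<le> card U + card T"
proof -
  define D where "D = {w \<in> U - {v}. {v, w} \<in> E}"
  \<comment> \<open>\<open>W\<close> is the union of the pieces grown so far, and
    \<open>\<pi>\<close> names for each vertex of \<open>W\<close> the neighbour of \<open>v\<close>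
    from which its piece was grown.\<close>
  define good where "good W \<pi> \<longleftrightarrow> D \<subseteq> W \<and> W \<subseteq> U - {v} \<and> (\<forall>x\<in>W. \<pi> x \<in> D) \<and> (\<forall>d\<in>D. \<pi> d = d) \<and>
      (\<forall>d\<in>D. conn E {x \<in> W. \<pi> x = d})" for W and \<pi> :: "'a \<Rightarrow> 'a"
  have finD: "finite D" using fin by (simp add: D_def)
  have "good D id"
  proof -
    have "{x \<in> D. x = d} = {d}" if "d \<in> D" for d using that by auto
    then show ?thesis by (auto simp: good_def D_def)
  qed
  then have ex: "\<exists>\<pi>. good D \<pi>" by blast
  have bound: "\<forall>W. (\<exists>\<pi>. good W \<pi>) \<longrightarrow> card W < Suc (card U)"
    using fin by (auto simp: good_def intro!: le_imp_less_Suc card_mono)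
  obtain W where W: "\<exists>\<pi>. good W \<pi>" and maxW: "\<And>W'. (\<exists>\<pi>. good W' \<pi>) \<Longrightarrow> card W' \<le> card W"
    using ex_has_greatest_nat[of "\<lambda>W. \<exists>\<pi>. good W \<pi>" D card "Suc (card U)", OF ex bound] by blast
  obtain \<pi> where g: "good W \<pi>" using W by blast
  \<comment> \<open>Otherwise an edge of \<open>U\<close> leaves \<open>insert v W\<close>. It does
    not start at \<open>v\<close>, whose neighbours in \<open>U\<close> are all in \<open>W\<close>,
    so it extends a piece.\<close>
  have WU: "W = U - {v}"
  proof (rule ccontr)
    assume "W \<noteq> U - {v}"
    then obtain y where y: "y \<in> U" "y \<notin> insert v W" using g unfolding good_def by blast
    have sub: "insert v W \<subseteq> U" using g v unfolding good_def by blast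
    obtain a b where ab: "a \<in> insert v W" "b \<in> U" "b \<notin> insert v W" "{a, b} \<in> E"
      using conn_cut[OF U, of v "insert v W" y] y v by blast
    have "a \<noteq> v" using ab g by (auto simp: good_def D_def)
    then have aW: "a \<in> W" using ab by simp
    define \<pi>' where "\<pi>' = \<pi>(b := \<pi> a)"
    have fib: "{x \<in> insert b W. \<pi>' x = d} =
        (if \<pi> a = d then insert b {x \<in> W. \<pi> x = d} else {x \<in> W. \<pi> x = d})" for d
      using ab by (auto simp: \<pi>'_def)
    have "conn E {x \<in> insert b W. \<pi>' x = d}" if "d \<in> D" for d
    proof (cases "\<pi> a = d")
      case True
      have "conn E (insert b {x \<in> W. \<pi> x = d})"
        using g that aW ab True by (intro conn_insert[of E _ a]) (auto simp: good_def)
      then show ?thesis using True by (subst fib) simp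
    next
      case False
      then show ?thesis using g that by (subst fib) (simp add: good_def)
    qed
    moreover have "b \<notin> D" using ab g by (auto simp: good_def)
    ultimately have "good (insert b W) \<pi>'"
      using g ab aW unfolding good_def by (auto simp: \<pi>'_def)
    then have "card (insert b W) \<le> card W" using maxW by blast
    moreover have "finite W" using g fin by (auto simp: good_def intro: finite_subset)
    ultimately show False using ab by simp
  qed
  define I where "I = \<pi> ` T"
  define F where "F d = {x \<in> W. \<pi> x = d}" for d
  have ID: "I \<subseteq> D" using T g WU by (auto simp: I_def good_def)
  define U' where "U' = {v} \<union> (\<Union>d\<in>I. F d)"
  have dF: "d \<in> F d" if "d \<in> D" for d using that g by (auto simp: F_def good_def)
  have "conn E U'" unfolding U'_def
  proof (rule conn_UN)
    fix d assume "d \<in> I"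
    then have d: "d \<in> D" using ID by auto
    then show "conn E (F d)" using g by (auto simp: F_def good_def)
    have "{v, d} \<in> E" using d by (simp add: D_def)
    then show "F d \<inter> {v} \<noteq> {} \<or> (\<exists>a\<in>{v}. \<exists>b\<in>F d. {a, b} \<in> E)" using dF[OF d] by blast
  qed simp
  moreover have "U' \<subseteq> U" using v WU by (auto simp: U'_def F_def)
  moreover have "T \<subseteq> U'" using T WU by (auto simp: U'_def F_def I_def)
  moreover have "card U' + card D \<le> card U + card T"
  proof -
    \<comment> \<open>A dropped piece loses at least its root in \<open>D - I\<close>, and at most
      \<open>card T\<close> pieces are kept; this is the saving claimed.\<close>
    have disj: "U' \<inter> (D - I) = {}" using g by (auto simp: U'_def F_def good_def D_def)
    have "card U' + card (D - I) = card (U' \<union> (D - I))"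
      using disj fin finD \<open>U' \<subseteq> U\<close> by (subst card_Un_disjoint) (auto intro: finite_subset)
    also have "\<dots> \<le> card U" using \<open>U' \<subseteq> U\<close> fin by (intro card_mono) (auto simp: D_def)
    finally have 1: "card U' + card (D - I) \<le> card U" .
    have "finite T" using T fin by (auto intro: finite_subset)
    then have "card I \<le> card T" by (simp add: I_def card_image_le)
    moreover have "card D = card I + card (D - I)"
      using ID finD by (metis card_Diff_subset card_mono finite_subset le_add_diff_inverse)
    ultimately show ?thesis using 1 by linarith
  qed
  ultimately show ?thesis unfolding D_def U'_def by (intro exI[of _ U'] conjI) (auto simp: U'_def)
qed

text \<open>A largest connected set around \<open>x\<close> that avoids \<open>L\<close> can only be
  extended into \<open>L\<close>, and one added vertex suffices. This is the substitute for stopping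
  a path at its first vertex in \<open>L\<close>.\<close>

lemma conn_first_hit:
  assumes Q: "conn E Q" and fin: "finite Q" and x: "x \<in> Q" and L: "Q \<inter> L \<noteq> {}"
  shows "\<exists>Q' y. Q' \<subseteq> Q \<and> conn E Q' \<and> x \<in> Q' \<and> Q' \<inter> L = {y}"
proof (cases "x \<in> L")
  case True
  then show ?thesis using x by (intro exI[of _ "{x}"] exI[of _ x]) auto
next
  case False
  define good where "good K \<longleftrightarrow> K \<subseteq> Q - L \<and> conn E K \<and> x \<in> K" for K
  have g0: "good {x}" using False x by (simp add: good_def)
  have bnd: "\<forall>K. good K \<longrightarrow> card K < Suc (card Q)"
    using fin by (auto simp: good_def less_Suc_eq_le intro!: card_mono)
  obtain K where K: "good K" and mx: "\<And>K'. good K' \<Longrightarrow> card K' \<le> card K"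
    using ex_has_greatest_nat[OF g0 bnd] by blast
  obtain y where y: "y \<in> Q" "y \<in> L" using L by auto
  obtain a b where ab: "a \<in> K" "b \<in> Q" "b \<notin> K" "{a, b} \<in> E"
    using conn_cut[OF Q, of x K y] K y x by (auto simp: good_def)
  have c: "conn E (insert b K)" using conn_insert K ab by (metis good_def)
  have "b \<in> L"
  proof (rule ccontr)
    assume "b \<notin> L"
    then have "good (insert b K)" using c K ab by (auto simp: good_def)
    then have "card (insert b K) \<le> card K" by (rule mx)
    moreover have "finite K" using K fin by (auto simp: good_def intro: finite_subset)
    ultimately show False using ab by simp
  qed
  then show ?thesis using c K ab by (intro exI[of _ "insert b K"] exI[of _ b]) (auto simp: good_def)
qed

section \<open>Separations and Menger's theorem for disjoint connected sets\<close>

definition sep :: "'a set set \<Rightarrow> 'a set \<Rightarrow> 'a set \<Rightarrow> 'a set \<Rightarrow> bool" where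
  "sep E V A B \<longleftrightarrow> A \<union> B = V \<and> (\<forall>a\<in>A - B. \<forall>b\<in>B - A. {a, b} \<notin> E)"

lemma sepD: "sep E V A B \<Longrightarrow> a \<in> A \<Longrightarrow> a \<notin> B \<Longrightarrow> b \<in> B \<Longrightarrow> b \<notin> A \<Longrightarrow> {a, b} \<notin> E"
  by (auto simp: sep_def)

lemma sepD': "sep E V A B \<Longrightarrow> a \<in> A \<Longrightarrow> a \<notin> B \<Longrightarrow> b \<in> B \<Longrightarrow> b \<notin> A \<Longrightarrow> {b, a} \<notin> E"
  by (auto simp: sep_def insert_commute)

text \<open>There are as many disjoint sets as targets, so by counting each set meets
  \<open>T\<close> in exactly one vertex and the targets can serve as indices.\<close>

lemma index_by_target:
  fixes Q :: "nat \<Rightarrow> 'a set"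
  assumes "finite T" "card T = k" and m: "\<And>i. i < k \<Longrightarrow> Q i \<inter> T \<noteq> {}"
    and d: "\<And>i j. i < k \<Longrightarrow> j < k \<Longrightarrow> i \<noteq> j \<Longrightarrow> Q i \<inter> Q j = {}"
  obtains h where "bij_betw h T {..<k}" "\<And>t. t \<in> T \<Longrightarrow> Q (h t) \<inter> T = {t}"
proof -
  have "\<forall>i. \<exists>x. i < k \<longrightarrow> x \<in> Q i \<inter> T" using m by blast
  then obtain f where f: "\<And>i. i < k \<Longrightarrow> f i \<in> Q i \<inter> T" by metis
  have inj: "inj_on f {..<k}" using f d by (auto simp: inj_on_def) (metis IntI empty_iff)
  have "f ` {..<k} = T"
    using f inj assms by (intro card_subset_eq) (auto simp: card_image)
  then have bij: "bij_betw f {..<k} T" using inj by (simp add: bij_betw_def)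
  define h where "h = inv_into {..<k} f"
  have hb: "bij_betw h T {..<k}" using bij by (simp add: h_def bij_betw_inv_into)
  have "Q (h t) \<inter> T = {t}" if t: "t \<in> T" for t
  proof -
    have ht: "h t < k" "f (h t) = t"
      using t bij hb by (auto simp: h_def bij_betw_def f_inv_into_f)
    have "s = t" if s: "s \<in> Q (h t)" "s \<in> T" for s
    proof -
      have hs: "h s < k" "f (h s) = s"
        using s bij hb by (auto simp: h_def bij_betw_def f_inv_into_f)
      then have "s \<in> Q (h s)" using f[of "h s"] by auto
      then have "h s = h t" using d[of "h s" "h t"] hs ht s by blast
      then show ?thesis using hs ht by metis
    qed
    moreover have "t \<in> Q (h t)" using f[of "h t"] ht by auto
    ultimately show ?thesis using t by blast
  qed
  then show ?thesis using that hb by blast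
qed

text \<open>Induction on the number of edges inside \<open>V\<close>, with connected sets in the
  place of paths. Delete an edge \<open>{x, y}\<close>. If this creates a separation
  \<open>(A, B)\<close> of order below \<open>k\<close>, adding \<open>x\<close> or \<open>y\<close>
  to \<open>A \<inter> B\<close> gives two sets of size \<open>k\<close>; the induction hypothesis
  leads from \<open>S\<close> to the first inside \<open>A\<close> and from the second to
  \<open>T\<close> inside \<open>B\<close>, and the families are glued.\<close>

lemma menger:
  fixes E :: "'a set set"
  assumes "finite V" "\<And>e. e \<in> E \<Longrightarrow> card e = 2" "S \<subseteq> V" "T \<subseteq> V"
    and "\<And>A B. sep E V A B \<Longrightarrow> S \<subseteq> A \<Longrightarrow> T \<subseteq> B \<Longrightarrow> k \<le> card (A \<inter> B)"
  shows "\<exists>Q :: nat \<Rightarrow> 'a set. (\<forall>i<k. Q i \<subseteq> V \<and> conn E (Q i) \<and> Q i \<inter> S \<noteq> {} \<and> Q i \<inter> T \<noteq> {}) \<and>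
           (\<forall>i<k. \<forall>j<k. i \<noteq> j \<longrightarrow> Q i \<inter> Q j = {})"
  using assms
proof (induction "card {e \<in> E. e \<subseteq> V}" arbitrary: E V S T rule: less_induct)
  case less
  note finV = less.prems(1) and two = less.prems(2) and ST = less.prems(3,4) and cut = less.prems(5)
  show ?case
  proof (cases "{e \<in> E. e \<subseteq> V} = {}")
    case True
    \<comment> \<open>Without edges this pair is a separation, and its order is
      \<open>card (S \<inter> T)\<close>; singletons then suffice.\<close>
    have "sep E V S (V - S \<union> T)" using True ST by (auto simp: sep_def)
    then have "k \<le> card (S \<inter> (V - S \<union> T))" using cut ST by blast
    also have "S \<inter> (V - S \<union> T) = S \<inter> T" by auto
    finally obtain W where W: "W \<subseteq> S \<inter> T" "card W = k"
      by (metis obtain_subset_with_card_n)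
    have "finite W" using W ST finV by (meson finite_subset le_infE)
    then obtain f where f: "bij_betw f {..<k} W"
      using W by (metis atLeast0LessThan ex_bij_betw_nat_finite)
    then have "inj_on f {..<k}" "\<And>i. i < k \<Longrightarrow> f i \<in> S \<inter> T" using W by (auto simp: bij_betw_def)
    then show ?thesis using ST by (intro exI[of _ "\<lambda>i. {f i}"]) (auto simp: inj_on_def)
  next
    case False
    then obtain e where e: "e \<in> E" "e \<subseteq> V" by auto
    define E' where "E' = E - {e}"
    have finE: "finite {e \<in> E. e \<subseteq> V}" using finV by simp
    have mono: "conn E C" if "conn E' C" for C using that by (rule conn_mono) (auto simp: E'_def)
    have smaller: "card {f \<in> E'. f \<subseteq> W} < card {f \<in> E. f \<subseteq> V}" if "W \<subseteq> V" for W
      using that e finE by (intro psubset_card_mono) (auto simp: E'_def)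
    have two': "card f = 2" if "f \<in> E'" for f using that two by (simp add: E'_def)
    show ?thesis
    proof (cases "\<forall>A B. sep E' V A B \<longrightarrow> S \<subseteq> A \<longrightarrow> T \<subseteq> B \<longrightarrow> k \<le> card (A \<inter> B)")
      case True
      then obtain Q :: "nat \<Rightarrow> 'a set" where
        "\<forall>i<k. Q i \<subseteq> V \<and> conn E' (Q i) \<and> Q i \<inter> S \<noteq> {} \<and> Q i \<inter> T \<noteq> {}"
        "\<forall>i<k. \<forall>j<k. i \<noteq> j \<longrightarrow> Q i \<inter> Q j = {}"
        using less.hyps[OF smaller[OF order_refl] finV two' ST] by blast
      then show ?thesis using mono by blast
    next
      case False
      then obtain A B where AB: "sep E' V A B" "S \<subseteq> A" "T \<subseteq> B" "card (A \<inter> B) < k"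
        by (auto simp: not_le)
      have "\<not> sep E V A B" using cut[of A B] AB by auto
      then obtain x y where xy: "x \<in> A" "x \<notin> B" "y \<in> B" "y \<notin> A" "{x, y} \<in> E"
        using AB(1) by (auto simp: sep_def)
      then have exy: "e = {x, y}" using AB(1) sepD[OF AB(1), of x y] by (auto simp: E'_def)
      have V: "V = A \<union> B" using AB by (auto simp: sep_def)
      have fA: "finite A" "finite B" using V finV by auto
      have noE: "a = x \<and> b = y" if "a \<in> A" "a \<notin> B" "b \<in> B" "b \<notin> A" "{a, b} \<in> E" for a b
      proof -
        have "{a, b} = {x, y}" using sepD[OF AB(1) that(1-4)] that(5) exy by (simp add: E'_def)
        then show ?thesis using that xy by (metis doubleton_eq_iff)
      qed
      \<comment> \<open>Putting \<open>y\<close> into both sides repairs the separation for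
        \<open>E\<close>, so the order of \<open>(A, B)\<close> is just one short of
        \<open>k\<close>.\<close>
      have "sep E V (insert y A) B"
        unfolding sep_def using noE xy(3) V by blast
      then have "k \<le> card (insert y A \<inter> B)" using cut AB by blast
      also have "insert y A \<inter> B = insert y (A \<inter> B)" using xy by auto
      also have "card \<dots> = Suc (card (A \<inter> B))" using xy fA by simp
      finally have kk: "card (A \<inter> B) + 1 = k" using AB by simp
      define P where "P = insert x (A \<inter> B)"
      define P' where "P' = insert y (A \<inter> B)"
      have cP: "card P = k" "card P' = k" "finite P" "finite P'"
        using kk xy fA by (auto simp: P_def P'_def)
      have "\<exists>Q :: nat \<Rightarrow> 'a set. (\<forall>i<k. Q i \<subseteq> A \<and> conn E' (Q i) \<and> Q i \<inter> S \<noteq> {} \<and> Q i \<inter> P \<noteq> {}) \<and>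
           (\<forall>i<k. \<forall>j<k. i \<noteq> j \<longrightarrow> Q i \<inter> Q j = {})"
      proof (rule less.hyps)
        show "card {f \<in> E'. f \<subseteq> A} < card {f \<in> E. f \<subseteq> V}" using smaller V by auto
        show "P \<subseteq> A" using xy by (auto simp: P_def)
        fix A1 B1 assume s: "sep E' A A1 B1" "S \<subseteq> A1" "P \<subseteq> B1"
        have AA: "A = A1 \<union> B1" using s by (auto simp: sep_def)
        have "sep E V A1 (B1 \<union> B)"
          unfolding sep_def
        proof (intro conjI ballI)
          show "A1 \<union> (B1 \<union> B) = V" using AA V by auto
          fix a b assume a: "a \<in> A1 - (B1 \<union> B)" and b: "b \<in> B1 \<union> B - A1"
          show "{a, b} \<notin> E"
          proof
            assume ab: "{a, b} \<in> E"
            show False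
            proof (cases "b \<in> A")
              case True
              then have "b \<in> B1" using b AA by auto
              then have "{a, b} \<notin> E'" using sepD[OF s(1), of a b] a b by auto
              then have "{a, b} = {x, y}" using ab exy by (simp add: E'_def)
              then show False using a b xy True AA by (metis DiffD1 DiffD2 UnCI doubleton_eq_iff)
            next
              case False
              then have "a = x" using noE[of a b] a b AA ab by auto
              then show False using a s by (auto simp: P_def)
            qed
          qed
        qed
        then have "k \<le> card (A1 \<inter> (B1 \<union> B))" using cut s AB by blast
        also have "A1 \<inter> (B1 \<union> B) = A1 \<inter> B1" using s AA by (auto simp: P_def)
        finally show "k \<le> card (A1 \<inter> B1)" .
      next
        fix f assume "f \<in> E'" then show "card f = 2" by (rule two')
      next
        show "finite A" by (rule fA)
      next
        show "S \<subseteq> A" by (rule AB(2))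
      qed
      then obtain Q1 :: "nat \<Rightarrow> 'a set" where
          Q1: "\<forall>i<k. Q1 i \<subseteq> A \<and> conn E' (Q1 i) \<and> Q1 i \<inter> S \<noteq> {} \<and> Q1 i \<inter> P \<noteq> {}"
        and Q1d: "\<forall>i<k. \<forall>j<k. i \<noteq> j \<longrightarrow> Q1 i \<inter> Q1 j = {}"
        by (elim exE conjE)
      note Q1 = Q1[rule_format] and Q1d = Q1d[rule_format]
      have "\<exists>Q :: nat \<Rightarrow> 'a set. (\<forall>i<k. Q i \<subseteq> B \<and> conn E' (Q i) \<and> Q i \<inter> P' \<noteq> {} \<and> Q i \<inter> T \<noteq> {}) \<and>
           (\<forall>i<k. \<forall>j<k. i \<noteq> j \<longrightarrow> Q i \<inter> Q j = {})"
      proof (rule less.hyps)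
        show "card {f \<in> E'. f \<subseteq> B} < card {f \<in> E. f \<subseteq> V}" using smaller V by auto
        show "P' \<subseteq> B" using xy by (auto simp: P'_def)
        fix A1 B1 assume s: "sep E' B A1 B1" "P' \<subseteq> A1" "T \<subseteq> B1"
        have AA: "B = A1 \<union> B1" using s by (auto simp: sep_def)
        have "sep E V (A \<union> A1) B1"
          unfolding sep_def
        proof (intro conjI ballI)
          show "A \<union> A1 \<union> B1 = V" using AA V by auto
          fix a b assume a: "a \<in> A \<union> A1 - B1" and b: "b \<in> B1 - (A \<union> A1)"
          show "{a, b} \<notin> E"
          proof
            assume ab: "{a, b} \<in> E"
            show False
            proof (cases "a \<in> B")
              case True
              then have "a \<in> A1" using a AA by auto
              then have "{a, b} \<notin> E'" using sepD[OF s(1), of a b] a b by auto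
              then have "{a, b} = {x, y}" using ab exy by (simp add: E'_def)
              then show False using a b xy True AA by (metis DiffD1 DiffD2 UnCI doubleton_eq_iff)
            next
              case False
              then have "b = y" using noE[of a b] a b AA ab by auto
              then show False using b s by (auto simp: P'_def)
            qed
          qed
        qed
        then have "k \<le> card ((A \<union> A1) \<inter> B1)" using cut s AB by blast
        also have "(A \<union> A1) \<inter> B1 = A1 \<inter> B1" using s AA by (auto simp: P'_def)
        finally show "k \<le> card (A1 \<inter> B1)" .
      next
        fix f assume "f \<in> E'" then show "card f = 2" by (rule two')
      next
        show "finite B" by (rule fA)
      next
        show "T \<subseteq> B" by (rule AB(3))
      qed
      then obtain Q2 :: "nat \<Rightarrow> 'a set" where
          Q2: "\<forall>i<k. Q2 i \<subseteq> B \<and> conn E' (Q2 i) \<and> Q2 i \<inter> P' \<noteq> {} \<and> Q2 i \<inter> T \<noteq> {}"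
        and Q2d: "\<forall>i<k. \<forall>j<k. i \<noteq> j \<longrightarrow> Q2 i \<inter> Q2 j = {}"
        by (elim exE conjE)
      note Q2 = Q2[rule_format] and Q2d = Q2d[rule_format]
      obtain h1 where h1: "bij_betw h1 P {..<k}" "\<And>t. t \<in> P \<Longrightarrow> Q1 (h1 t) \<inter> P = {t}"
        using index_by_target[of P k Q1] cP Q1 Q1d by auto
      obtain h2 where h2: "bij_betw h2 P' {..<k}" "\<And>t. t \<in> P' \<Longrightarrow> Q2 (h2 t) \<inter> P' = {t}"
        using index_by_target[of P' k Q2] cP Q2 Q2d by auto
      \<comment> \<open>The left family ends in \<open>P\<close> and the right one starts in
        \<open>P'\<close>. Both contain \<open>A \<inter> B\<close>, and \<open>x\<close> is matched
        with \<open>y\<close> across the deleted edge.\<close>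
      define s where "s t = (if t = x then y else t)" for t
      define R where "R t = Q1 (h1 t) \<union> Q2 (h2 (s t))" for t
      have sP: "s t \<in> P'" if "t \<in> P" for t using that by (auto simp: s_def P_def P'_def)
      have s_inj: "s t = s u \<Longrightarrow> t = u" if "t \<in> P" "u \<in> P" for t u
        using that xy by (auto simp: s_def P_def split: if_splits)
      have hk: "h1 t < k" "h2 (s t) < k" if "t \<in> P" for t
        using that sP[OF that] h1(1) h2(1) by (auto simp: bij_betw_def)
      have Rprop: "R t \<subseteq> V \<and> conn E (R t) \<and> R t \<inter> S \<noteq> {} \<and> R t \<inter> T \<noteq> {}" if t: "t \<in> P" for t
      proof -
        have a: "t \<in> Q1 (h1 t)" "s t \<in> Q2 (h2 (s t))" using h1(2)[OF t] h2(2)[OF sP[OF t]] by auto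
        have "conn E (R t)"
        proof (cases "t = x")
          case True
          then show ?thesis unfolding R_def
            using a hk[OF t] Q1 Q2 mono xy by (intro conn_Un_edge[of E _ _ x y]) (auto simp: s_def)
        next
          case False
          then show ?thesis unfolding R_def
            using a hk[OF t] Q1 Q2 mono xy by (intro conn_Un[of E _ _ t]) (auto simp: s_def)
        qed
        then show ?thesis using hk[OF t] Q1 Q2 V unfolding R_def by blast
      qed
      have Rdisj: "R t \<inter> R u = {}" if tu: "t \<in> P" "u \<in> P" "t \<noteq> u" for t u
      proof -
        have n1: "h1 t \<noteq> h1 u" using h1(1) tu by (auto simp: bij_betw_def inj_on_def)
        have n2: "h2 (s t) \<noteq> h2 (s u)"
          using h2(1) sP[OF tu(1)] sP[OF tu(2)] s_inj[OF tu(1,2)] tu(3) by (auto simp: bij_betw_def inj_on_def)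
        \<comment> \<open>A common vertex lies in \<open>A \<inter> B\<close>; it is then the only
          element of \<open>P\<close> in the left set and the only element of \<open>P'\<close> in
          the right one.\<close>
        have x12: "Q1 (h1 t) \<inter> Q2 (h2 (s u)) = {}" if tu: "t \<in> P" "u \<in> P" "t \<noteq> u" for t u
        proof -
          have "z = t \<and> z = s u" if "z \<in> Q1 (h1 t)" "z \<in> Q2 (h2 (s u))" for z
          proof -
            have "z \<in> A" "z \<in> B" using that Q1 Q2 hk tu by blast+
            then have "z \<in> P" "z \<in> P'" by (auto simp: P_def P'_def)
            then show ?thesis using that h1(2)[OF tu(1)] h2(2)[OF sP[OF tu(2)]] by blast
          qed
          moreover have "\<not> (t = s u)" using tu xy by (auto simp: s_def P_def split: if_splits)
          ultimately show ?thesis by blast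
        qed
        show ?thesis
          using Q1d[OF hk(1)[OF tu(1)] hk(1)[OF tu(2)] n1] Q2d[OF hk(2)[OF tu(1)] hk(2)[OF tu(2)] n2]
            x12[OF tu] x12[OF tu(2,1)] tu(3) unfolding R_def by blast
      qed
      obtain f where f: "bij_betw f {..<k} P"
        using cP by (metis atLeast0LessThan ex_bij_betw_nat_finite)
      then have "inj_on f {..<k}" "\<And>i. i < k \<Longrightarrow> f i \<in> P" by (auto simp: bij_betw_def)
      then show ?thesis using Rprop Rdisj
        by (intro exI[of _ "\<lambda>i. R (f i)"]) (simp add: inj_on_def, metis lessThan_iff)
    qed
  qed
qed

section \<open>Linkages in dense graphs\<close>

text \<open>Only parts with at least two elements count towards \<open>M\<close>. Singletons stay in
  the family because the sets of the other parts have to avoid them.\<close>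

definition parts :: "nat \<Rightarrow> 'a set \<Rightarrow> 'a set set \<Rightarrow> bool" where
  "parts M Z \<P> \<longleftrightarrow> (\<forall>P\<in>\<P>. P \<noteq> {} \<and> P \<subseteq> Z) \<and> pairwise disjnt \<P> \<and> card {P \<in> \<P>. 2 \<le> card P} \<le> M"

definition linkage :: "'a set set \<Rightarrow> 'a set \<Rightarrow> 'a set set \<Rightarrow> ('a set \<Rightarrow> 'a set) \<Rightarrow> bool" where
  "linkage E B \<P> C \<longleftrightarrow> (\<forall>P\<in>\<P>. P \<subseteq> C P \<and> C P \<subseteq> B \<and> conn E (C P)) \<and>
     (\<forall>P\<in>\<P>. \<forall>P'\<in>\<P>. P \<noteq> P' \<longrightarrow> C P \<inter> C P' = {})"

definition linked :: "nat \<Rightarrow> 'a set set \<Rightarrow> 'a set \<Rightarrow> 'a set \<Rightarrow> bool" where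
  "linked M E B Z \<longleftrightarrow> (\<forall>\<P>. parts M Z \<P> \<longrightarrow> (\<exists>C. linkage E B \<P> C))"

lemma parts_disjoint: "parts M Z \<P> \<Longrightarrow> P \<in> \<P> \<Longrightarrow> P' \<in> \<P> \<Longrightarrow> x \<in> P \<Longrightarrow> x \<in> P' \<Longrightarrow> P = P'"
  by (auto simp: parts_def pairwise_def disjnt_def)

text \<open>A vertex of \<open>Z\<close> in no part can be added as a singleton, which leaves the
  number of larger parts unchanged.\<close>

lemma linked_if_full:
  assumes "finite Z" and full: "\<And>\<P>. parts M Z \<P> \<Longrightarrow> \<Union>\<P> = Z \<Longrightarrow> \<exists>C. linkage E B \<P> C"
  shows "linked M E B Z"
  unfolding linked_def
proof (intro allI impI)
  fix \<P> assume p: "parts M Z \<P>"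
  define \<Q> where "\<Q> = \<P> \<union> (\<lambda>z. {z}) ` (Z - \<Union>\<P>)"
  have "{P \<in> \<Q>. 2 \<le> card P} = {P \<in> \<P>. 2 \<le> card P}" by (auto simp: \<Q>_def)
  moreover have "P \<inter> P' = {}" if "P \<in> \<Q>" "P' \<in> \<Q>" "P \<noteq> P'" for P P'
    using that parts_disjoint[OF p, of P P'] unfolding \<Q>_def by blast
  ultimately have "parts M Z \<Q>"
    using p unfolding parts_def by (auto simp: \<Q>_def pairwise_def disjnt_def)
  moreover have "\<Union>\<Q> = Z" using p by (auto simp: \<Q>_def parts_def)
  ultimately obtain C where "linkage E B \<Q> C" using full by blast
  then have "linkage E B \<P> C" by (auto simp: linkage_def \<Q>_def)
  then show "\<exists>C. linkage E B \<P> C" by (rule exI[of _ C])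
qed

text \<open>The weight of a part with \<open>g\<close> terminals: in an optimal partial linkage, an outside vertex
  has at most this many neighbours in the tree of that part.\<close>

definition omega :: "nat \<Rightarrow> nat" where
  "omega g = (if 2 \<le> g then Suc g else g)"

lemma omega_mono: "g \<le> h \<Longrightarrow> omega g \<le> omega h"
  by (auto simp: omega_def)

section \<open>Optimal partial linkages and their exchange properties\<close>

locale linking =
  fixes E :: "'a set set" and D Z :: "'a set" and \<P> :: "'a set set" and M Bd :: nat
  assumes finD: "finite D" and two: "\<And>e. e \<in> E \<Longrightarrow> card e = 2"
    and ZD: "Z \<subseteq> D" and parts: "parts M Z \<P>" and full: "\<Union>\<P> = Z" and ZBd: "card Z \<le> Bd"
begin

lemma finZ: "finite Z" using finD ZD finite_subset by blast

lemma finP: "finite \<P>" using finZ full finite_UnionD by blast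

lemma finPP: "P \<in> \<P> \<Longrightarrow> finite P" using finZ full by (metis Union_upper finite_subset)

lemma no_loop: "{v, w} \<in> E \<Longrightarrow> v \<noteq> w" using two by fastforce

text \<open>A partial linkage: a part of \<open>\<P>\<close> may still be spread over several
  components. \<open>Bd\<close> caps the total size. It will be either \<open>card D - 1\<close>,
  which keeps a vertex outside, or a lower bound for the degrees, which gives every vertex of the
  linkage a neighbour outside.\<close>

definition state :: "'a set set \<Rightarrow> bool" where
  "state \<C> \<longleftrightarrow> (\<forall>C\<in>\<C>. C \<subseteq> D \<and> conn E C \<and> C \<inter> Z \<noteq> {} \<and> (\<exists>P\<in>\<P>. C \<inter> Z \<subseteq> P)) \<and>
     pairwise disjnt \<C> \<and> Z \<subseteq> \<Union>\<C> \<and> card (\<Union>\<C>) \<le> Bd"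

text \<open>The weight \<open>Suc (card D)\<close> exceeds every possible total size, so the
  comparison is lexicographic: few components come before few vertices.\<close>

definition opt :: "'a set set \<Rightarrow> bool" where
  "opt \<C> \<longleftrightarrow> state \<C> \<and> (\<forall>\<C>'. state \<C>' \<longrightarrow>
     card \<C> * Suc (card D) + card (\<Union>\<C>) \<le> card \<C>' * Suc (card D) + card (\<Union>\<C>'))"

lemma ex_opt: "\<exists>\<C>. opt \<C>"
proof -
  have "state ((\<lambda>z. {z}) ` Z)"
    using ZD full ZBd by (auto simp: state_def pairwise_def disjnt_def)
  then show ?thesis
    unfolding opt_def
    using ex_has_least_nat[of state _ "\<lambda>\<C>. card \<C> * Suc (card D) + card (\<Union>\<C>)"] by blast
qed

lemma state_sub: "state \<C> \<Longrightarrow> \<Union>\<C> \<subseteq> D"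
  by (auto simp: state_def)

lemma state_fin: assumes "state \<C>" shows "finite \<C>" "finite (\<Union>\<C>)" "C \<in> \<C> \<Longrightarrow> finite C"
proof -
  show "finite (\<Union>\<C>)" using state_sub[OF assms] finD finite_subset by blast
  then show "finite \<C>" "C \<in> \<C> \<Longrightarrow> finite C" by (auto dest: finite_UnionD intro: finite_subset)
qed

lemma state_size: "state \<C> \<Longrightarrow> card (\<Union>\<C>) \<le> Bd"
  unfolding state_def by blast

lemma state_conn: "state \<C> \<Longrightarrow> C \<in> \<C> \<Longrightarrow> conn E C"
  unfolding state_def by blast

lemma state_ne: "state \<C> \<Longrightarrow> C \<in> \<C> \<Longrightarrow> C \<inter> Z \<noteq> {}"
  unfolding state_def by blast

lemma state_cover: "state \<C> \<Longrightarrow> Z \<subseteq> \<Union>\<C>"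
  unfolding state_def by blast

lemma part_sub: "P \<in> \<P> \<Longrightarrow> P \<subseteq> Z"
  using full by blast

lemma state_disj:
  assumes "state \<C>" "C \<in> \<C>" "C' \<in> \<C>" "C \<noteq> C'" shows "C \<inter> C' = {}"
proof -
  have "pairwise disjnt \<C>" using assms(1) by (simp add: state_def)
  then have "disjnt C C'" using assms by (simp add: pairwiseD)
  then show ?thesis by (simp add: disjnt_def)
qed

lemma state_colour: "state \<C> \<Longrightarrow> C \<in> \<C> \<Longrightarrow> \<exists>P\<in>\<P>. C \<inter> Z \<subseteq> P"
  unfolding state_def by blast

lemma state_rest: "state \<C> \<Longrightarrow> \<A> \<subseteq> \<C> \<Longrightarrow> \<Union>\<A> \<inter> \<Union>(\<C> - \<A>) = {}"
  using state_disj by blast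

lemma opt_state: "opt \<C> \<Longrightarrow> state \<C>" by (simp add: opt_def)

lemma opt_card_le:
  assumes "opt \<C>" "state \<C>'" shows "card \<C> \<le> card \<C>'"
proof (rule ccontr)
  assume "\<not> ?thesis"
  then have "Suc (card \<C>') * Suc (card D) \<le> card \<C> * Suc (card D)" by (intro mult_le_mono1) simp
  moreover have "card (\<Union>\<C>') \<le> card D" using state_sub[OF assms(2)] finD by (rule card_mono[rotated])
  moreover have "card \<C> * Suc (card D) + card (\<Union>\<C>) \<le> card \<C>' * Suc (card D) + card (\<Union>\<C>')"
    using assms unfolding opt_def by blast
  ultimately show False by simp
qed

lemma opt_size_le:
  assumes "opt \<C>" "state \<C>'" "card \<C>' \<le> card \<C>" shows "card (\<Union>\<C>) \<le> card (\<Union>\<C>')"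
proof -
  have "card \<C>' = card \<C>" using assms opt_card_le by (metis le_antisym)
  then show ?thesis using assms unfolding opt_def by (metis add_le_cancel_left)
qed

text \<open>The exchange behind all properties of optimal states: components of one colour give way
  to a single connected set \<open>U\<close> that keeps their terminals. The assumption
  \<open>sz\<close> says that the new total size still respects \<open>Bd\<close>.\<close>

lemma replace:
  assumes st: "state \<C>" and sub: "\<C>1 \<subseteq> \<C>" "\<C>1 \<noteq> {}"
    and P: "P \<in> \<P>" "\<And>C. C \<in> \<C>1 \<Longrightarrow> C \<inter> Z \<subseteq> P"
    and U: "U \<subseteq> D" "conn E U" "U \<inter> \<Union>(\<C> - \<C>1) = {}" "Z \<inter> \<Union>\<C>1 \<subseteq> U"
    and sz: "card (\<Union>\<C>) + card U \<le> Bd + card (\<Union>\<C>1)"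
  shows "state (insert U (\<C> - \<C>1))" (is "state ?N")
    and "card (insert U (\<C> - \<C>1)) + card \<C>1 = Suc (card \<C>)"
    and "card (\<Union>(insert U (\<C> - \<C>1))) + card (\<Union>\<C>1) = card (\<Union>\<C>) + card U"
proof -
  note f = state_fin[OF st]
  have dis: "\<Union>\<C>1 \<inter> \<Union>(\<C> - \<C>1) = {}" by (rule state_rest[OF st sub(1)])
  have un: "\<Union>\<C> = \<Union>\<C>1 \<union> \<Union>(\<C> - \<C>1)" using sub by auto
  have fin': "finite (\<Union>\<C>1)" "finite (\<Union>(\<C> - \<C>1))" using f(2) un by (metis finite_Un)+
  have "finite U" using U finD finite_subset by blast
  then have eq1: "card (\<Union>?N) = card U + card (\<Union>(\<C> - \<C>1))"
    using U(3) fin' by (simp add: card_Un_disjoint)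
  have eq2: "card (\<Union>\<C>) = card (\<Union>\<C>1) + card (\<Union>(\<C> - \<C>1))"
    using dis fin' un by (metis card_Un_disjoint)
  show 3: "card (\<Union>?N) + card (\<Union>\<C>1) = card (\<Union>\<C>) + card U" using eq1 eq2 by simp
  have "Z \<subseteq> \<Union>\<C>1 \<union> \<Union>(\<C> - \<C>1)" using st un by (simp add: state_def)
  then have UZ: "U \<inter> Z = Z \<inter> \<Union>\<C>1" using U(3,4) by blast
  have "Z \<inter> \<Union>\<C>1 \<noteq> {}" using st sub unfolding state_def by blast
  then have Une: "U \<inter> Z \<noteq> {}" using UZ by simp
  have "U \<notin> \<C> - \<C>1" using Une U(3) by blast
  then have "card ?N = Suc (card (\<C> - \<C>1))" using f by simp
  moreover have "card \<C> = card \<C>1 + card (\<C> - \<C>1)"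
    using sub f by (metis card_Diff_subset card_mono finite_subset le_add_diff_inverse)
  ultimately show "card ?N + card \<C>1 = Suc (card \<C>)" by simp
  have ZC: "Z \<subseteq> \<Union>\<C>" and pw: "pairwise disjnt \<C>" using st by (auto simp: state_def)
  have "U \<inter> Z \<subseteq> P"
  proof
    fix x assume "x \<in> U \<inter> Z"
    then obtain C where "C \<in> \<C>1" "x \<in> C \<inter> Z" using UZ by blast
    then show "x \<in> P" using P(2)[of C] by blast
  qed
  then have 4: "\<exists>P\<in>\<P>. U \<inter> Z \<subseteq> P" using P(1) by blast
  have "disjnt U C \<and> disjnt C U" if "C \<in> \<C> - \<C>1" for C
    using U(3) that unfolding disjnt_def by blast
  moreover have "pairwise disjnt (\<C> - \<C>1)" using pw by (rule pairwise_subset) auto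
  ultimately have 5: "pairwise disjnt ?N" by (simp add: pairwise_insert)
  have "Z \<subseteq> (Z \<inter> \<Union>\<C>1) \<union> \<Union>(\<C> - \<C>1)" using ZC un by blast
  then have 6: "Z \<subseteq> \<Union>?N" using U(4) by auto
  have 7: "card (\<Union>?N) \<le> Bd" using 3 sz by simp
  have "C \<subseteq> D \<and> conn E C \<and> C \<inter> Z \<noteq> {} \<and> (\<exists>P\<in>\<P>. C \<inter> Z \<subseteq> P)" if "C \<in> ?N" for C
  proof (cases "C = U")
    case True then show ?thesis using U(1,2) Une 4 by simp
  next
    case False
    then have "C \<in> \<C>" using that by simp
    then show ?thesis using st unfolding state_def by blast
  qed
  then show "state ?N" using 5 6 7 unfolding state_def by blast
qed

text \<open>Merging would lower the number of components, so in an optimal state only the cap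
  \<open>Bd\<close> can forbid it.\<close>

lemma opt_merge:
  assumes "opt \<C>" "\<C>1 \<subseteq> \<C>" "2 \<le> card \<C>1"
    and "P \<in> \<P>" "\<And>C. C \<in> \<C>1 \<Longrightarrow> C \<inter> Z \<subseteq> P"
    and "U \<subseteq> D" "conn E U" "U \<inter> \<Union>(\<C> - \<C>1) = {}" "Z \<inter> \<Union>\<C>1 \<subseteq> U"
  shows "Bd + card (\<Union>\<C>1) < card (\<Union>\<C>) + card U"
proof (rule ccontr)
  assume "\<not> ?thesis"
  then have sz: "card (\<Union>\<C>) + card U \<le> Bd + card (\<Union>\<C>1)" by simp
  have ne: "\<C>1 \<noteq> {}" using assms(3) by auto
  note r = replace[OF opt_state[OF assms(1)] assms(2) ne assms(4-9) sz]
  show False using opt_card_le[OF assms(1) r(1)] r(2) assms(3) by simp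
qed

text \<open>Exchanging one component for another keeps their number, so the second criterion, the
  total size, decides.\<close>

lemma opt_shrink:
  assumes "opt \<C>" "C \<in> \<C>" "U \<subseteq> D" "conn E U" "U \<inter> \<Union>(\<C> - {C}) = {}" "Z \<inter> C \<subseteq> U"
  shows "card C \<le> card U"
proof (rule ccontr)
  assume a: "\<not> ?thesis"
  have st: "state \<C>" using assms opt_state by blast
  obtain P where P: "P \<in> \<P>" "C \<inter> Z \<subseteq> P" using state_colour[OF st assms(2)] by blast
  have sz: "card (\<Union>\<C>) + card U \<le> Bd + card (\<Union>{C})" using a st by (simp add: state_def)
  have "\<And>C'. C' \<in> {C} \<Longrightarrow> C' \<inter> Z \<subseteq> P" "{C} \<subseteq> \<C>" "{C} \<noteq> {}" "Z \<inter> \<Union>{C} \<subseteq> U" using P assms by auto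
  note r = replace[OF st this(2,3) P(1) this(1) assms(3-5) this(4) sz]
  show False using opt_size_le[OF assms(1) r(1)] r(2,3) a by simp
qed

lemma opt_single:
  assumes "opt \<C>" "C \<in> \<C>" "card (C \<inter> Z) = 1" shows "card C \<le> 1"
proof -
  have st: "state \<C>" using assms opt_state by blast
  obtain z where z: "C \<inter> Z = {z}" using assms(3) card_1_singletonE by blast
  have "card C \<le> card {z}"
  proof (rule opt_shrink[OF assms(1,2)])
    show "{z} \<subseteq> D" "Z \<inter> C \<subseteq> {z}" using z ZD by auto
    show "{z} \<inter> \<Union>(\<C> - {C}) = {}" using state_rest[OF st, of "{C}"] z assms(2) by blast
  qed simp
  then show ?thesis by simp
qed

text \<open>A component of a state that meets a part has all its terminals in it, so meeting
  \<open>P\<close> is enough to give a component the colour \<open>P\<close>.\<close>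

definition col :: "'a set set \<Rightarrow> 'a set \<Rightarrow> 'a set set" where
  "col \<C> P = {C \<in> \<C>. C \<inter> P \<noteq> {}}"

lemma colD:
  assumes "state \<C>" "P \<in> \<P>" "C \<in> col \<C> P"
  shows "C \<in> \<C>" "C \<inter> Z \<subseteq> P" "C \<inter> Z = C \<inter> P" "C \<inter> P \<noteq> {}"
proof -
  show C: "C \<in> \<C>" and ne: "C \<inter> P \<noteq> {}" using assms by (auto simp: col_def)
  obtain P' where P': "P' \<in> \<P>" "C \<inter> Z \<subseteq> P'" using state_colour[OF assms(1) C] by blast
  have "P \<subseteq> Z" using assms(2) full by auto
  then have "P = P'" using ne P' parts_disjoint[OF parts assms(2) P'(1)] by blast
  then show "C \<inter> Z \<subseteq> P" "C \<inter> Z = C \<inter> P" using P' \<open>P \<subseteq> Z\<close> by auto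
qed

lemma col_ex:
  assumes "state \<C>" "C \<in> \<C>" shows "\<exists>P\<in>\<P>. C \<in> col \<C> P"
proof -
  obtain x where x: "x \<in> C" "x \<in> Z" using state_ne[OF assms] by blast
  then obtain P where "P \<in> \<P>" "x \<in> P" using full by blast
  then show ?thesis using x assms(2) unfolding col_def by blast
qed

lemma col_disjoint:
  assumes st: "state \<C>" and P: "P \<in> \<P>" "P' \<in> \<P>" "P \<noteq> P'"
  shows "\<Union>(col \<C> P) \<inter> \<Union>(col \<C> P') = {}"
proof -
  have False if C: "C \<in> col \<C> P" "C' \<in> col \<C> P'" "x \<in> C" "x \<in> C'" for C C' x
  proof -
    have "C = C'" using state_disj[OF st colD(1)[OF st P(1) C(1)] colD(1)[OF st P(2) C(2)]] C(3,4)
      by blast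
    then obtain y where "y \<in> C \<inter> Z" "y \<in> P" "y \<in> P'"
      using colD(3,4)[OF st P(1) C(1)] colD(3)[OF st P(2) C(2)] by blast
    then show False using parts_disjoint[OF parts P(1,2)] P(3) by blast
  qed
  then show ?thesis by blast
qed

lemma Un_col:
  assumes "state \<C>" shows "(\<Union>P\<in>\<P>. \<Union>(col \<C> P)) = \<Union>\<C>"
proof
  show "\<Union>\<C> \<subseteq> (\<Union>P\<in>\<P>. \<Union>(col \<C> P))"
  proof
    fix x assume "x \<in> \<Union>\<C>"
    then obtain C where C: "C \<in> \<C>" "x \<in> C" by blast
    obtain P where "P \<in> \<P>" "C \<in> col \<C> P" using col_ex[OF assms C(1)] by blast
    then show "x \<in> (\<Union>P\<in>\<P>. \<Union>(col \<C> P))" using C(2) by blast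
  qed
qed (auto simp: col_def)

lemma fin_col: "state \<C> \<Longrightarrow> finite (\<Union>(col \<C> P))"
  by (rule finite_subset[OF _ state_fin(2)]) (auto simp: col_def)

lemma size_eq: "state \<C> \<Longrightarrow> card (\<Union>\<C>) = (\<Sum>P\<in>\<P>. card (\<Union>(col \<C> P)))"
  using Un_col[of \<C>] card_UN_disjoint[of \<P> "\<lambda>P. \<Union>(col \<C> P)"] finP fin_col col_disjoint by simp

text \<open>Attach \<open>v\<close> to the touched components of colour \<open>P\<close> and prune
  around \<open>v\<close> down to their terminals. With \<open>l\<close> neighbours and
  \<open>g\<close> terminals the result has at least \<open>l - g - 1\<close> vertices fewer than
  these components together. For two or more components this is a merge within the cap if
  \<open>l > g\<close>; for a single one it is a shrinking if \<open>l > g + 1\<close>. A component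
  with one terminal is a single vertex, which settles \<open>g = 1\<close>. This is the origin of
  \<open>omega\<close>.\<close>

lemma nb_touched:
  assumes o: "opt \<C>" and v: "v \<in> D - \<Union>\<C>" and P: "P \<in> \<P>"
    and A: "A = {C \<in> col \<C> P. \<exists>w\<in>C. {v, w} \<in> E}"
  shows "card {w \<in> \<Union>(col \<C> P). {v, w} \<in> E} \<le> omega (card (P \<inter> \<Union>A))"
proof (cases "A = {}")
  case True
  then have "{w \<in> \<Union>(col \<C> P). {v, w} \<in> E} = {}" using A by blast
  then show ?thesis by (simp only: card.empty)
next
  case False
  have st: "state \<C>" using o opt_state by blast
  have A\<C>: "A \<subseteq> \<C>" using A by (auto simp: col_def)
  have finA: "finite A" "finite (\<Union>A)" using state_fin[OF st] A\<C> by (auto intro: finite_subset)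
  have PZ: "P \<subseteq> Z" using P full by auto
  define U where "U = {v} \<union> (\<Union>C\<in>A. C)"
  have vA: "v \<notin> \<Union>A" using v A\<C> by auto
  have cU: "conn E U" unfolding U_def
    by (rule conn_UN) (use A st in \<open>auto simp: state_def col_def\<close>)
  have UD: "U \<subseteq> D" using v A\<C> state_sub[OF st] by (auto simp: U_def)
  then have fU: "finite U" using finD finite_subset by blast
  have "P \<inter> \<Union>A \<subseteq> U - {v}" using vA by (auto simp: U_def)
  then obtain U' where U': "U' \<subseteq> U" "conn E U'" "v \<in> U'" "P \<inter> \<Union>A \<subseteq> U'"
    "card U' + card {w \<in> U - {v}. {v, w} \<in> E} \<le> card U + card (P \<inter> \<Union>A)"
    using conn_prune[OF cU fU, of v "P \<inter> \<Union>A"] by (auto simp: U_def)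
  have eq: "{w \<in> U - {v}. {v, w} \<in> E} = {w \<in> \<Union>(col \<C> P). {v, w} \<in> E}"
    using A vA no_loop by (auto simp: U_def)
  have cardU: "card U = Suc (card (\<Union>A))" using vA finA by (simp add: U_def)
  let ?l = "card {w \<in> \<Union>(col \<C> P). {v, w} \<in> E}" and ?g = "card (P \<inter> \<Union>A)"
  have 1: "card U' + ?l \<le> Suc (card (\<Union>A)) + ?g" using U'(5) eq cardU by simp
  have mono: "C \<inter> Z \<subseteq> P" if "C \<in> A" for C using colD(2)[OF st P] that A by auto
  have disU: "U' \<inter> \<Union>(\<C> - A) = {}"
  proof -
    have "\<Union>A \<inter> \<Union>(\<C> - A) = {}" by (rule state_rest[OF st A\<C>])
    moreover have "v \<notin> \<Union>(\<C> - A)" using v by blast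
    moreover have "U' \<subseteq> insert v (\<Union>A)" using U'(1) by (simp add: U_def)
    ultimately show ?thesis by blast
  qed
  have ZU: "Z \<inter> \<Union>A \<subseteq> U'" using U'(4) mono by blast
  show ?thesis
  proof (cases "2 \<le> card A")
    case True
    have "Bd + card (\<Union>A) < card (\<Union>\<C>) + card U'"
      by (rule opt_merge[OF o A\<C> True P mono _ U'(2) disU ZU]) (use UD U'(1) in blast)+
    then have "?l \<le> ?g" using 1 st by (simp add: state_def)
    then show ?thesis by (simp add: omega_def)
  next
    case False
    moreover have "card A \<noteq> 0" using \<open>A \<noteq> {}\<close> finA(1) by simp
    ultimately have "card A = 1" by linarith
    then obtain C where C: "A = {C}" using card_1_singletonE by blast
    have "card C \<le> card U'"
    proof (rule opt_shrink[OF o _ _ U'(2)])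
      show "C \<in> \<C>" using C A\<C> by simp
      show "U' \<subseteq> D" using UD U'(1) by simp
      show "U' \<inter> \<Union>(\<C> - {C}) = {}" using disU C by simp
      show "Z \<inter> C \<subseteq> U'" using ZU C by simp
    qed
    then have 2: "?l \<le> Suc ?g" using 1 C by simp
    have "C \<in> col \<C> P" using C A by blast
    then have PC: "P \<inter> \<Union>A = C \<inter> Z" using colD(3)[OF st P] C by (simp add: Int_commute)
    show ?thesis
    proof (cases "2 \<le> ?g")
      case True then show ?thesis using 2 by (simp add: omega_def)
    next
      case False
      have "C \<inter> Z \<noteq> {}" using C A\<C> state_ne[OF st] by blast
      then have "?g > 0" using PC finZ by (simp add: card_gt_0_iff)
      then have g1: "?g = 1" using False by simp
      then have "card C \<le> 1" using opt_single[OF o, of C] C A\<C> PC by auto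
      moreover have "?l \<le> card C"
        using C A finA by (intro card_mono) auto
      ultimately show ?thesis using g1 by (simp add: omega_def)
    qed
  qed
qed

lemma nb_colour:
  assumes "opt \<C>" "v \<in> D - \<Union>\<C>" "P \<in> \<P>"
  shows "card {w \<in> \<Union>(col \<C> P). {v, w} \<in> E} \<le> omega (card P)"
proof -
  have "card (P \<inter> Q) \<le> card P" for Q using finPP[OF assms(3)] by (simp add: card_mono)
  then show ?thesis using nb_touched[OF assms refl] omega_mono by (meson le_trans)
qed

text \<open>Only terminals of \<open>C\<close> are touched here. Both bounds in the minimum are
  needed later: the size of \<open>C\<close> is compared with the size of the linkage, the weight
  with \<open>card Z + M\<close>.\<close>

lemma nb_colour_comp:
  assumes "opt \<C>" "v \<in> D - \<Union>\<C>" "P \<in> \<P>" "C \<in> col \<C> P"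
    and only: "\<And>C' w. C' \<in> col \<C> P \<Longrightarrow> C' \<noteq> C \<Longrightarrow> w \<in> C' \<Longrightarrow> {v, w} \<notin> E"
  shows "card {w \<in> \<Union>(col \<C> P). {v, w} \<in> E} \<le> min (card C) (omega (card (C \<inter> Z)))"
proof -
  have st: "state \<C>" using assms opt_state by blast
  define A where "A = {C \<in> col \<C> P. \<exists>w\<in>C. {v, w} \<in> E}"
  have "A \<subseteq> {C}" using only by (auto simp: A_def)
  then have "P \<inter> \<Union>A \<subseteq> C \<inter> Z" using assms(3) full by auto
  then have "card (P \<inter> \<Union>A) \<le> card (C \<inter> Z)" using finZ by (intro card_mono) auto
  then have "card {w \<in> \<Union>(col \<C> P). {v, w} \<in> E} \<le> omega (card (C \<inter> Z))"
    using nb_touched[OF assms(1-3) A_def] omega_mono by (meson le_trans)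
  moreover have "card {w \<in> \<Union>(col \<C> P). {v, w} \<in> E} \<le> card C"
    using only state_fin(3)[OF st, of C] assms(4) by (intro card_mono) (auto simp: col_def)
  ultimately show ?thesis by simp
qed

lemma nb_sum:
  assumes "state \<C>"
  shows "card {w \<in> \<Union>\<C>. {v, w} \<in> E} \<le> (\<Sum>P\<in>\<P>. card {w \<in> \<Union>(col \<C> P). {v, w} \<in> E})"
proof -
  have eq: "{w \<in> \<Union>\<C>. {v, w} \<in> E} = (\<Union>P\<in>\<P>. {w \<in> \<Union>(col \<C> P). {v, w} \<in> E})"
    unfolding Un_col[OF assms, symmetric] by blast
  show ?thesis unfolding eq by (rule card_UN_le[OF finP])
qed

text \<open>The excess of \<open>omega\<close> is one for each part with at least two elements;
  hence the term \<open>card Z + M\<close> in all later bounds.\<close>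

lemma sum_omega: "(\<Sum>P\<in>\<P>. omega (card P)) \<le> card Z + M"
proof -
  have "(\<Sum>P\<in>\<P>. omega (card P)) = (\<Sum>P\<in>\<P>. card P + (if 2 \<le> card P then 1 else 0))"
    by (intro sum.cong) (auto simp: omega_def)
  also have "\<dots> = (\<Sum>P\<in>\<P>. card P) + card {P \<in> \<P>. 2 \<le> card P}"
    using finP by (simp add: sum.distrib sum.If_cases Int_def)
  also have "(\<Sum>P\<in>\<P>. card P) = card Z"
    using card_Union_disjoint[of \<P>] parts finPP full by (simp add: parts_def)
  finally show ?thesis using parts by (simp add: parts_def)
qed

lemma nb_total:
  assumes "opt \<C>" "v \<in> D - \<Union>\<C>"
  shows "card {w \<in> \<Union>\<C>. {v, w} \<in> E} \<le> card Z + M"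
proof -
  have "card {w \<in> \<Union>\<C>. {v, w} \<in> E} \<le> (\<Sum>P\<in>\<P>. omega (card P))"
    using nb_sum[OF opt_state[OF assms(1)], of v] sum_mono[of \<P>, OF nb_colour[OF assms]]
    by (meson le_trans)
  then show ?thesis using sum_omega by simp
qed

text \<open>Since \<open>Z\<close> is covered, a part with only one component lies inside it. So a
  partition that cannot be linked has two components of one colour in every state.\<close>

lemma linkage_if_unsplit:
  assumes st: "state \<C>" and un: "\<And>P C C'. P \<in> \<P> \<Longrightarrow> C \<in> col \<C> P \<Longrightarrow> C' \<in> col \<C> P \<Longrightarrow> C = C'"
  shows "\<exists>C. linkage E D \<P> C"
proof -
  have "\<exists>C. P \<subseteq> C \<and> C \<in> col \<C> P" if P: "P \<in> \<P>" for P
  proof -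
    obtain x where x: "x \<in> P" using P parts unfolding parts_def by blast
    have PC: "P \<subseteq> \<Union>\<C>" using part_sub[OF P] state_cover[OF st] by (rule subset_trans)
    have "\<exists>C. C \<in> col \<C> P" using x PC unfolding col_def by blast
    then obtain C where C: "C \<in> col \<C> P" ..
    have "P \<subseteq> C"
    proof
      fix x assume "x \<in> P"
      then obtain C' where "C' \<in> col \<C> P" "x \<in> C'" using PC unfolding col_def by blast
      then show "x \<in> C" using un[OF P _ C] by blast
    qed
    then show ?thesis using C by blast
  qed
  then obtain F where F: "\<And>P. P \<in> \<P> \<Longrightarrow> P \<subseteq> F P \<and> F P \<in> col \<C> P" by metis
  have "linkage E D \<P> F" unfolding linkage_def
  proof (intro conjI ballI impI)
    fix P assume P: "P \<in> \<P>"
    show "P \<subseteq> F P" "F P \<subseteq> D" "conn E (F P)" using F[OF P] st by (auto simp: col_def state_def)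
    fix P' assume P': "P' \<in> \<P>" "P \<noteq> P'"
    show "F P \<inter> F P' = {}" using col_disjoint[OF st P P'] F[OF P] F[OF P'(1)] by blast
  qed
  then show ?thesis by (rule exI[of _ F])
qed

text \<open>An outside set \<open>F\<close> that connects two components of one colour would merge
  them, so there is no room for \<open>F\<close> below \<open>Bd\<close>.\<close>

lemma opt_join:
  assumes o: "opt \<C>" and P: "P \<in> \<P>" and C: "C \<in> col \<C> P" "C' \<in> col \<C> P" "C \<noteq> C'"
    and F: "F \<subseteq> D - \<Union>\<C>" and c: "conn E (C \<union> C' \<union> F)"
  shows "Bd < card (\<Union>\<C>) + card F"
proof -
  have st: "state \<C>" using o opt_state by blast
  note c1 = colD[OF st P C(1)] and c2 = colD[OF st P C(2)]
  have dis: "C \<inter> C' = {}" by (rule state_disj[OF st c1(1) c2(1) C(3)])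
  have fin: "finite C" "finite C'" "finite F"
    using state_fin(3)[OF st] c1(1) c2(1) F finD by (auto intro: finite_subset)
  have sub: "C \<subseteq> D" "C' \<subseteq> D" using st c1 c2 by (auto simp: state_def)
  have d2: "(C \<union> C' \<union> F) \<inter> \<Union>(\<C> - {C, C'}) = {}"
    using F c1(1) c2(1) state_rest[OF st, of "{C, C'}"] by blast
  have "Bd + card (\<Union>{C, C'}) < card (\<Union>\<C>) + card (C \<union> C' \<union> F)"
  proof (rule opt_merge[OF o _ _ P])
    show "{C, C'} \<subseteq> \<C>" "2 \<le> card {C, C'}" using c1 c2 C(3) by auto
    show "\<And>Ca. Ca \<in> {C, C'} \<Longrightarrow> Ca \<inter> Z \<subseteq> P" using c1(2) c2(2) by auto
    show "C \<union> C' \<union> F \<subseteq> D" using F sub by auto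
    show "conn E (C \<union> C' \<union> F)" by (rule c)
    show "(C \<union> C' \<union> F) \<inter> \<Union>(\<C> - {C, C'}) = {}" by (rule d2)
    show "Z \<inter> \<Union>{C, C'} \<subseteq> C \<union> C' \<union> F" by auto
  qed
  moreover have "card (C \<union> C' \<union> F) = card (C \<union> C') + card F"
    using fin F c1(1) c2(1) by (intro card_Un_disjoint) auto
  ultimately show ?thesis by simp
qed

text \<open>Bounds the neighbours of an outside vertex in the colours other than \<open>P\<close>.
  Together with \<open>piece_bound C\<close> it sharpens \<open>card Z + M\<close> for vertices that
  see the colour \<open>P\<close> in at most the component \<open>C\<close>.\<close>

definition others_bound :: "'a set set \<Rightarrow> 'a set \<Rightarrow> nat" where
  "others_bound \<C> P = (\<Sum>P'\<in>\<P> - {P}. min (card (\<Union>(col \<C> P'))) (omega (card P')))"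

definition piece_bound :: "'a set \<Rightarrow> nat" where
  "piece_bound C = min (card C) (omega (card (C \<inter> Z)))"

lemma nb_split:
  assumes "opt \<C>" "v \<in> D - \<Union>\<C>" "P \<in> \<P>" "C \<in> col \<C> P"
    and "\<And>C' w. C' \<in> col \<C> P \<Longrightarrow> C' \<noteq> C \<Longrightarrow> w \<in> C' \<Longrightarrow> {v, w} \<notin> E"
  shows "card {w \<in> \<Union>\<C>. {v, w} \<in> E} \<le> others_bound \<C> P + piece_bound C"
proof -
  have st: "state \<C>" using assms opt_state by blast
  let ?n = "\<lambda>P. card {w \<in> \<Union>(col \<C> P). {v, w} \<in> E}"
  have "card {w \<in> \<Union>\<C>. {v, w} \<in> E} \<le> (\<Sum>P\<in>\<P>. ?n P)" by (rule nb_sum[OF st])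
  also have "\<dots> = ?n P + (\<Sum>P'\<in>\<P> - {P}. ?n P')" using finP assms(3) by (rule sum.remove)
  also have "?n P \<le> piece_bound C" unfolding piece_bound_def by (rule nb_colour_comp[OF assms])
  also have "(\<Sum>P'\<in>\<P> - {P}. ?n P') \<le> others_bound \<C> P" unfolding others_bound_def
  proof (intro sum_mono)
    fix P' assume P': "P' \<in> \<P> - {P}"
    have "?n P' \<le> card (\<Union>(col \<C> P'))" using fin_col[OF st] by (intro card_mono) auto
    then show "?n P' \<le> min (card (\<Union>(col \<C> P'))) (omega (card P'))"
      using nb_colour[OF assms(1,2)] P' by auto
  qed
  finally show ?thesis by simp
qed

text \<open>The first inequality compares with the sizes of the components, the others with their
  terminals. Both components contain a terminal, so the split part has at least two of them and
  weight \<open>card P + 1\<close>. The last inequality uses \<open>omega g + 1 \<le> 2 * g\<close>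
  for \<open>g \<ge> 1\<close> and serves for averaging over \<open>C\<close> and
  \<open>C'\<close>.\<close>

lemma split_arith:
  assumes st: "state \<C>" and P: "P \<in> \<P>" and C: "C \<in> col \<C> P" "C' \<in> col \<C> P" "C \<noteq> C'"
  shows "others_bound \<C> P + piece_bound C + piece_bound C' \<le> card (\<Union>\<C>)"
    and "others_bound \<C> P + 3 \<le> card Z + M"
    and "others_bound \<C> P + piece_bound C + 1 \<le> card Z + M"
    and "3 * others_bound \<C> P + piece_bound C + piece_bound C' + 7 \<le> 3 * (card Z + M)"
proof -
  note c1 = colD[OF st P C(1)] and c2 = colD[OF st P C(2)]
  have dis: "C \<inter> C' = {}" by (rule state_disj[OF st c1(1) c2(1) C(3)])
  have fin: "finite C" "finite C'" using state_fin(3)[OF st] c1(1) c2(1) by auto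
  have "others_bound \<C> P \<le> (\<Sum>P'\<in>\<P> - {P}. card (\<Union>(col \<C> P')))" unfolding others_bound_def by (intro sum_mono) auto
  moreover have "card (\<Union>\<C>) = card (\<Union>(col \<C> P)) + (\<Sum>P'\<in>\<P> - {P}. card (\<Union>(col \<C> P')))"
    unfolding size_eq[OF st] using finP P by (rule sum.remove)
  moreover have "card (C \<union> C') \<le> card (\<Union>(col \<C> P))" using C fin_col[OF st] by (intro card_mono) auto
  moreover have "card (C \<union> C') = card C + card C'" using fin dis by (rule card_Un_disjoint)
  ultimately show "others_bound \<C> P + piece_bound C + piece_bound C' \<le> card (\<Union>\<C>)" by (simp add: piece_bound_def)
  have "card (C \<inter> Z) + card (C' \<inter> Z) = card ((C \<union> C') \<inter> Z)"
    using fin dis by (subst Int_Un_distrib2, subst card_Un_disjoint) auto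
  also have "\<dots> \<le> card P" using c1(2) c2(2) finPP[OF P] by (intro card_mono) auto
  finally have g: "card (C \<inter> Z) + card (C' \<inter> Z) \<le> card P" .
  have g12: "1 \<le> card (C \<inter> Z)" "1 \<le> card (C' \<inter> Z)"
    using c1(3,4) c2(3,4) fin by (auto simp: Suc_le_eq card_gt_0_iff)
  have "(\<Sum>P\<in>\<P>. omega (card P)) = omega (card P) + (\<Sum>P'\<in>\<P> - {P}. omega (card P'))"
    using finP P by (rule sum.remove)
  moreover have "others_bound \<C> P \<le> (\<Sum>P'\<in>\<P> - {P}. omega (card P'))" unfolding others_bound_def by (intro sum_mono) auto
  moreover have "omega (card P) = Suc (card P)" using g g12 by (simp add: omega_def)
  ultimately have S: "others_bound \<C> P + card P + 1 \<le> card Z + M" using sum_omega by simp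
  then show "others_bound \<C> P + 3 \<le> card Z + M" using g g12 by simp
  have a: "piece_bound C \<le> omega (card (C \<inter> Z))" "piece_bound C' \<le> omega (card (C' \<inter> Z))" by (auto simp: piece_bound_def)
  then show "others_bound \<C> P + piece_bound C + 1 \<le> card Z + M" using S g g12 by (auto simp: omega_def split: if_splits)
  have "omega (card (C \<inter> Z)) + 1 \<le> 2 * card (C \<inter> Z)" "omega (card (C' \<inter> Z)) + 1 \<le> 2 * card (C' \<inter> Z)"
    using g12 by (auto simp: omega_def)
  then have "piece_bound C + piece_bound C' + 2 \<le> 2 * card P" using g a by linarith
  moreover have "2 \<le> card P" using g g12 by linarith
  moreover have "3 * x + a + b + 7 \<le> 3 * s"
    if "a + b + 2 \<le> 2 * g" "2 \<le> g" "x + g + 1 \<le> s" for x a b g s :: nat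
  proof -
    have "a + b + 4 \<le> 3 * g" using that(1,2) by linarith
    moreover have "3 * (x + g + 1) \<le> 3 * s" using that(3) by (rule mult_le_mono2)
    ultimately show ?thesis unfolding distrib_left by linarith
  qed
  ultimately show "3 * others_bound \<C> P + piece_bound C + piece_bound C' + 7 \<le> 3 * (card Z + M)" using S by blast
qed

end

section \<open>Linkages under a minimum degree condition\<close>

lemma card_Diff_add: "finite B \<Longrightarrow> A \<subseteq> B \<Longrightarrow> card (B - A) + card A = card B"
  by (simp add: card_Diff_subset card_mono finite_subset)

context linking
begin

definition NK :: "'a set set \<Rightarrow> 'a \<Rightarrow> 'a set" where
  "NK \<C> v = insert v {w \<in> D - \<Union>\<C>. {v, w} \<in> E}"

lemma NK_card:
  assumes "state \<C>" "v \<in> D - \<Union>\<C>"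
  shows "card (NK \<C> v) + card {w \<in> \<Union>\<C>. {v, w} \<in> E} = Suc (card {w \<in> D. {v, w} \<in> E})"
proof -
  have "{w \<in> D - \<Union>\<C>. {v, w} \<in> E} = {w \<in> D. {v, w} \<in> E} - {w \<in> \<Union>\<C>. {v, w} \<in> E}"
    by blast
  then have "card {w \<in> D - \<Union>\<C>. {v, w} \<in> E} + card {w \<in> \<Union>\<C>. {v, w} \<in> E} = card {w \<in> D. {v, w} \<in> E}"
    using card_Diff_add[of "{w \<in> D. {v, w} \<in> E}" "{w \<in> \<Union>\<C>. {v, w} \<in> E}"] finD state_sub[OF assms(1)]
    by (simp add: subset_iff)
  moreover have "card (NK \<C> v) = Suc (card {w \<in> D - \<Union>\<C>. {v, w} \<in> E})"
    using finD no_loop[of v v] unfolding NK_def by (intro card_insert_disjoint) auto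
  ultimately show ?thesis by simp
qed

lemma NK_sub: "v \<in> D - \<Union>\<C> \<Longrightarrow> NK \<C> v \<subseteq> D - \<Union>\<C>"
  by (auto simp: NK_def)

lemma NK_conn: "a \<in> NK \<C> v \<Longrightarrow> conn E {v, a}"
  using conn_insert[of E "{v}" v a] by (auto simp: NK_def insert_commute)

lemma opt_link:
  assumes o: "opt \<C>" and P: "P \<in> \<P>" and C: "C \<in> col \<C> P" "C' \<in> col \<C> P" "C \<noteq> C'"
    and F: "F \<subseteq> D - \<Union>\<C>" "conn E F" "card F \<le> m"
    and e: "\<exists>a\<in>C. \<exists>f\<in>F. {a, f} \<in> E" "\<exists>a\<in>C'. \<exists>f\<in>F. {a, f} \<in> E"
  shows "Bd < card (\<Union>\<C>) + m"
proof -
  have st: "state \<C>" using o opt_state by blast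
  have c: "conn E C" "conn E C'"
    using state_conn[OF st colD(1)[OF st P C(1)]] state_conn[OF st colD(1)[OF st P C(2)]] by auto
  obtain a f b g where e': "a \<in> C" "f \<in> F" "{a, f} \<in> E" "b \<in> C'" "g \<in> F" "{b, g} \<in> E" using e by blast
  have "conn E (C \<union> F)" by (rule conn_Un_edge[OF c(1) F(2) e'(1-3)])
  then have "conn E (C' \<union> (C \<union> F))" by (rule conn_Un_edge[OF c(2) _ e'(4) _ e'(6)]) (use e'(5) in simp)
  then have "conn E (C \<union> C' \<union> F)" by (simp add: Un_ac)
  then have "Bd < card (\<Union>\<C>) + card F" by (rule opt_join[OF o P C F(1)])
  then show ?thesis using F(3) by simp
qed

text \<open>A vertex \<open>x\<close> in both closed neighbourhoods yields a connector consisting of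
  \<open>u\<close>, \<open>x\<close> and \<open>w\<close>.\<close>

lemma opt_link3:
  assumes "opt \<C>" "P \<in> \<P>" "C \<in> col \<C> P" "C' \<in> col \<C> P" "C \<noteq> C'"
    and u: "u \<in> D - \<Union>\<C>" "a \<in> C" "{a, u} \<in> E" and w: "w \<in> D - \<Union>\<C>" "b \<in> C'" "{b, w} \<in> E"
    and x: "x \<in> NK \<C> u" "x \<in> NK \<C> w"
  shows "Bd < card (\<Union>\<C>) + 3"
proof (rule opt_link[OF assms(1-5)])
  show "{u, x} \<union> {w, x} \<subseteq> D - \<Union>\<C>" using NK_sub[OF u(1)] u(1) w(1) x by blast
  show "conn E ({u, x} \<union> {w, x})" using NK_conn[OF x(1)] NK_conn[OF x(2)] by (rule conn_Un[of _ _ _ x]) auto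
  show "card ({u, x} \<union> {w, x}) \<le> 3" by (simp add: card_insert_if)
qed (use u w in blast)+

end

text \<open>Suppose \<open>C0\<close> and \<open>C1\<close> share a colour. Both have neighbours
  outside the linkage, say \<open>u\<close> and \<open>w\<close>, and the closed neighbourhoods of
  these outside it are disjoint, as otherwise three vertices would join the components. Two disjoint
  neighbourhoods, even reduced by the neighbours inside the linkage, do not fit into
  \<open>D\<close>.\<close>

lemma (in linking) linkage_if_dense:
  assumes deg: "\<And>v. v \<in> D \<Longrightarrow> d \<le> card {w \<in> D. {v, w} \<in> E}"
    and size: "card D + (card Z + M) \<le> 2 * d + 4" and big: "card Z + M + 3 \<le> d" and Bd_def: "Bd = card D - 1"
  shows "\<exists>C. linkage E D \<P> C"
proof -
  note fin = finD
  obtain \<C> where o: "opt \<C>" using ex_opt by blast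
  have st: "state \<C>" using o by (rule opt_state)
  define J where "J = \<Union>\<C>"
  define K where "K = D - J"
  let ?S = "card Z + M"
  show ?thesis
  proof (rule linkage_if_unsplit[OF st], rule ccontr)
    fix P C0 C1 assume P: "P \<in> \<P>" and C01: "C0 \<in> col \<C> P" "C1 \<in> col \<C> P" "C0 \<noteq> C1"
    have JD: "J \<subseteq> D" using state_sub[OF st] by (simp add: J_def)
    have "card J \<le> card D - 1" using state_size[OF st] by (simp add: J_def Bd_def)
    moreover have "D \<noteq> {}" using colD(1,4)[OF st P C01(1)] JD by (auto simp: J_def)
    then have "card D > 0" using fin by (simp add: card_gt_0_iff)
    ultimately have JltD: "card J < card D" by simp
    have cK: "card K + card J = card D"
      unfolding K_def using fin JD by (rule card_Diff_add)
    have finK: "finite K" using fin by (simp add: K_def)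
    have Kne: "K \<noteq> {}" using cK JltD by auto
    have NKc: "Suc d \<le> card (NK \<C> v) + card {w \<in> J. {v, w} \<in> E}" if "v \<in> K" for v
      using NK_card[OF st, of v] deg[of v] that by (simp add: K_def J_def)
    have NKsub: "NK \<C> v \<subseteq> K" if "v \<in> K" for v using NK_sub[of v \<C>] that by (simp add: K_def J_def)
    obtain v0 where v0: "v0 \<in> K" using Kne by blast
    have "card (NK \<C> v0) \<le> card K" using NKsub[OF v0] finK by (rule card_mono[rotated])
    moreover have "card {w \<in> J. {v0, w} \<in> E} \<le> ?S"
      using nb_total[OF o, of v0] v0 by (simp add: K_def J_def)
    \<comment> \<open>The closed neighbourhood of \<open>v0\<close> outside the linkage has at least
      four vertices. With \<open>Bd = card D - 1\<close> this makes room for connectors of three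
      vertices.\<close>
    ultimately have room: "card J + 4 \<le> card D" using NKc[OF v0] cK big by linarith
    have no_link: False if "C \<in> col \<C> P" "C' \<in> col \<C> P" "C \<noteq> C'" "F \<subseteq> K" "conn E F" "card F \<le> 3"
      "\<exists>a\<in>C. \<exists>f\<in>F. {a, f} \<in> E" "\<exists>a\<in>C'. \<exists>f\<in>F. {a, f} \<in> E" for C C' F
      using opt_link[OF o P that(1-3) _ that(5,6,7,8)] that(4) room by (simp add: K_def J_def Bd_def)
    have nbs: "card {w \<in> J. {v, w} \<in> E} \<le> others_bound \<C> P + piece_bound C"
      if v: "v \<in> K" and C: "C \<in> col \<C> P" and vC: "x \<in> C" "{v, x} \<in> E" for v C x
      unfolding J_def
    proof (rule nb_split[OF o _ P C])
      show "v \<in> D - \<Union>\<C>" using v by (simp add: K_def J_def)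
      fix C' w assume C': "C' \<in> col \<C> P" "C' \<noteq> C" "w \<in> C'"
      show "{v, w} \<notin> E"
      proof
        assume "{v, w} \<in> E"
        then have "\<exists>a\<in>C'. \<exists>f\<in>{v}. {a, f} \<in> E" using C' by (auto simp: insert_commute)
        moreover have "\<exists>a\<in>C. \<exists>f\<in>{v}. {a, f} \<in> E" using vC by (auto simp: insert_commute)
        ultimately show False using no_link[OF C C'(1), of "{v}"] C'(2) v by auto
      qed
    qed
    \<comment> \<open>If \<open>C\<close> has no neighbour outside, the neighbours of a vertex of
      \<open>C\<close> lie in the linkage, and none lies in another component \<open>C2\<close> of
      the same colour. The degrees of this vertex and of \<open>v0\<close> then add up to too
      much.\<close>
    have stuck: False
      if C: "C \<in> col \<C> P" "C' \<in> col \<C> P" "C \<noteq> C'" and no: "\<And>u x. u \<in> K \<Longrightarrow> x \<in> C \<Longrightarrow> {u, x} \<notin> E" for C C'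
    proof -
      obtain x where x: "x \<in> C" using colD(4)[OF st P C(1)] by blast
      \<comment> \<open>If \<open>v0\<close> sees the colour \<open>P\<close>, then
        \<open>C2\<close> is a component it sees; otherwise \<open>C'\<close> serves as
        well.\<close>
      obtain C2 where C2: "C2 \<in> col \<C> P" "C2 \<noteq> C" "card {w \<in> J. {v0, w} \<in> E} \<le> others_bound \<C> P + piece_bound C2"
      proof (cases "\<exists>C2\<in>col \<C> P. \<exists>y\<in>C2. {v0, y} \<in> E")
        case True
        then obtain C2 y where C2: "C2 \<in> col \<C> P" "y \<in> C2" "{v0, y} \<in> E" by blast
        have "C2 \<noteq> C" using no[OF v0, of y] C2 by auto
        then show ?thesis using that[OF C2(1)] nbs[OF v0 C2] by simp
      next
        case False
        have "card {w \<in> J. {v0, w} \<in> E} \<le> others_bound \<C> P + piece_bound C'"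
          unfolding J_def using False v0 by (intro nb_split[OF o _ P C(2)]) (auto simp: K_def J_def)
        then show ?thesis using that[OF C(2)] C(3) by simp
      qed
      have CC: "C \<in> \<C>" "C2 \<in> \<C>" using colD(1)[OF st P] C(1) C2(1) by auto
      have dis: "C \<inter> C2 = {}" by (rule state_disj[OF st CC]) (use C2 in auto)
      have nox: "{x, y} \<notin> E" if "y \<in> C2" for y
      proof
        assume "{x, y} \<in> E"
        then have "conn E (C \<union> C2 \<union> {})"
          using conn_Un_edge[OF state_conn[OF st CC(1)] state_conn[OF st CC(2)] x that] by simp
        then have "Bd < card J + card ({} :: 'a set)"
          unfolding J_def by (rule opt_join[OF o P C(1) C2(1) C2(2)[symmetric], rotated]) simp
        then show False using room by (simp add: Bd_def)
      qed
      have sub: "insert x {y \<in> D. {x, y} \<in> E} \<subseteq> J - C2"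
      proof -
        have "y \<in> J" if "y \<in> D" "{x, y} \<in> E" for y
          using no[of y x] x that by (auto simp: K_def insert_commute)
        then show ?thesis using nox x CC dis by (auto simp: J_def)
      qed
      have xD: "x \<in> D" using x CC(1) JD by (auto simp: J_def)
      have "Suc (card {y \<in> D. {x, y} \<in> E}) = card (insert x {y \<in> D. {x, y} \<in> E})"
        using fin no_loop[of x x] by (intro card_insert_disjoint[symmetric]) auto
      also have "\<dots> \<le> card (J - C2)" using sub JD fin by (intro card_mono) (auto intro: finite_subset)
      finally have "Suc d \<le> card (J - C2)" using deg[OF xD] by simp
      moreover have "C2 \<subseteq> J" using CC by (auto simp: J_def)
      then have "card (J - C2) + card C2 = card J"
        using finite_subset[OF JD fin] by (intro card_Diff_add)
      moreover have "piece_bound C2 \<le> card C2" by (simp add: piece_bound_def)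
      moreover note C2(3) NKc[OF v0] \<open>card (NK \<C> v0) \<le> card K\<close> split_arith(2)[OF st P C01] cK size
      ultimately show False by linarith
    qed
    have "\<exists>u x. u \<in> K \<and> x \<in> C0 \<and> {u, x} \<in> E"
      by (rule ccontr) (use stuck[OF C01] in simp)
    then obtain u x where u: "u \<in> K" "x \<in> C0" "{u, x} \<in> E" by blast
    have "\<exists>w y. w \<in> K \<and> y \<in> C1 \<and> {w, y} \<in> E"
      by (rule ccontr) (use stuck[OF C01(2,1) C01(3)[symmetric]] in simp)
    then obtain w y where w: "w \<in> K" "y \<in> C1" "{w, y} \<in> E" by blast
    have dis: "NK \<C> u \<inter> NK \<C> w = {}"
    proof (rule ccontr)
      assume "\<not> ?thesis"
      then obtain a where "a \<in> NK \<C> u" "a \<in> NK \<C> w" by blast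
      moreover have "{x, u} \<in> E" "{y, w} \<in> E" using u w by (simp_all add: insert_commute)
      ultimately have "card D - 1 < card (\<Union>\<C>) + 3"
        using opt_link3[OF o P C01, of u x w y] u w by (simp add: K_def J_def Bd_def)
      then show False using room by (simp add: J_def)
    qed
    have "card (NK \<C> u) + card (NK \<C> w) = card (NK \<C> u \<union> NK \<C> w)"
      using dis NKsub[OF u(1)] NKsub[OF w(1)] finK by (intro card_Un_disjoint[symmetric]) (auto intro: finite_subset)
    also have "\<dots> \<le> card K" using NKsub[OF u(1)] NKsub[OF w(1)] finK by (intro card_mono) auto
    finally have "card (NK \<C> u) + card (NK \<C> w) \<le> card K" .
    \<comment> \<open>In the sum of the bounds for \<open>u\<close> and \<open>w\<close>, the first
      claim of \<open>split_arith\<close> absorbs both piece bounds and one copy of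
      \<open>others_bound\<close>; the other copy is at most \<open>card Z + M - 3\<close>, which
      contradicts \<open>size\<close> by one.\<close>
    moreover note NKc[OF u(1)] NKc[OF w(1)] nbs[OF u(1) C01(1) u(2,3)] nbs[OF w(1) C01(2) w(2,3)]
      split_arith(1,2)[OF st P C01] cK size
    ultimately show False unfolding J_def by linarith
  qed
qed

lemma dense_linked:
  assumes fin: "finite D" and two: "\<And>e. e \<in> E \<Longrightarrow> card e = 2" and ZD: "Z \<subseteq> D"
    and deg: "\<And>v. v \<in> D \<Longrightarrow> d \<le> card {w \<in> D. {v, w} \<in> E}"
    and size: "card D + (card Z + M) \<le> 2 * d + 4" and big: "card Z + M + 3 \<le> d"
  shows "linked M E D Z"
proof (rule linked_if_full)
  show "finite Z" using fin ZD finite_subset by blast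
  fix \<P> assume p: "parts M Z \<P>" "\<Union>\<P> = Z"
  have dD: "d \<le> card D" if "v \<in> D" for v
    using deg[OF that] card_mono[OF fin, of "{w \<in> D. {v, w} \<in> E}"] by auto
  have "card Z \<le> card D - 1"
  proof (cases "D = {}")
    case True then show ?thesis using ZD by simp
  next
    case False then show ?thesis using dD big by fastforce
  qed
  then have "linking E D Z \<P> M (card D - 1)"
    using fin two ZD p by unfold_locales
  then show "\<exists>C. linkage E D \<P> C" using deg size big by (rule linking.linkage_if_dense) simp_all
qed

section \<open>Linked subsets of dense neighbourhoods\<close>

context linking
begin

text \<open>If any two closed neighbourhoods outside the partial linkage meet, every component can be
  rerouted through the outside, hence is small.\<close>

lemma small_components:
  assumes o: "opt \<C>" and C: "C \<in> \<C>"
    and out: "\<And>x. x \<in> C \<Longrightarrow> \<exists>u\<in>D - \<Union>\<C>. {x, u} \<in> E"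
    and meet: "\<And>u w. u \<in> D - \<Union>\<C> \<Longrightarrow> w \<in> D - \<Union>\<C> \<Longrightarrow> NK \<C> u \<inter> NK \<C> w \<noteq> {}"
  shows "card C + 1 \<le> 3 * card (C \<inter> Z)"
proof -
  have st: "state \<C>" using o by (rule opt_state)
  define K where "K = D - \<Union>\<C>"
  define Z0 where "Z0 = C \<inter> Z"
  have finZ0: "finite Z0" using finZ by (simp add: Z0_def)
  obtain z1 where z1: "z1 \<in> Z0" using state_ne[OF st C] by (auto simp: Z0_def)
  have "\<forall>z. \<exists>u. z \<in> Z0 \<longrightarrow> u \<in> K \<and> {z, u} \<in> E"
  proof
    fix z show "\<exists>u. z \<in> Z0 \<longrightarrow> u \<in> K \<and> {z, u} \<in> E"
      using out[of z] unfolding Z0_def K_def by blast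
  qed
  then obtain u where u: "\<And>z. z \<in> Z0 \<Longrightarrow> u z \<in> K \<and> {z, u z} \<in> E" by metis
  have "\<forall>z. \<exists>a. z \<in> Z0 \<longrightarrow> a \<in> NK \<C> (u z1) \<inter> NK \<C> (u z)"
  proof
    fix z show "\<exists>a. z \<in> Z0 \<longrightarrow> a \<in> NK \<C> (u z1) \<inter> NK \<C> (u z)"
      using meet[of "u z1" "u z"] u[OF z1] u[of z] by (auto simp: K_def)
  qed
  then obtain a where a: "\<And>z. z \<in> Z0 \<Longrightarrow> a z \<in> NK \<C> (u z1) \<inter> NK \<C> (u z)" by metis
  \<comment> \<open>A terminal \<open>z\<close> other than \<open>z1\<close> reaches
    \<open>u z1\<close> through three vertices: itself, its outside neighbour, and a vertex common
    to both closed neighbourhoods. The total is \<open>2 + 3 * (card Z0 - 1)\<close>.\<close>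
  define F where "F z = {z, u z, a z}" for z
  define U where "U = {z1, u z1} \<union> (\<Union>z\<in>Z0 - {z1}. F z)"
  have aK: "a z \<in> K" if "z \<in> Z0" for z using a[OF that] NK_sub[of "u z" \<C>] u[OF that] by (auto simp: K_def)
  have edge: "conn E {z, u z}" if "z \<in> Z0" for z
    using conn_insert[of E "{z}" z "u z"] u[OF that] by (simp add: insert_commute)
  have "conn E U" unfolding U_def
  proof (rule conn_UN)
    show "conn E {z1, u z1}" using edge[OF z1] .
    fix z assume z: "z \<in> Z0 - {z1}"
    have "conn E ({z, u z} \<union> {u z, a z})"
      using edge[of z] NK_conn[of "a z" \<C> "u z"] z a[of z] by (intro conn_Un[of _ _ _ "u z"]) auto
    then show "conn E (F z)" by (simp add: F_def insert_commute)
    have "a z = u z1 \<or> {u z1, a z} \<in> E" using a[of z] z by (auto simp: NK_def)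
    then show "F z \<inter> {z1, u z1} \<noteq> {} \<or> (\<exists>a\<in>{z1, u z1}. \<exists>b\<in>F z. {a, b} \<in> E)" by (auto simp: F_def)
  qed
  moreover have "U \<subseteq> Z0 \<union> K" using z1 u aK by (auto simp: U_def F_def)
  then have "U \<subseteq> D" "U \<inter> \<Union>(\<C> - {C}) = {}"
    using ZD state_rest[OF st, of "{C}"] C by (auto simp: Z0_def K_def)
  moreover have "Z \<inter> C \<subseteq> U" by (auto simp: U_def F_def Z0_def)
  ultimately have "card C \<le> card U" using opt_shrink[OF o C, of U] by simp
  also have "\<dots> \<le> card {z1, u z1} + card (\<Union>z\<in>Z0 - {z1}. F z)" unfolding U_def by (rule card_Un_le)
  also have "card (\<Union>z\<in>Z0 - {z1}. F z) \<le> (\<Sum>z\<in>Z0 - {z1}. card (F z))" using finZ0 by (intro card_UN_le) simp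
  also have "\<dots> \<le> (\<Sum>z\<in>Z0 - {z1}. 3)" by (intro sum_mono) (simp add: F_def card_insert_if)
  also have "\<dots> = 3 * (card Z0 - 1)" using z1 finZ0 by simp
  also have "card {z1, u z1} \<le> 2" by (simp add: card_insert_if)
  finally have "card C \<le> 2 + 3 * (card Z0 - 1)" by simp
  moreover have "card Z0 > 0" using z1 finZ0 by (auto simp: card_gt_0_iff)
  ultimately show ?thesis by (simp add: Z0_def)
qed

lemma size_sum:
  assumes "state \<C>"
  shows "card (\<Union>\<C>) = (\<Sum>C\<in>\<C>. card C)" "(\<Sum>C\<in>\<C>. card (C \<inter> Z)) = card Z"
proof -
  note f = state_fin[OF assms]
  show "card (\<Union>\<C>) = (\<Sum>C\<in>\<C>. card C)"
    using assms f by (intro card_Union_disjoint) (auto simp: state_def)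
  have "card Z = card (\<Union>C\<in>\<C>. C \<inter> Z)"
    using state_cover[OF assms] by (intro arg_cong[of _ _ card]) auto
  also have "\<dots> = (\<Sum>C\<in>\<C>. card (C \<inter> Z))"
    using f finZ state_disj[OF assms] by (intro card_UN_disjoint) blast+
  finally show "(\<Sum>C\<in>\<C>. card (C \<inter> Z)) = card Z" ..
qed

end

text \<open>Two components of one colour have neighbours \<open>u\<close> and \<open>w\<close>
  outside the linkage. The vertices within distance two of \<open>u\<close> and of \<open>w\<close>
  outside it form two sets that are disjoint, have no edge between them and cover the outside. Each
  keeps the degree \<open>Bd\<close> up to its neighbours in the linkage, and by averaging one of
  them is small enough for \<open>dense_linked\<close>.\<close>

lemma (in linking) dense_subset_if_unlinked:
  assumes unlinked: "\<not> (\<exists>C. linkage E D \<P> C)" and YZ: "Y \<subseteq> Z" and ZN: "card Z \<le> N"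
    and dW: "\<And>v. v \<in> D - Y \<Longrightarrow> Bd \<le> card {w \<in> D. {v, w} \<in> E}"
    and dY: "\<And>v. v \<in> Y \<Longrightarrow> Bd + 1 \<le> card {w \<in> D - Y. {v, w} \<in> E} + card Y"
    and P1: "5 * (N + M) + card D \<le> 4 * Bd + 16" and P2: "3 * N + 1 \<le> Bd"
    and P3: "card D + 2 * (N + M) + 4 \<le> 3 * Bd" and P4: "2 * (N + M) + 2 \<le> Bd"
  shows "\<exists>L\<subseteq>D. N < card L \<and> (\<forall>Z. Y \<inter> L \<subseteq> Z \<longrightarrow> Z \<subseteq> L \<longrightarrow> card Z \<le> N \<longrightarrow> linked M E L Z)"
proof -
  note fin = finD
  obtain \<C> where o: "opt \<C>" using ex_opt by blast
  have st: "state \<C>" using o by (rule opt_state)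
  have "\<exists>P C0 C1. P \<in> \<P> \<and> C0 \<in> col \<C> P \<and> C1 \<in> col \<C> P \<and> C0 \<noteq> C1"
    using linkage_if_unsplit[OF st] unlinked by blast
  then obtain P C0 C1 where P: "P \<in> \<P>" and C01: "C0 \<in> col \<C> P" "C1 \<in> col \<C> P" "C0 \<noteq> C1" by blast
  define J where "J = \<Union>\<C>"
  define K where "K = D - J"
  have JD: "J \<subseteq> D" using state_sub[OF st] by (simp add: J_def)
  have YJ: "Y \<subseteq> J" using YZ state_cover[OF st] by (simp add: J_def)
  have cJ: "card J \<le> Bd" using state_size[OF st] by (simp add: J_def)
  have cK: "card K + card J = card D" unfolding K_def using fin JD by (rule card_Diff_add)
  have finJ: "finite J" using JD fin finite_subset by blast
  have finK: "finite K" using fin by (simp add: K_def)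
  have NKc: "Suc Bd \<le> card (NK \<C> v) + card {w \<in> J. {v, w} \<in> E}" if "v \<in> K" for v
    using NK_card[OF st, of v] dW[of v] that YJ by (auto simp: K_def J_def)
  have NKsub: "NK \<C> v \<subseteq> K" if "v \<in> K" for v using NK_sub[of v \<C>] that by (simp add: K_def J_def)
  have nbS: "card {w \<in> J. {v, w} \<in> E} \<le> card Z + M" if "v \<in> K" for v
    using nb_total[OF o, of v] that by (simp add: K_def J_def)
  have nbJ: "card {w \<in> J. {v, w} \<in> E} \<le> card J" for v
    using finJ by (intro card_mono) auto
  \<comment> \<open>The cap \<open>Bd\<close> is also the degree bound, so the neighbours of a
    vertex of \<open>J\<close> do not fit into the rest of \<open>J\<close>.\<close>
  have out: "\<exists>u\<in>K. {x, u} \<in> E" if x: "x \<in> J" for x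
  proof (rule ccontr)
    assume "\<not> ?thesis"
    then have no: "{w \<in> D. {x, w} \<in> E} \<subseteq> J - {x}" using no_loop[of x x] by (auto simp: K_def)
    show False
    proof (cases "x \<in> Y")
      case True
      have "card {w \<in> D - Y. {x, w} \<in> E} \<le> card (J - Y)" using no finJ by (intro card_mono) auto
      then show False using dY[OF True] card_Diff_add[OF finJ YJ] cJ by simp
    next
      case False
      have "card {w \<in> D. {x, w} \<in> E} \<le> card (J - {x})" using no finJ by (intro card_mono) auto
      moreover have "card (J - {x}) + 1 = card J" using card_Diff_add[OF finJ, of "{x}"] x by simp
      ultimately show False using dW[of x] False x JD cJ by auto
    qed
  qed
  have c0: "C0 \<in> \<C>" "C1 \<in> \<C>" using colD(1)[OF st P] C01 by auto
  obtain x0 where x0: "x0 \<in> C0" using state_ne[OF st c0(1)] by blast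
  obtain x1 where x1: "x1 \<in> C1" using state_ne[OF st c0(2)] by blast
  obtain u where u: "u \<in> K" "{x0, u} \<in> E" using out[of x0] x0 c0 by (auto simp: J_def)
  obtain w where w: "w \<in> K" "{x1, w} \<in> E" using out[of x1] x1 c0 by (auto simp: J_def)
  \<comment> \<open>If all closed neighbourhoods met, all components would be small, and since there
    are at least two, \<open>card J \<le> 3 * card Z - 2\<close>. By \<open>P2\<close> a connector
    of three vertices would then fit below the cap.\<close>
  have "\<exists>u0 w0. u0 \<in> K \<and> w0 \<in> K \<and> NK \<C> u0 \<inter> NK \<C> w0 = {}"
  proof (rule ccontr)
    assume a: "\<not> ?thesis"
    have meet: "NK \<C> u0 \<inter> NK \<C> w0 \<noteq> {}" if "u0 \<in> D - \<Union>\<C>" "w0 \<in> D - \<Union>\<C>" for u0 w0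
      using a that unfolding K_def J_def by blast
    have "card C + 1 \<le> 3 * card (C \<inter> Z)" if C: "C \<in> \<C>" for C
    proof (rule small_components[OF o C])
      show "\<exists>u\<in>D - \<Union>\<C>. {x, u} \<in> E" if "x \<in> C" for x
        using out[of x] C that by (auto simp: K_def J_def)
    qed (rule meet)
    then have "(\<Sum>C\<in>\<C>. card C + 1) \<le> (\<Sum>C\<in>\<C>. 3 * card (C \<inter> Z))" by (rule sum_mono)
    then have "card J + card \<C> \<le> 3 * card Z"
      using size_sum[OF st] unfolding J_def by (simp only: sum.distrib sum_distrib_left[symmetric] sum_constant of_nat_id mult_1_right)
    moreover have "card {C0, C1} \<le> card \<C>" using c0 state_fin(1)[OF st] by (intro card_mono) auto
    then have "2 \<le> card \<C>" using C01(3) by simp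
    moreover obtain a where "a \<in> NK \<C> u" "a \<in> NK \<C> w"
      using meet[of u w] u(1) w(1) unfolding K_def J_def by blast
    then have "Bd < card J + 3"
      using opt_link3[OF o P C01, of u x0 w x1 a] u w x0 x1 by (simp add: K_def J_def)
    ultimately show False using P2 ZN by (linarith | simp)
  qed
  then obtain u0 w0 where uw0: "u0 \<in> K" "w0 \<in> K" "NK \<C> u0 \<inter> NK \<C> w0 = {}" by blast
  have fNK: "finite (NK \<C> v)" if "v \<in> K" for v using NKsub[OF that] finK finite_subset by blast
  have "card (NK \<C> u0) + card (NK \<C> w0) = card (NK \<C> u0 \<union> NK \<C> w0)"
    using uw0(3) fNK[OF uw0(1)] fNK[OF uw0(2)] by (intro card_Un_disjoint[symmetric])
  also have "\<dots> \<le> card K" using NKsub[OF uw0(1)] NKsub[OF uw0(2)] finK by (intro card_mono) auto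
  finally have "card (NK \<C> u0) + card (NK \<C> w0) \<le> card K" .
  \<comment> \<open>Two disjoint closed neighbourhoods outside force the linkage to be small by
    \<open>P3\<close>, which allows connectors of six vertices.\<close>
  then have room: "card J + 6 \<le> Bd"
    using NKc[OF uw0(1)] NKc[OF uw0(2)] nbS[OF uw0(1)] nbS[OF uw0(2)] cK ZN P3 by simp
  have no_link: False if "C \<in> col \<C> P" "C' \<in> col \<C> P" "C \<noteq> C'" "F \<subseteq> K" "conn E F" "card F \<le> 6"
    "\<exists>a\<in>C. \<exists>f\<in>F. {a, f} \<in> E" "\<exists>a\<in>C'. \<exists>f\<in>F. {a, f} \<in> E" for C C' F
    using opt_link[OF o P that(1-3) _ that(5,6,7,8)] that(4) room by (simp add: K_def J_def)
  \<comment> \<open>These are the vertices within distance two of \<open>v\<close> outside the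
    linkage. Two paths of three vertices each, one from \<open>u\<close> and one from
    \<open>w\<close>, meeting or joined by an edge, would be a forbidden connector.\<close>
  define B where "B v = {y \<in> K. NK \<C> y \<inter> NK \<C> v \<noteq> {}}" for v
  have Bpath: "\<exists>F\<subseteq>K. conn E F \<and> v \<in> F \<and> y \<in> F \<and> card F \<le> 3" if y: "y \<in> B v" and v: "v \<in> K" for v y
  proof -
    obtain a where a: "a \<in> NK \<C> y" "a \<in> NK \<C> v" and yK: "y \<in> K" using y by (auto simp: B_def)
    have "conn E ({y, a} \<union> {v, a})" using NK_conn[OF a(1)] NK_conn[OF a(2)] by (rule conn_Un[of _ _ _ a]) auto
    moreover have "{y, a} \<union> {v, a} \<subseteq> K" using a NKsub[OF v] yK v by auto
    moreover have "card ({y, a} \<union> {v, a}) \<le> 3" by (simp add: card_insert_if)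
    ultimately show ?thesis by (intro exI[of _ "{y, a} \<union> {v, a}"]) auto
  qed
  have Bself: "v \<in> B v" if "v \<in> K" for v using that by (auto simp: B_def NK_def)
  have nbB: "card {z \<in> J. {y, z} \<in> E} \<le> others_bound \<C> P + piece_bound C"
    if C: "C \<in> col \<C> P" and x: "x \<in> C" "{x, v} \<in> E" and v: "v \<in> K" and y: "y \<in> B v" for C x v y
    unfolding J_def
  proof (rule nb_split[OF o _ P C])
    show "y \<in> D - \<Union>\<C>" using y by (simp add: B_def K_def J_def)
    fix C' z assume C': "C' \<in> col \<C> P" "C' \<noteq> C" "z \<in> C'"
    show "{y, z} \<notin> E"
    proof
      assume e: "{y, z} \<in> E"
      obtain F where F: "F \<subseteq> K" "conn E F" "v \<in> F" "y \<in> F" "card F \<le> 3" using Bpath[OF y v] by blast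
      have "\<exists>a\<in>C. \<exists>f\<in>F. {a, f} \<in> E" using x F(3) by blast
      moreover have "\<exists>a\<in>C'. \<exists>f\<in>F. {a, f} \<in> E" using e C'(3) F(4) by (metis insert_commute)
      ultimately show False using no_link[OF C C'(1) C'(2)[symmetric] F(1,2)] F(5) by simp
    qed
  qed
  have apart: "y \<noteq> y' \<and> {y, y'} \<notin> E" if y: "y \<in> B u" "y' \<in> B w" for y y'
  proof (rule ccontr)
    assume a: "\<not> ?thesis"
    obtain F where F: "F \<subseteq> K" "conn E F" "u \<in> F" "y \<in> F" "card F \<le> 3" using Bpath[OF y(1) u(1)] by blast
    obtain F' where F': "F' \<subseteq> K" "conn E F'" "w \<in> F'" "y' \<in> F'" "card F' \<le> 3" using Bpath[OF y(2) w(1)] by blast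
    have "conn E (F \<union> F')"
    proof (cases "y = y'")
      case True then show ?thesis using conn_Un[OF F(2) F'(2) F(4)] F'(4) by simp
    next
      case False then show ?thesis using conn_Un_edge[OF F(2) F'(2) F(4) F'(4)] a by simp
    qed
    moreover have "card (F \<union> F') \<le> 6" using card_Un_le[of F F'] F(5) F'(5) by (linarith | simp)
    moreover have "\<exists>a\<in>C0. \<exists>f\<in>F \<union> F'. {a, f} \<in> E" "\<exists>a\<in>C1. \<exists>f\<in>F \<union> F'. {a, f} \<in> E"
      using x0 x1 u w F(3) F'(3) by blast+
    ultimately show False using no_link[OF C01, of "F \<union> F'"] F(1) F'(1) by simp
  qed
  \<comment> \<open>A vertex in neither set would give three disjoint closed neighbourhoods. Each
    loses at most \<open>card Z + M\<close> and at most \<open>card J\<close> neighbours to the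
    linkage; using the smaller of these bounds contradicts \<open>P3\<close>.\<close>
  have cover: "y \<in> B u \<or> y \<in> B w" if y: "y \<in> K" for y
  proof (rule ccontr)
    assume a: "\<not> ?thesis"
    then have d1: "NK \<C> y \<inter> NK \<C> u = {}" "NK \<C> y \<inter> NK \<C> w = {}" using y by (auto simp: B_def)
    have d2: "NK \<C> u \<inter> NK \<C> w = {}"
    proof (rule ccontr)
      assume "\<not> ?thesis"
      then have "u \<in> B w" using u(1) by (auto simp: B_def)
      then show False using apart[OF Bself[OF u(1)]] by blast
    qed
    have "card (NK \<C> y) + (card (NK \<C> u) + card (NK \<C> w)) = card (NK \<C> y \<union> (NK \<C> u \<union> NK \<C> w))"
      using d1 d2 fNK[OF y] fNK[OF u(1)] fNK[OF w(1)] by (simp add: card_Un_disjoint Int_Un_distrib)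
    also have "\<dots> \<le> card K" using NKsub[OF y] NKsub[OF u(1)] NKsub[OF w(1)] finK by (intro card_mono) auto
    finally have s: "card (NK \<C> y) + (card (NK \<C> u) + card (NK \<C> w)) \<le> card K" .
    note f = NKc[OF y] NKc[OF u(1)] NKc[OF w(1)]
    show False
    proof (cases "card Z + M \<le> card J")
      case True
      then show False using s f nbS[OF y] nbS[OF u(1)] nbS[OF w(1)] cK P3 ZN by (linarith | simp)
    next
      case False
      then show False using s f nbJ[of y] nbJ[of u] nbJ[of w] cK P3 ZN by (linarith | simp)
    qed
  qed
  have degB: "Bd \<le> card {z \<in> B v. {y, z} \<in> E} + (others_bound \<C> P + piece_bound C)"
    if v: "v = u \<and> v' = w \<or> v = w \<and> v' = u" and C: "C \<in> col \<C> P" "x \<in> C" "{x, v} \<in> E"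
      and y: "y \<in> B v" for v v' C x y
  proof -
    have vK: "v \<in> K" using v u w by auto
    have yK: "y \<in> K" using y by (simp add: B_def)
    have "{z \<in> D. {y, z} \<in> E} \<subseteq> {z \<in> B v. {y, z} \<in> E} \<union> {z \<in> J. {y, z} \<in> E}"
    proof
      fix z assume "z \<in> {z \<in> D. {y, z} \<in> E}"
      then have z: "z \<in> D" "{y, z} \<in> E" by auto
      have "z \<notin> B v'" 
        using v apart[of y z] apart[of z y] y z(2) by (auto simp: insert_commute)
      then have "z \<in> K \<Longrightarrow> z \<in> B v" using cover v by blast
      then show "z \<in> {z \<in> B v. {y, z} \<in> E} \<union> {z \<in> J. {y, z} \<in> E}" using z by (auto simp: K_def)
    qed
    then have "card {z \<in> D. {y, z} \<in> E} \<le> card ({z \<in> B v. {y, z} \<in> E} \<union> {z \<in> J. {y, z} \<in> E})"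
      using finJ finK by (intro card_mono) (auto simp: B_def)
    also have "\<dots> \<le> card {z \<in> B v. {y, z} \<in> E} + card {z \<in> J. {y, z} \<in> E}" by (rule card_Un_le)
    finally have "card {z \<in> D. {y, z} \<in> E} \<le> card {z \<in> B v. {y, z} \<in> E} + card {z \<in> J. {y, z} \<in> E}" .
    moreover have "y \<in> D - Y" using yK YJ by (auto simp: K_def)
    ultimately show ?thesis using nbB[OF C vK y] dW[of y] by linarith
  qed
  have good: "\<exists>L\<subseteq>D. N < card L \<and> (\<forall>Z. Y \<inter> L \<subseteq> Z \<longrightarrow> Z \<subseteq> L \<longrightarrow> card Z \<le> N \<longrightarrow> linked M E L Z)"
    if v: "v = u \<and> v' = w \<or> v = w \<and> v' = u" and C: "C \<in> col \<C> P" "x \<in> C" "{x, v} \<in> E"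
      and piece_bound: "others_bound \<C> P + piece_bound C + 1 \<le> card Z + M"
      and sz: "card (B v) + (N + M) + 2 * (others_bound \<C> P + piece_bound C) \<le> 2 * Bd + 4" for v v' C x
  proof (intro exI[of _ "B v"] conjI allI impI)
    \<comment> \<open>This is the degree left inside \<open>B v\<close>; by \<open>P4\<close> it is
      at least \<open>N + M + 3\<close>.\<close>
    define d where "d = Bd - (others_bound \<C> P + piece_bound C)"
    have d: "d + (others_bound \<C> P + piece_bound C) = Bd" using piece_bound P4 ZN by (simp add: d_def)
    have db: "d \<le> card {z \<in> B v. {y, z} \<in> E}" if "y \<in> B v" for y
      using degB[OF v C that] d by (linarith | simp)
    have d3: "N + M + 3 \<le> d" using d piece_bound P4 ZN by (linarith | simp)
    have finB: "finite (B v)" using finK by (simp add: B_def)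
    show "B v \<subseteq> D" by (auto simp: B_def K_def)
    have "v \<in> K" using v u w by auto
    then have "d \<le> card {z \<in> B v. {v, z} \<in> E}" using db Bself by blast
    also have "\<dots> \<le> card (B v)" using finB by (intro card_mono) auto
    finally show "N < card (B v)" using d3 by (linarith | simp)
    fix Z' assume Z': "Z' \<subseteq> B v" "card Z' \<le> N"
    show "linked M E (B v) Z'"
    proof (rule dense_linked[OF finB _ Z'(1) db])
      show "card (B v) + (card Z' + M) \<le> 2 * d + 4" using sz d Z'(2) by (linarith | simp)
      show "card Z' + M + 3 \<le> d" using d3 Z'(2) by (linarith | simp)
    qed (rule two)
  qed
  have "card (B u) + card (B w) = card (B u \<union> B w)"
    using apart finK by (intro card_Un_disjoint[symmetric]) (auto simp: B_def)
  also have "\<dots> \<le> card K" using finK by (intro card_mono) (auto simp: B_def)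
  finally have "card (B u) + card (B w) \<le> card K" .
  moreover note split_arith(1,4)[OF st P C01]
  \<comment> \<open>If both inequalities failed, their sum would exceed the right side by the
    constant 10; the last claim of \<open>split_arith\<close> contributes 7 more. The bound 16 in
    \<open>P1\<close> is one less than 17.\<close>
  moreover have "x + (n + m) + 2 * (t + a) \<le> 2 * Bd + 4 \<or> y + (n + m) + 2 * (t + b) \<le> 2 * Bd + 4"
    if "x + y \<le> k" "t + a + b \<le> j" "3 * t + a + b + 7 \<le> 3 * (z + m)" "k + j = h" "z \<le> n"
      "5 * (n + m) + h \<le> 4 * Bd + 16" for x y k t a b j z m h n :: nat
  proof (rule ccontr)
    assume "\<not> ?thesis"
    then have "2 * Bd + 5 \<le> x + (n + m) + 2 * (t + a)" "2 * Bd + 5 \<le> y + (n + m) + 2 * (t + b)" by simp_all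
    then have "4 * Bd + 10 \<le> x + y + 2 * (n + m) + 4 * t + 2 * a + 2 * b" by simp
    then have "4 * Bd + 10 \<le> h + 2 * (n + m) + 3 * t + a + b" using that(1,2,4) by simp
    then show False using that(3,5,6) by simp
  qed
  ultimately have "card (B u) + (N + M) + 2 * (others_bound \<C> P + piece_bound C0) \<le> 2 * Bd + 4 \<or>
             card (B w) + (N + M) + 2 * (others_bound \<C> P + piece_bound C1) \<le> 2 * Bd + 4"
    using cK[unfolded J_def] ZN P1 by blast
  then show ?thesis
  proof
    assume "card (B u) + (N + M) + 2 * (others_bound \<C> P + piece_bound C0) \<le> 2 * Bd + 4"
    with split_arith(3)[OF st P C01] show ?thesis by (intro good[of u w, OF _ C01(1) x0 u(2)]) auto
  next
    assume "card (B w) + (N + M) + 2 * (others_bound \<C> P + piece_bound C1) \<le> 2 * Bd + 4"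
    with split_arith(3)[OF st P C01(2,1) C01(3)[symmetric]]
    show ?thesis by (intro good[of w u, OF _ C01(2) x1 w(2)]) auto
  qed
qed

text \<open>Either \<open>H\<close> itself is the linked set, or some set between \<open>Y\<close>
  and \<open>H\<close> is not linked in it and starts the splitting argument, with the degree
  \<open>\<delta>\<close> as the cap.\<close>

lemma dense_contains_linked:
  assumes fin: "finite H" and two: "\<And>e. e \<in> E \<Longrightarrow> card e = 2" and YH: "Y \<subseteq> H" and ne: "H \<noteq> {}"
    and dW: "\<And>v. v \<in> H - Y \<Longrightarrow> \<delta> \<le> card {w \<in> H. {v, w} \<in> E}"
    and dY: "\<And>v. v \<in> Y \<Longrightarrow> \<delta> + 1 \<le> card {w \<in> H - Y. {v, w} \<in> E} + card Y"
    and P1: "5 * (N + M) + card H \<le> 4 * \<delta> + 16" and P2: "3 * N + 1 \<le> \<delta>"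
    and P3: "card H + 2 * (N + M) + 4 \<le> 3 * \<delta>" and P4: "2 * (N + M) + 2 \<le> \<delta>"
  shows "\<exists>L\<subseteq>H. N < card L \<and> (\<forall>Z. Y \<inter> L \<subseteq> Z \<longrightarrow> Z \<subseteq> L \<longrightarrow> card Z \<le> N \<longrightarrow> linked M E L Z)"
proof (cases "\<forall>Z. Y \<inter> H \<subseteq> Z \<longrightarrow> Z \<subseteq> H \<longrightarrow> card Z \<le> N \<longrightarrow> linked M E H Z")
  case True
  obtain v where v: "v \<in> H" using ne by blast
  have "\<delta> \<le> card H"
  proof (cases "v \<in> Y")
    case False
    have "card {w \<in> H. {v, w} \<in> E} \<le> card H" using fin by (intro card_mono) auto
    then show ?thesis using dW[of v] v False by simp
  next
    case True
    have "card {w \<in> H - Y. {v, w} \<in> E} \<le> card (H - Y)" using fin by (intro card_mono) auto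
    then show ?thesis using dY[OF True] card_Diff_add[OF fin YH] by simp
  qed
  then have "N < card H" using P2 by simp
  then show ?thesis using True by blast
next
  case False
  then obtain Z where Z: "Y \<subseteq> Z" "Z \<subseteq> H" "card Z \<le> N" "\<not> linked M E H Z" using YH by blast
  have finZ: "finite Z" using Z(2) fin finite_subset by blast
  obtain \<P> where p: "parts M Z \<P>" "\<Union>\<P> = Z" "\<not> (\<exists>C. linkage E H \<P> C)"
    using linked_if_full[OF finZ, of M E H] Z(4) by blast
  have "card Z \<le> \<delta>" using Z(3) P2 by simp
  then have "linking E H Z \<P> M \<delta>" using fin two Z(2) p(1,2) by unfold_locales
  then show ?thesis using p(3) Z(1,3) dW dY P1 P2 P3 P4 by (rule linking.dense_subset_if_unlinked)
qed

section \<open>Massed pairs\<close>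

definition rho :: "'a set set \<Rightarrow> 'a set \<Rightarrow> 'a set \<Rightarrow> nat" where
  "rho E V U = card {e \<in> E. e \<subseteq> V \<and> e \<inter> U \<noteq> {}}"

definition massed :: "nat \<Rightarrow> 'a set set \<Rightarrow> 'a set \<Rightarrow> 'a set \<Rightarrow> bool" where
  "massed c E V X \<longleftrightarrow> finite V \<and> X \<subseteq> V \<and> c * card (V - X) < rho E V (V - X) \<and>
     (\<forall>A B. sep E V A B \<longrightarrow> X \<subseteq> A \<longrightarrow> card (A \<inter> B) < card X \<longrightarrow> rho E V (B - A) \<le> c * card (B - A))"

lemma rho_fin: "finite V \<Longrightarrow> finite {e \<in> E. e \<subseteq> V \<and> R e}"
  by (rule finite_subset[of _ "Pow V"]) auto

lemma linkageD:
  assumes "linkage E B \<P> C" "P \<in> \<P>" shows "P \<subseteq> C P" "C P \<subseteq> B" "conn E (C P)"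
  using assms unfolding linkage_def by auto

lemma linkage_disj: "linkage E B \<P> C \<Longrightarrow> P \<in> \<P> \<Longrightarrow> P' \<in> \<P> \<Longrightarrow> P \<noteq> P' \<Longrightarrow> C P \<inter> C P' = {}"
  unfolding linkage_def by auto

lemma edge_pair:
  assumes "card e = 2" "x \<in> e" obtains y where "e = {x, y}" "y \<noteq> x"
  using assms by (auto simp: card_2_iff insert_commute)

text \<open>An edge of \<open>V\<close> that meets \<open>B - A\<close> cannot leave
  \<open>B\<close>, so it is counted in \<open>B\<close> as well.\<close>

lemma rho_sep:
  assumes "sep E V A B" "U \<subseteq> B - A" "\<And>e. e \<in> E \<Longrightarrow> card e = 2"
  shows "rho E B U = rho E V U"
proof -
  have "e \<subseteq> B" if e: "e \<in> E" "e \<subseteq> V" "e \<inter> U \<noteq> {}" for e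
  proof -
    obtain x where x: "x \<in> e" "x \<in> U" using e(3) by blast
    obtain y where y: "e = {x, y}" using edge_pair[OF assms(3)[OF e(1)] x(1)] by metis
    have "y \<in> B"
      using sepD'[OF assms(1), of y x] e y x assms(1,2) by (auto simp: sep_def insert_commute)
    then show ?thesis using y x assms(2) by auto
  qed
  moreover have "B \<subseteq> V" using assms(1) by (auto simp: sep_def)
  ultimately have "{e \<in> E. e \<subseteq> B \<and> e \<inter> U \<noteq> {}} = {e \<in> E. e \<subseteq> V \<and> e \<inter> U \<noteq> {}}" by blast
  then show ?thesis by (simp add: rho_def)
qed

text \<open>The vertices of \<open>A\<close> can join the left side of a separation of
  \<open>B\<close> that keeps \<open>A \<inter> B\<close> there: those outside \<open>B\<close> have
  no neighbours in \<open>B - A\<close>. The order and the part cut off do not change.\<close>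

lemma sep_extend:
  assumes "sep E V A B" "sep E B A' B'" "A \<inter> B \<subseteq> A'"
  shows "sep E V (A \<union> A') B'" and "(A \<union> A') \<inter> B' = A' \<inter> B'" and "B' - (A \<union> A') = B' - A'"
proof -
  have AB: "A \<union> B = V" "A' \<union> B' = B" using assms by (auto simp: sep_def)
  show "(A \<union> A') \<inter> B' = A' \<inter> B'" "B' - (A \<union> A') = B' - A'" using AB assms(3) by auto
  have "{a, b} \<notin> E" if a: "a \<in> A \<union> A'" "a \<notin> B'" and b: "b \<in> B'" "b \<notin> A \<union> A'" for a b
  proof (cases "a \<in> A'")
    case True
    then show ?thesis using sepD[OF assms(2), of a b] a b by simp
  next
    case False
    then have "a \<in> A" "a \<notin> B" using a assms(3) by auto
    moreover have "b \<in> B" using b AB by auto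
    ultimately show ?thesis using sepD[OF assms(1), of a b] b by simp
  qed
  then show "sep E V (A \<union> A') B'" using AB unfolding sep_def by auto
qed

text \<open>A violation inside \<open>B\<close> extends to a separation of \<open>V\<close> that has
  smaller order and cuts off the same dense part, against the minimality of
  \<open>(A, B)\<close>.\<close>

lemma sub_massed:
  assumes fin: "finite V" and two: "\<And>e. e \<in> E \<Longrightarrow> card e = 2" and s: "sep E V A B" and XA: "X \<subseteq> A"
    and dense: "c * card (B - A) < rho E V (B - A)"
    and min: "\<And>A' B'. sep E V A' B' \<Longrightarrow> X \<subseteq> A' \<Longrightarrow> card (A' \<inter> B') < card (A \<inter> B) \<Longrightarrow>
      rho E V (B' - A') \<le> c * card (B' - A')"
  shows "massed c E B (A \<inter> B)"
  unfolding massed_def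
proof (intro conjI allI impI)
  have BV: "B \<subseteq> V" using s by (auto simp: sep_def)
  show "finite B" using BV fin finite_subset by blast
  show "A \<inter> B \<subseteq> B" by simp
  have e: "B - A \<inter> B = B - A" by blast
  show "c * card (B - A \<inter> B) < rho E B (B - A \<inter> B)"
    using dense rho_sep[OF s subset_refl] two by (simp add: e)
  fix A' B' assume s': "sep E B A' B'" "A \<inter> B \<subseteq> A'" "card (A' \<inter> B') < card (A \<inter> B)"
  note x = sep_extend[OF s s'(1,2)]
  have "B' - A' \<subseteq> B - A" using x(3) s'(1) by (auto simp: sep_def)
  then have "rho E B (B' - A') = rho E V (B' - A')" using two by (rule rho_sep[OF s])
  then show "rho E B (B' - A') \<le> c * card (B' - A')"
    using min[OF x(1)] XA s'(3) x(2,3) by auto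
qed

text \<open>A set that is linked inside \<open>B\<close> simulates a clique on \<open>A \<inter> B\<close>.\<close>

lemma linkage_through:
  assumes lk: "linked M E B Z" and finX: "finite X" and p: "parts M X \<P>"
    and C: "linkage E1 A \<P> C" and AB: "A \<inter> B \<subseteq> Z"
    and E1: "\<And>a b. {a, b} \<in> E1 \<Longrightarrow> {a, b} \<notin> E \<Longrightarrow> a \<in> B \<and> b \<in> B"
  shows "\<exists>C'. linkage E (A \<union> B) \<P> C'"
proof -
  have finP: "finite \<P>"
    by (rule finite_subset[of _ "Pow X"]) (use p finX in \<open>auto simp: parts_def\<close>)
  \<comment> \<open>A singleton part is cut down to its vertex. Otherwise its set could meet
    \<open>B\<close> in several vertices and raise the number of larger parts above
    \<open>M\<close>.\<close>
  define C0 where "C0 P = (if 2 \<le> card P then C P else P)" for P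
  have CP: "P \<subseteq> C P" "C P \<subseteq> A" "conn E1 (C P)" if "P \<in> \<P>" for P
    using linkageD[OF C that] by auto
  have sing: "\<exists>x. P = {x}" if P: "P \<in> \<P>" "\<not> 2 \<le> card P" for P
  proof -
    have "finite P" "P \<noteq> {}" using P p finX by (auto simp: parts_def intro: finite_subset)
    then have "card P \<noteq> 0" by simp
    then have "card P = 1" using P(2) by linarith
    then show ?thesis by (rule card_1_singletonE) blast
  qed
  have C0: "P \<subseteq> C0 P \<and> C0 P \<subseteq> A \<and> C0 P \<subseteq> C P \<and> conn E1 (C0 P)" if P: "P \<in> \<P>" for P
  proof (cases "2 \<le> card P")
    case True then show ?thesis using CP[OF P] by (simp add: C0_def)
  next
    case False
    then obtain x where "P = {x}" using sing[OF P] by blast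
    then show ?thesis using CP[OF P] False by (auto simp: C0_def)
  qed
  have dC: "C P \<inter> C P' = {}" if "P \<in> \<P>" "P' \<in> \<P>" "P \<noteq> P'" for P P'
    using linkage_disj[OF C that] .
  have dC0: "C0 P \<inter> C0 P' = {}" if "P \<in> \<P>" "P' \<in> \<P>" "P \<noteq> P'" for P P'
    using dC[OF that] C0[OF that(1)] C0[OF that(2)] by blast
  \<comment> \<open>The nonempty traces in \<open>B\<close> are the parts that have to be linked
    anew inside \<open>B\<close>.\<close>
  define \<Q> where "\<Q> = (\<lambda>P. C0 P \<inter> B) ` \<P> - {{}}"
  have "parts M Z \<Q>" unfolding parts_def
  proof (intro conjI)
    have "C0 P \<inter> B \<subseteq> Z" if "P \<in> \<P>" for P using C0[OF that] AB by blast
    then show "\<forall>Q\<in>\<Q>. Q \<noteq> {} \<and> Q \<subseteq> Z" unfolding \<Q>_def by fastforce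
    show "pairwise disjnt \<Q>"
      unfolding pairwise_def disjnt_def
    proof (intro ballI impI)
      fix Q Q' assume "Q \<in> \<Q>" "Q' \<in> \<Q>" "Q \<noteq> Q'"
      then obtain P P' where "P \<in> \<P>" "P' \<in> \<P>" "Q = C0 P \<inter> B" "Q' = C0 P' \<inter> B" "P \<noteq> P'"
        by (auto simp: \<Q>_def)
      then show "Q \<inter> Q' = {}" using dC0[of P P'] by auto
    qed
    have "{Q \<in> \<Q>. 2 \<le> card Q} \<subseteq> (\<lambda>P. C0 P \<inter> B) ` {P \<in> \<P>. 2 \<le> card P}"
    proof
      fix Q assume "Q \<in> {Q \<in> \<Q>. 2 \<le> card Q}"
      then obtain P where P: "P \<in> \<P>" "Q = C0 P \<inter> B" "2 \<le> card Q" by (auto simp: \<Q>_def)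
      have "2 \<le> card P"
      proof (rule ccontr)
        assume n: "\<not> ?thesis"
        then obtain x where "P = {x}" using sing[OF P(1)] by blast
        then have "Q \<subseteq> {x}" using n P(2) by (auto simp: C0_def)
        then have "card Q \<le> card {x}" by (intro card_mono) auto
        then show False using P(3) by simp
      qed
      then show "Q \<in> (\<lambda>P. C0 P \<inter> B) ` {P \<in> \<P>. 2 \<le> card P}" using P by blast
    qed
    then have "card {Q \<in> \<Q>. 2 \<le> card Q} \<le> card {P \<in> \<P>. 2 \<le> card P}"
      using finP by (intro surj_card_le) auto
    then show "card {Q \<in> \<Q>. 2 \<le> card Q} \<le> M" using p by (simp add: parts_def)
  qed
  then obtain D where D: "linkage E B \<Q> D" using lk unfolding linked_def by blast
  define D' where "D' P = (if C0 P \<inter> B = {} then {} else D (C0 P \<inter> B))" for P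
  have D': "D' P \<subseteq> B \<and> C0 P \<inter> B \<subseteq> D' P \<and> (C0 P \<inter> B \<noteq> {} \<longrightarrow> conn E (D' P))" if P: "P \<in> \<P>" for P
  proof (cases "C0 P \<inter> B = {}")
    case True then show ?thesis by (simp add: D'_def)
  next
    case False
    then have "C0 P \<inter> B \<in> \<Q>" using P by (simp add: \<Q>_def)
    note d = linkageD[OF D this]
    have "D' P = D (C0 P \<inter> B)" using False by (simp add: D'_def)
    then show ?thesis using d by (simp only: simp_thms)
  qed
  have dD: "D' P \<inter> D' P' = {}" if P: "P \<in> \<P>" "P' \<in> \<P>" "P \<noteq> P'" for P P'
  proof (cases "C0 P \<inter> B = {} \<or> C0 P' \<inter> B = {}")
    case True then show ?thesis by (auto simp: D'_def)
  next
    case False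
    then have "C0 P \<inter> B \<noteq> C0 P' \<inter> B" using dC0[OF P] by blast
    moreover have "C0 P \<inter> B \<in> \<Q>" "C0 P' \<inter> B \<in> \<Q>" using P False by (auto simp: \<Q>_def)
    ultimately have "D (C0 P \<inter> B) \<inter> D (C0 P' \<inter> B) = {}" by (intro linkage_disj[OF D])
    then show ?thesis using False by (simp add: D'_def)
  qed
  have cD: "C0 P \<inter> D' P' = {}" if P: "P \<in> \<P>" "P' \<in> \<P>" "P \<noteq> P'" for P P'
    using dD[OF P] D'[OF P(1)] D'[OF P(2)] by blast
  have "linkage E (A \<union> B) \<P> (\<lambda>P. C0 P \<union> D' P)"
    unfolding linkage_def
  proof (intro conjI ballI impI)
    fix P assume P: "P \<in> \<P>"
    show "P \<subseteq> C0 P \<union> D' P" "C0 P \<union> D' P \<subseteq> A \<union> B" using C0[OF P] D'[OF P] by auto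
    show "conn E (C0 P \<union> D' P)"
    proof (cases "C0 P \<inter> B = {}")
      case True
      have "conn E (C0 P)"
      proof (rule conn_mono[of E1])
        show "conn E1 (C0 P)" using C0[OF P] by simp
        show "{a, b} \<in> E" if "a \<in> C0 P" "b \<in> C0 P" "{a, b} \<in> E1" for a b
          using E1[OF that(3)] that(1) True by blast
      qed
      then show ?thesis using True by (simp add: D'_def)
    next
      case False
      then obtain x where x: "x \<in> C0 P" "x \<in> B" by blast
      have cD': "conn E (D' P)" and sub: "C0 P \<inter> B \<subseteq> D' P" using D'[OF P] False by auto
      show ?thesis
      proof (rule connI[of x])
        show "x \<in> C0 P \<union> D' P" using x by simp
        fix W assume W: "W \<subseteq> C0 P \<union> D' P" "x \<in> W" "W \<noteq> C0 P \<union> D' P"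
        show "\<exists>a\<in>W. \<exists>b\<in>C0 P \<union> D' P - W. {a, b} \<in> E"
        proof (cases "D' P \<subseteq> W")
          case False
          then obtain y where "y \<in> D' P" "y \<notin> W" by blast
          then show ?thesis using conn_cut[OF cD', of x W y] x W(2) sub by blast
        next
          case True
          then obtain y where y: "y \<in> C0 P" "y \<notin> W" using W by blast
          have "conn E1 (C0 P)" using C0[OF P] by simp
          then obtain a b where ab: "a \<in> C0 P" "a \<in> W" "b \<in> C0 P" "b \<notin> W" "{a, b} \<in> E1"
            using conn_cut[of E1 "C0 P" x W y] x W(2) y by blast
          \<comment> \<open>\<open>W\<close> contains the whole trace in \<open>B\<close>, so
            \<open>b\<close> is outside \<open>B\<close>, where all edges of \<open>E1\<close>
            belong to \<open>E\<close>.\<close>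
          have "b \<notin> B" using ab True sub by blast
          then have "{a, b} \<in> E" using E1[OF ab(5)] by blast
          then show ?thesis using ab by blast
        qed
      qed
    qed
    fix P' assume P': "P' \<in> \<P>" "P \<noteq> P'"
    show "(C0 P \<union> D' P) \<inter> (C0 P' \<union> D' P') = {}"
      using dC0[OF P P'] dD[OF P P'] cD[OF P P'] cD[OF P'(1) P P'(2)[symmetric]] by blast
  qed
  then show ?thesis by (intro exI[of _ "\<lambda>P. C0 P \<union> D' P"])
qed

text \<open>The sets \<open>Q z\<close> carry \<open>Z\<close> injectively into \<open>L\<close>; a
  linkage of the images is enlarged by them. The condition \<open>Q z \<inter> L = {f z}\<close>
  keeps a path from running into the set of a different part.\<close>

lemma linked_via_paths:
  assumes lk: "linked M E L (f ` Z)" and finZ: "finite Z" and LB: "L \<subseteq> B"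
    and Q: "\<And>z. z \<in> Z \<Longrightarrow> Q z \<subseteq> B \<and> conn E (Q z) \<and> z \<in> Q z \<and> Q z \<inter> L = {f z}"
    and dQ: "\<And>z z'. z \<in> Z \<Longrightarrow> z' \<in> Z \<Longrightarrow> z \<noteq> z' \<Longrightarrow> Q z \<inter> Q z' = {}"
  shows "linked M E B Z"
  unfolding linked_def
proof (intro allI impI)
  fix \<P> assume p: "parts M Z \<P>"
  have PZ: "P \<subseteq> Z" "P \<noteq> {}" if "P \<in> \<P>" for P using p that by (auto simp: parts_def)
  have injf: "inj_on f Z"
  proof (rule inj_onI, rule ccontr)
    fix z z' assume z: "z \<in> Z" "z' \<in> Z" "f z = f z'" "z \<noteq> z'"
    have "f z \<in> Q z" "f z' \<in> Q z'" using Q[OF z(1)] Q[OF z(2)] by auto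
    then show False using dQ[OF z(1,2,4)] z(3) by auto
  qed
  define \<Q> where "\<Q> = (\<lambda>P. f ` P) ` \<P>"
  have cf: "card (f ` P) = card P" if "P \<in> \<P>" for P
    using inj_on_subset[OF injf PZ(1)[OF that]] by (rule card_image)
  have "parts M (f ` Z) \<Q>" unfolding parts_def
  proof (intro conjI)
    show "\<forall>Q\<in>\<Q>. Q \<noteq> {} \<and> Q \<subseteq> f ` Z" using PZ by (auto simp: \<Q>_def)
    show "pairwise disjnt \<Q>" unfolding pairwise_def disjnt_def
    proof (intro ballI impI)
      fix A B assume "A \<in> \<Q>" "B \<in> \<Q>" "A \<noteq> B"
      then obtain P P' where P: "P \<in> \<P>" "P' \<in> \<P>" "A = f ` P" "B = f ` P'" "P \<noteq> P'" by (auto simp: \<Q>_def)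
      have "P \<inter> P' = {}" using parts_disjoint[OF p P(1,2)] P(5) by blast
      then show "A \<inter> B = {}" using inj_on_image_Int[OF injf PZ(1)[OF P(1)] PZ(1)[OF P(2)]] P by simp
    qed
    have "finite \<P>" by (rule finite_subset[of _ "Pow Z"]) (use PZ finZ in auto)
    moreover have "{Q \<in> \<Q>. 2 \<le> card Q} \<subseteq> (\<lambda>P. f ` P) ` {P \<in> \<P>. 2 \<le> card P}"
      using cf by (auto simp: \<Q>_def)
    ultimately have "card {Q \<in> \<Q>. 2 \<le> card Q} \<le> card {P \<in> \<P>. 2 \<le> card P}"
      by (intro surj_card_le) auto
    then show "card {Q \<in> \<Q>. 2 \<le> card Q} \<le> M" using p by (simp add: parts_def)
  qed
  then obtain D where D: "linkage E L \<Q> D" using lk unfolding linked_def by blast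
  have DP: "f ` P \<subseteq> D (f ` P)" "D (f ` P) \<subseteq> L" "conn E (D (f ` P))" if "P \<in> \<P>" for P
  proof -
    have "f ` P \<in> \<Q>" using that by (auto simp: \<Q>_def)
    note linkageD[OF D this]
    then show "f ` P \<subseteq> D (f ` P)" "D (f ` P) \<subseteq> L" "conn E (D (f ` P))" .
  qed
  have dD: "D (f ` P) \<inter> D (f ` P') = {}" if P: "P \<in> \<P>" "P' \<in> \<P>" "P \<noteq> P'" for P P'
  proof -
    have "f ` P \<noteq> f ` P'" using inj_on_image_eq_iff[OF injf PZ(1)[OF P(1)] PZ(1)[OF P(2)]] P(3) by simp
    moreover have "f ` P \<in> \<Q>" "f ` P' \<in> \<Q>" using P by (auto simp: \<Q>_def)
    ultimately show ?thesis by (intro linkage_disj[OF D])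
  qed
  define C where "C P = D (f ` P) \<union> (\<Union>z\<in>P. Q z)" for P
  have "linkage E B \<P> C" unfolding linkage_def
  proof (intro conjI ballI impI)
    fix P assume P: "P \<in> \<P>"
    have zQ: "z \<in> Z" "Q z \<subseteq> B" "conn E (Q z)" "z \<in> Q z" "Q z \<inter> L = {f z}" if "z \<in> P" for z
      using Q[of z] PZ(1)[OF P] that by auto
    show "P \<subseteq> C P" using zQ by (auto simp: C_def)
    show "C P \<subseteq> B" using zQ(2) DP(2)[OF P] LB by (auto simp: C_def)
    show "conn E (C P)" unfolding C_def
    proof (rule conn_UN)
      fix z assume z: "z \<in> P"
      show "conn E (Q z)" by (rule zQ(3)[OF z])
      have "f z \<in> Q z" "f z \<in> D (f ` P)" using zQ(5)[OF z] DP(1)[OF P] z by auto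
      then show "Q z \<inter> D (f ` P) \<noteq> {} \<or> (\<exists>a\<in>D (f ` P). \<exists>b\<in>Q z. {a, b} \<in> E)" by blast
    qed (rule DP(3)[OF P])
    fix P' assume P': "P' \<in> \<P>" "P \<noteq> P'"
    have cross: "D (f ` P1) \<inter> (\<Union>z\<in>P2. Q z) = {}"
      if PP: "P1 \<in> \<P>" "P2 \<in> \<P>" "P1 \<noteq> P2" for P1 P2
    proof -
      have False if y: "y \<in> D (f ` P1)" "z \<in> P2" "y \<in> Q z" for y z
      proof -
        have "z \<in> Z" using PZ(1)[OF PP(2)] y(2) by blast
        then have "Q z \<inter> L = {f z}" using Q by simp
        moreover have "y \<in> Q z \<inter> L" using y(1,3) DP(2)[OF PP(1)] by auto
        ultimately have "y = f z" by simp
        then have "y \<in> D (f ` P2)" using DP(1)[OF PP(2)] y(2) by auto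
        then show False using dD[OF PP] y(1) by blast
      qed
      then show ?thesis by blast
    qed
    have QQ: "(\<Union>z\<in>P. Q z) \<inter> (\<Union>z\<in>P'. Q z) = {}"
    proof -
      have False if "z \<in> P" "z' \<in> P'" "y \<in> Q z" "y \<in> Q z'" for z z' y
      proof -
        have "z \<noteq> z'" using parts_disjoint[OF p P P'(1)] that P'(2) by blast
        moreover have "z \<in> Z" "z' \<in> Z" using PZ(1)[OF P] PZ(1)[OF P'(1)] that by auto
        ultimately show False using dQ[of z z'] that by blast
      qed
      then show ?thesis by blast
    qed
    show "C P \<inter> C P' = {}"
      unfolding C_def Int_Un_distrib Int_Un_distrib2
      using dD[OF P P'] cross[OF P P'] cross[OF P'(1) P P'(2)[symmetric]] QQ by (simp add: Int_commute)
  qed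
  then show "\<exists>C. linkage E B \<P> C" by (intro exI[of _ C])
qed

section \<open>Minimal separations and the exclusion of linked sides\<close>

lemma ex_min_sep:
  assumes "X \<subseteq> V" "L \<subseteq> V"
  obtains A B where "sep E V A B" "X \<subseteq> A" "L \<subseteq> B"
    "\<And>A' B'. sep E V A' B' \<Longrightarrow> X \<subseteq> A' \<Longrightarrow> L \<subseteq> B' \<Longrightarrow> card (A \<inter> B) \<le> card (A' \<inter> B')"
proof -
  define ok where "ok p \<longleftrightarrow> sep E V (fst p) (snd p) \<and> X \<subseteq> fst p \<and> L \<subseteq> snd p" for p :: "'a set \<times> 'a set"
  have "ok (V, V)" using assms by (simp add: ok_def sep_def)
  then obtain p where p: "ok p" "\<And>q. ok q \<Longrightarrow> card (fst p \<inter> snd p) \<le> card (fst q \<inter> snd q)"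
    using ex_has_least_nat[of ok "(V, V)" "\<lambda>p. card (fst p \<inter> snd p)"] by blast
  show thesis
  proof (rule that)
    show "sep E V (fst p) (snd p)" "X \<subseteq> fst p" "L \<subseteq> snd p" using p(1) by (auto simp: ok_def)
    show "card (fst p \<inter> snd p) \<le> card (A' \<inter> B')" if "sep E V A' B'" "X \<subseteq> A'" "L \<subseteq> B'" for A' B'
      using p(2)[of "(A', B')"] that by (simp add: ok_def)
  qed
qed

text \<open>A separation of \<open>B\<close> between \<open>A \<inter> B\<close> and
  \<open>L\<close> extends to one of \<open>V\<close>, so none has order below
  \<open>card (A \<inter> B)\<close> and Menger's theorem applies inside \<open>B\<close>. The
  resulting sets are stopped at their first vertex in \<open>L\<close>.\<close>

lemma min_sep_paths:
  assumes fin: "finite V" and two: "\<And>e. e \<in> E \<Longrightarrow> card e = 2"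
    and s: "sep E V A B" "X \<subseteq> A" "L \<subseteq> B"
    and min: "\<And>A' B'. sep E V A' B' \<Longrightarrow> X \<subseteq> A' \<Longrightarrow> L \<subseteq> B' \<Longrightarrow> card (A \<inter> B) \<le> card (A' \<inter> B')"
  obtains Q f where
    "\<And>z. z \<in> A \<inter> B \<Longrightarrow> Q z \<subseteq> B \<and> conn E (Q z) \<and> z \<in> Q z \<and> Q z \<inter> L = {f z}"
    "\<And>z z'. z \<in> A \<inter> B \<Longrightarrow> z' \<in> A \<inter> B \<Longrightarrow> z \<noteq> z' \<Longrightarrow> Q z \<inter> Q z' = {}"
proof -
  have BV: "B \<subseteq> V" using s(1) by (auto simp: sep_def)
  have finB: "finite B" using BV fin finite_subset by blast
  define k where "k = card (A \<inter> B)"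
  have "k \<le> card (A' \<inter> B')" if "sep E B A' B'" "A \<inter> B \<subseteq> A'" "L \<subseteq> B'" for A' B'
  proof -
    have "card (A \<inter> B) \<le> card ((A \<union> A') \<inter> B')"
      using sep_extend(1)[OF s(1) that(1,2)] s(2) that(3) by (intro min) auto
    then show ?thesis using sep_extend(2)[OF s(1) that(1,2)] by (simp add: k_def)
  qed
  then have "\<exists>Q :: nat \<Rightarrow> 'a set.
      (\<forall>i<k. Q i \<subseteq> B \<and> conn E (Q i) \<and> Q i \<inter> (A \<inter> B) \<noteq> {} \<and> Q i \<inter> L \<noteq> {}) \<and>
      (\<forall>i<k. \<forall>j<k. i \<noteq> j \<longrightarrow> Q i \<inter> Q j = {})"
    by (intro menger[OF finB _ Int_lower2 s(3)]) (rule two)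
  then obtain Q0 :: "nat \<Rightarrow> 'a set" where
    Q0: "\<forall>i<k. Q0 i \<subseteq> B \<and> conn E (Q0 i) \<and> Q0 i \<inter> (A \<inter> B) \<noteq> {} \<and> Q0 i \<inter> L \<noteq> {}"
    and dQ0: "\<forall>i<k. \<forall>j<k. i \<noteq> j \<longrightarrow> Q0 i \<inter> Q0 j = {}" by (elim exE conjE)
  note Q0 = Q0[rule_format] and dQ0 = dQ0[rule_format]
  have finAB: "finite (A \<inter> B)" using finB by simp
  obtain h where h: "bij_betw h (A \<inter> B) {..<k}" "\<And>t. t \<in> A \<inter> B \<Longrightarrow> Q0 (h t) \<inter> (A \<inter> B) = {t}"
  proof (rule index_by_target[OF finAB k_def[symmetric], of Q0])
    show "Q0 i \<inter> (A \<inter> B) \<noteq> {}" if "i < k" for i using Q0[OF that] by blast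
    show "Q0 i \<inter> Q0 j = {}" if "i < k" "j < k" "i \<noteq> j" for i j using dQ0[OF that(1,2)] that(3) by blast
  qed blast
  have hk: "h t < k" if "t \<in> A \<inter> B" for t using h(1) that by (auto simp: bij_betw_def)
  have "\<forall>z. \<exists>R y. z \<in> A \<inter> B \<longrightarrow> R \<subseteq> Q0 (h z) \<and> conn E R \<and> z \<in> R \<and> R \<inter> L = {y}"
  proof
    fix z
    show "\<exists>R y. z \<in> A \<inter> B \<longrightarrow> R \<subseteq> Q0 (h z) \<and> conn E R \<and> z \<in> R \<and> R \<inter> L = {y}"
    proof (cases "z \<in> A \<inter> B")
      case True
      note q = Q0[OF hk[OF True]]
      have fq: "finite (Q0 (h z))" using q finB finite_subset by blast
      have "z \<in> Q0 (h z)" using h(2)[OF True] by blast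
      then show ?thesis using conn_first_hit[of E "Q0 (h z)" z L] q fq by blast
    qed blast
  qed
  then obtain Q f where Q: "\<And>z. z \<in> A \<inter> B \<Longrightarrow> Q z \<subseteq> Q0 (h z) \<and> conn E (Q z) \<and> z \<in> Q z \<and> Q z \<inter> L = {f z}"
    by metis
  show thesis
  proof (rule that)
    fix z assume z: "z \<in> A \<inter> B"
    show "Q z \<subseteq> B \<and> conn E (Q z) \<and> z \<in> Q z \<and> Q z \<inter> L = {f z}" using Q[OF z] Q0[OF hk[OF z]] by auto
    fix z' assume z': "z' \<in> A \<inter> B" "z \<noteq> z'"
    have "h z \<noteq> h z'" using h(1) z z' by (auto simp: bij_betw_def inj_on_def)
    then show "Q z \<inter> Q z' = {}" using dQ0[OF hk[OF z] hk[OF z'(1)]] Q[OF z] Q[OF z'(1)] by blast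
  qed
qed

lemma sep_sym: "sep E V A B \<Longrightarrow> sep E V B A"
  unfolding sep_def by (metis Un_commute insert_commute)

lemma linked_subset: "linked M E B Z \<Longrightarrow> Z' \<subseteq> Z \<Longrightarrow> linked M E B Z'"
  unfolding linked_def parts_def by (meson subset_trans)

text \<open>By \<open>IH\<close> every smaller massed set is linked. Induction on
  \<open>card A\<close>. At order \<open>card X\<close>, a minimal separation between
  \<open>X\<close> and \<open>A \<inter> B\<close> inside \<open>A\<close> is either a smaller
  instance or provides paths that link \<open>X\<close>. At smaller order, \<open>B\<close> is
  represented by a clique on \<open>A \<inter> B\<close>; then \<open>X\<close> is massed in
  \<open>A\<close>, hence linked, or a dense part of \<open>A\<close> behind a separation of minimal
  order leads to a smaller instance or a contradiction.\<close>

lemma no_rigid: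
  fixes V :: "'a set"
  assumes IH: "\<And>E' V' (X' :: 'a set). card V' < card V \<Longrightarrow> (\<forall>e\<in>E'. card e = 2) \<Longrightarrow> massed c E' V' X' \<Longrightarrow>
      card X' \<le> N \<Longrightarrow> linked M E' V' X'"
    and m: "massed c E V X" and two: "\<forall>e\<in>E. card e = 2" and XN: "card X \<le> N"
    and not: "\<not> linked M E V X"
    and "sep E V A B" "X \<subseteq> A" "card (A \<inter> B) \<le> card X" "B - A \<noteq> {}" "linked M E B (A \<inter> B)"
  shows False
  using assms(6-10)
proof (induction "card A" arbitrary: A B rule: less_induct)
  case less
  note s = less.prems(1) and XA = less.prems(2) and ord = less.prems(3) and ne = less.prems(4)
    and lk = less.prems(5)
  have finV: "finite V" and XV: "X \<subseteq> V" using m by (auto simp: massed_def)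
  have ii: "rho E V (B' - A') \<le> c * card (B' - A')"
    if "sep E V A' B'" "X \<subseteq> A'" "card (A' \<inter> B') < card X" for A' B'
    using m that by (simp add: massed_def)
  have V: "V = A \<union> B" using s by (auto simp: sep_def)
  have finA: "finite A" using V finV by simp
  have finX: "finite X" using XV finV finite_subset by blast
  have AV: "card A < card V" using V ne finV by (intro psubset_card_mono) auto
  show False
  proof (cases "card (A \<inter> B) = card X")
    case True
    obtain A2 B2 where s2: "sep E A A2 B2" "X \<subseteq> A2" "A \<inter> B \<subseteq> B2"
      and min: "\<And>A' B'. sep E A A' B' \<Longrightarrow> X \<subseteq> A' \<Longrightarrow> A \<inter> B \<subseteq> B' \<Longrightarrow> card (A2 \<inter> B2) \<le> card (A' \<inter> B')"
      using ex_min_sep[of X A "A \<inter> B" E] XA by blast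
    have lkB: "linked M E B (f ` Z)" if "f ` Z \<subseteq> A \<inter> B" for f :: "'a \<Rightarrow> 'a" and Z
      by (rule linked_subset[OF lk that])
    show False
    proof (cases "card (A2 \<inter> B2) < card X")
      case small: True
      obtain Q f where Q: "\<And>z. z \<in> A2 \<inter> B2 \<Longrightarrow> Q z \<subseteq> B2 \<and> conn E (Q z) \<and> z \<in> Q z \<and> Q z \<inter> (A \<inter> B) = {f z}"
        and dQ: "\<And>z z'. z \<in> A2 \<inter> B2 \<Longrightarrow> z' \<in> A2 \<inter> B2 \<Longrightarrow> z \<noteq> z' \<Longrightarrow> Q z \<inter> Q z' = {}"
        using min_sep_paths[OF finA _ s2 min, of thesis] two by blast
      have A2A: "A2 \<subseteq> A" "B2 \<subseteq> A" using s2(1) by (auto simp: sep_def)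
      \<comment> \<open>The paths from the smaller separator to \<open>A \<inter> B\<close> carry
        the linkedness over, so \<open>(A2, B2 \<union> B)\<close> is an instance with a smaller
        left side.\<close>
      have "linked M E (B2 \<union> B) (A2 \<inter> B2)"
      proof (rule linked_via_paths[of M E B f _ _ Q])
        have "f ` (A2 \<inter> B2) \<subseteq> A \<inter> B" using Q by blast
        then show "linked M E B (f ` (A2 \<inter> B2))" by (rule lkB)
        show "finite (A2 \<inter> B2)" using A2A finA finite_subset by blast
        show "Q z \<subseteq> B2 \<union> B \<and> conn E (Q z) \<and> z \<in> Q z \<and> Q z \<inter> B = {f z}" if "z \<in> A2 \<inter> B2" for z
          using Q[OF that] A2A(2) by blast
        show "Q z \<inter> Q z' = {}" if "z \<in> A2 \<inter> B2" "z' \<in> A2 \<inter> B2" "z \<noteq> z'" for z z'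
          by (rule dQ[OF that])
      qed simp
      moreover note x = sep_extend[OF sep_sym[OF s] sep_sym[OF s2(1)]]
      have BA: "B \<inter> A \<subseteq> B2" using s2(3) by blast
      have "sep E V A2 (B2 \<union> B)" using sep_sym[OF x(1)[OF BA]] by (simp add: Un_commute)
      moreover have e: "A2 \<inter> (B2 \<union> B) = A2 \<inter> B2" using x(2)[OF BA] by blast
      moreover have "B2 \<union> B - A2 \<noteq> {}" using ne A2A by blast
      moreover have "A2 \<noteq> A"
      proof
        assume "A2 = A"
        then have "A \<inter> B \<subseteq> A2 \<inter> B2" using s2(3) by blast
        then have "card (A \<inter> B) \<le> card (A2 \<inter> B2)" using A2A finA by (intro card_mono) (auto intro: finite_subset)
        then show False using True small by simp
      qed
      then have "card A2 < card A" using A2A finA by (intro psubset_card_mono) auto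
      ultimately show False using less.hyps[of A2 "B2 \<union> B"] s2(2) small by simp
    next
      case False
      have sX: "sep E A X A" using XA by (auto simp: sep_def)
      have XAe: "X \<inter> A = X" using XA by blast
      have "card (X \<inter> A) \<le> card (A' \<inter> B')" if "sep E A A' B'" "X \<subseteq> A'" "A \<inter> B \<subseteq> B'" for A' B'
        using min[OF that] False XAe by simp
      then obtain Q f where Q: "\<And>z. z \<in> X \<inter> A \<Longrightarrow> Q z \<subseteq> A \<and> conn E (Q z) \<and> z \<in> Q z \<and> Q z \<inter> (A \<inter> B) = {f z}"
        and dQ: "\<And>z z'. z \<in> X \<inter> A \<Longrightarrow> z' \<in> X \<inter> A \<Longrightarrow> z \<noteq> z' \<Longrightarrow> Q z \<inter> Q z' = {}"
        using min_sep_paths[OF finA _ sX subset_refl Int_lower1, of B thesis] two by blast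
      have "linked M E V X"
      proof (rule linked_via_paths[of M E B f _ _ Q])
        have "f ` X \<subseteq> A \<inter> B" using Q XAe by blast
        then show "linked M E B (f ` X)" by (rule lkB)
        show "Q z \<subseteq> V \<and> conn E (Q z) \<and> z \<in> Q z \<and> Q z \<inter> B = {f z}" if "z \<in> X" for z
          using Q[of z] that XAe V by blast
        show "Q z \<inter> Q z' = {}" if "z \<in> X" "z' \<in> X" "z \<noteq> z'" for z z'
          using dQ[of z z'] that XAe by blast
      qed (use finX V in auto)
      then show False using not by simp
    qed
  next
    case False
    then have lt: "card (A \<inter> B) < card X" using ord by simp
    define E1 where "E1 = E \<union> {{a, b} | a b. a \<in> A \<inter> B \<and> b \<in> A \<inter> B \<and> a \<noteq> b}"
    have two1: "\<forall>e\<in>E1. card e = 2" using two by (auto simp: E1_def)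
    have E1in: "a \<in> A \<inter> B \<and> b \<in> A \<inter> B" if "{a, b} \<in> E1" "{a, b} \<notin> E" for a b
      using that by (auto simp: E1_def doubleton_eq_iff)
    have thr: "\<exists>C'. linkage E (W \<union> B) \<P> C'"
      if "linkage E1 W \<P> C" "parts M Z \<P>" "finite Z" "W \<subseteq> A" for W Z \<P> C
      by (rule linkage_through[OF lk that(3,2,1)]) (use that(4) E1in in blast)+
    \<comment> \<open>The order is below \<open>card X\<close>, so \<open>B - A\<close> has at most
      \<open>c\<close> edges per vertex and removing it leaves \<open>A\<close> dense.\<close>
    have i: "c * card (A - X) < rho E1 A (A - X)"
    proof -
      have "{e \<in> E. e \<subseteq> V \<and> e \<inter> (V - X) \<noteq> {}} \<subseteq>
          {e \<in> E1. e \<subseteq> A \<and> e \<inter> (A - X) \<noteq> {}} \<union> {e \<in> E. e \<subseteq> V \<and> e \<inter> (B - A) \<noteq> {}}"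
        using V by (auto simp: E1_def)
      then have "rho E V (V - X) \<le> card ({e \<in> E1. e \<subseteq> A \<and> e \<inter> (A - X) \<noteq> {}} \<union> {e \<in> E. e \<subseteq> V \<and> e \<inter> (B - A) \<noteq> {}})"
        unfolding rho_def using rho_fin[OF finV] rho_fin[OF finA] by (intro card_mono) auto
      also have "\<dots> \<le> rho E1 A (A - X) + rho E V (B - A)" unfolding rho_def by (rule card_Un_le)
      finally have 1: "rho E V (V - X) \<le> rho E1 A (A - X) + c * card (B - A)"
        using ii[OF s XA lt] by simp
      have "V - X = (A - X) \<union> (B - A)" using V XA by blast
      moreover have "card (A - X \<union> (B - A)) = card (A - X) + card (B - A)"
        using finV V by (intro card_Un_disjoint) auto
      ultimately have "card (V - X) = card (A - X) + card (B - A)" by simp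
      then have "c * card (V - X) = c * card (A - X) + c * card (B - A)" by (simp add: distrib_left)
      moreover have "c * card (V - X) < rho E V (V - X)" using m by (simp add: massed_def)
      ultimately show ?thesis using 1 by simp
    qed
    define bad where "bad p \<longleftrightarrow> sep E1 A (fst p) (snd p) \<and> X \<subseteq> fst p \<and> card (fst p \<inter> snd p) < card X \<and>
        c * card (snd p - fst p) < rho E1 A (snd p - fst p)" for p
    show False
    proof (cases "\<exists>p. bad p")
      case False
      have "massed c E1 A X" unfolding massed_def
      proof (intro conjI allI impI)
        fix A' B' assume "sep E1 A A' B'" "X \<subseteq> A'" "card (A' \<inter> B') < card X"
        moreover have "\<not> bad (A', B')" using False by blast
        ultimately show "rho E1 A (B' - A') \<le> c * card (B' - A')" by (simp add: bad_def)
      qed (use finA XA i in auto)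
      then have "linked M E1 A X" using IH[OF AV two1] XN by simp
      then have "linked M E V X" using thr[of A _ _ X] finX V unfolding linked_def by blast
      then show False using not by simp
    next
      case True
      then obtain p where p: "bad p" "\<And>q. bad q \<Longrightarrow> card (fst p \<inter> snd p) \<le> card (fst q \<inter> snd q)"
        using ex_has_least_nat[of bad _ "\<lambda>p. card (fst p \<inter> snd p)"] by blast
      obtain A1 B1 where pe: "p = (A1, B1)" by (cases p)
      have s1: "sep E1 A A1 B1" "X \<subseteq> A1" "card (A1 \<inter> B1) < card X" "c * card (B1 - A1) < rho E1 A (B1 - A1)"
        using p(1) by (auto simp: bad_def pe)
      have A1: "A = A1 \<union> B1" using s1(1) by (auto simp: sep_def)
      have s1': "sep E A A1 B1" using s1(1) by (auto simp: sep_def E1_def)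
      have ne1: "B1 - A1 \<noteq> {}"
      proof
        assume "B1 - A1 = {}"
        then show False using s1(4) by (simp only: rho_def) simp
      qed
      \<comment> \<open>A clique cannot be split by a separation, so it lies on one side.\<close>
      consider "A \<inter> B \<subseteq> A1" | "A \<inter> B \<subseteq> B1"
      proof -
        have False if "a \<in> A \<inter> B" "a \<notin> A1" "b \<in> A \<inter> B" "b \<notin> B1" for a b
        proof -
          have "a \<in> B1" "b \<in> A1" using that A1 by auto
          moreover have "{b, a} \<in> E1" using that \<open>a \<in> B1\<close> by (auto simp: E1_def)
          ultimately show False using sepD[OF s1(1), of b a] that by simp
        qed
        then show thesis using that by blast
      qed
      then show False
      proof cases
        case 1
        have BA: "B \<inter> A \<subseteq> A1" using 1 by blast
        note x = sep_extend[OF sep_sym[OF s] s1' BA]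
        \<comment> \<open>No clique edge meets the dense part in this case, so it would already be
          dense in \<open>V\<close>, against \<open>massed\<close>.\<close>
        have "rho E V (B1 - A1) \<le> c * card (B1 - A1)"
          using ii[OF x(1)] s1(2,3) x(2,3) by auto
        moreover have "{e \<in> E1. e \<subseteq> A \<and> e \<inter> (B1 - A1) \<noteq> {}} \<subseteq> {e \<in> E. e \<subseteq> V \<and> e \<inter> (B1 - A1) \<noteq> {}}"
          using 1 V by (auto simp: E1_def)
        then have "rho E1 A (B1 - A1) \<le> rho E V (B1 - A1)"
          unfolding rho_def using rho_fin[OF finV] by (intro card_mono)
        ultimately show False using s1(4) by simp
      next
        case 2
        have BA: "B \<inter> A \<subseteq> B1" using 2 by blast
        note x = sep_extend[OF sep_sym[OF s] sep_sym[OF s1'] BA]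
        \<comment> \<open>By the minimal order this side is massed and hence linked with the help of
          the clique, which the linked set in \<open>B\<close> then replaces.\<close>
        have m1: "massed c E1 B1 (A1 \<inter> B1)"
        proof (rule sub_massed[OF finA _ s1(1,2,4)])
          show "card e = 2" if "e \<in> E1" for e using two1 that by blast
          fix A' B' assume q: "sep E1 A A' B'" "X \<subseteq> A'" "card (A' \<inter> B') < card (A1 \<inter> B1)"
          then have "\<not> bad (A', B')" using p(2)[of "(A', B')"] pe by auto
          then show "rho E1 A (B' - A') \<le> c * card (B' - A')" using q s1(3) by (simp add: bad_def)
        qed
        have "card B1 \<le> card A" using A1 finA by (intro card_mono) auto
        then have "linked M E1 B1 (A1 \<inter> B1)"
          using AV s1(3) XN by (intro IH[OF _ two1 m1]) auto
        moreover have "finite (A1 \<inter> B1)" using A1 finA by simp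
        ultimately have lk1: "linked M E (B1 \<union> B) (A1 \<inter> B1)"
          using thr[of B1 _ _ "A1 \<inter> B1"] A1 unfolding linked_def by blast
        have "sep E V A1 (B1 \<union> B)" using sep_sym[OF x(1)] by (simp add: Un_commute)
        moreover have "A1 \<inter> (B1 \<union> B) = A1 \<inter> B1" using x(2) by blast
        moreover have "B1 \<union> B - A1 \<noteq> {}" using ne1 by blast
        moreover have "card A1 < card A" using A1 ne1 finA by (intro psubset_card_mono) auto
        ultimately show False using less.hyps[of A1 "B1 \<union> B"] s1(2,3) lk1 by simp
      qed
    qed
  qed
qed

section \<open>Contracting an edge in a smallest counterexample\<close>

definition contr :: "'a set set \<Rightarrow> 'a \<Rightarrow> 'a \<Rightarrow> 'a set set" where
  "contr E v u = {e \<in> E. v \<notin> e} \<union> {{u, w} | w. {v, w} \<in> E \<and> w \<noteq> u}"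

lemma contr_keep: "e \<in> E \<Longrightarrow> v \<notin> e \<Longrightarrow> e \<in> contr E v u"
  by (simp add: contr_def)

lemma contr_new: "{v, w} \<in> E \<Longrightarrow> w \<noteq> u \<Longrightarrow> {u, w} \<in> contr E v u"
  by (auto simp: contr_def)

text \<open>An edge \<open>{u, w}\<close> of the contracted graph stems from \<open>{u, w}\<close>
  or \<open>{v, w}\<close>, so a set containing \<open>u\<close> stays connected once
  \<open>v\<close> is put back.\<close>

lemma contr_conn:
  assumes c: "conn (contr E v u) C" and v: "v \<notin> C" "{v, u} \<in> E"
  shows "conn E (if u \<in> C then insert v C else C)"
proof (cases "u \<in> C")
  case False
  have "conn E C"
  proof (rule conn_mono[OF c])
    fix a b assume "a \<in> C" "b \<in> C" "{a, b} \<in> contr E v u"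
    then show "{a, b} \<in> E" using False by (auto simp: contr_def doubleton_eq_iff)
  qed
  then show ?thesis using False by simp
next
  case True
  have "conn E (insert v C)"
  proof (rule connI[of u])
    show "u \<in> insert v C" using True by simp
    fix W assume W: "W \<subseteq> insert v C" "u \<in> W" "W \<noteq> insert v C"
    show "\<exists>a\<in>W. \<exists>b\<in>insert v C - W. {a, b} \<in> E"
    proof (cases "v \<in> W")
      case False
      then show ?thesis using W(2) v(2) by (metis DiffI insertI1 insert_commute)
    next
      case vW: True
      then obtain y where "y \<in> C" "y \<notin> W" using W by blast
      then obtain a b where ab: "a \<in> C" "a \<in> W" "b \<in> C" "b \<notin> W" "{a, b} \<in> contr E v u"
        using conn_cut[OF c, of u W y] True W(2) by blast
      have "{a, b} \<in> E \<or> {v, b} \<in> E"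
        using ab(5) ab(4) W(2) by (auto simp: contr_def doubleton_eq_iff)
      then show ?thesis using ab vW by blast
    qed
  qed
  then show ?thesis using True by simp
qed

lemma contr_linked:
  assumes lk: "linked M (contr E v u) B Z" and v: "v \<notin> B" "{v, u} \<in> E"
  shows "linked M E (if u \<in> B then insert v B else B) Z"
  unfolding linked_def
proof (intro allI impI)
  fix \<P> assume p: "parts M Z \<P>"
  then obtain C where C: "linkage (contr E v u) B \<P> C" using lk unfolding linked_def by blast
  define C' where "C' P = (if u \<in> C P then insert v (C P) else C P)" for P
  have vC: "v \<notin> C P" if "P \<in> \<P>" for P using linkageD(2)[OF C that] v(1) by blast
  have "linkage E (if u \<in> B then insert v B else B) \<P> C'"
    unfolding linkage_def
  proof (intro conjI ballI impI)
    fix P assume P: "P \<in> \<P>"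
    note d = linkageD[OF C P]
    show "P \<subseteq> C' P" using d by (auto simp: C'_def)
    show "C' P \<subseteq> (if u \<in> B then insert v B else B)" using d by (auto simp: C'_def)
    show "conn E (C' P)" unfolding C'_def by (rule contr_conn[OF d(3) vC[OF P] v(2)])
    fix P' assume P': "P' \<in> \<P>" "P \<noteq> P'"
    show "C' P \<inter> C' P' = {}"
      using linkage_disj[OF C P P'] vC[OF P] vC[OF P'(1)] by (auto simp: C'_def)
  qed
  then show "\<exists>C. linkage E (if u \<in> B then insert v B else B) \<P> C" by (intro exI[of _ C'])
qed

text \<open>Suppose the contracted graph were dense. If \<open>X\<close> is massed in it, then
  \<open>X\<close> is linked there and, after uncontracting, in \<open>V\<close>. Otherwise a
  separation of minimal order cuts off a dense and therefore massed side, and uncontracting gives a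
  separation excluded by \<open>no_rigid\<close>. If \<open>u\<close> is on both sides, then
  \<open>v\<close> has to be as well and the order may rise to \<open>card X\<close>.\<close>

lemma contr_sparse:
  fixes V :: "'a set"
  assumes IH: "\<And>E' V' (X' :: 'a set). card V' < card V \<Longrightarrow> (\<forall>e\<in>E'. card e = 2) \<Longrightarrow> massed c E' V' X' \<Longrightarrow>
      card X' \<le> N \<Longrightarrow> linked M E' V' X'"
    and m: "massed c E V X" and two: "\<forall>e\<in>E. card e = 2" and XN: "card X \<le> N"
    and not: "\<not> linked M E V X"
    and v: "v \<in> V - X" and u: "u \<in> V" and vu: "{v, u} \<in> E"
  shows "rho (contr E v u) (V - {v}) (V - {v} - X) \<le> c * card (V - {v} - X)"
proof (rule ccontr)
  assume dense: "\<not> ?thesis"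
  define E' where "E' = contr E v u"
  define V' where "V' = V - {v}"
  have finV: "finite V" and XV: "X \<subseteq> V" using m by (auto simp: massed_def)
  have finV': "finite V'" and XV': "X \<subseteq> V'" using finV XV v by (auto simp: V'_def)
  have uv: "u \<noteq> v" using two vu by fastforce
  have two': "\<forall>e\<in>E'. card e = 2" using two by (auto simp: E'_def contr_def)
  have V'lt: "card V' < card V" unfolding V'_def using v finV by (intro psubset_card_mono) auto
  have ii: "rho E V (B' - A') \<le> c * card (B' - A')"
    if "sep E V A' B'" "X \<subseteq> A'" "card (A' \<inter> B') < card X" for A' B'
    using m that by (simp add: massed_def)
  have rigid: False
    if "sep E V A B" "X \<subseteq> A" "card (A \<inter> B) \<le> card X" "B - A \<noteq> {}" "linked M E B (A \<inter> B)" for A B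
    by (rule no_rigid[OF _ m two XN not that]) (rule IH)
  define bad where "bad p \<longleftrightarrow> sep E' V' (fst p) (snd p) \<and> X \<subseteq> fst p \<and> card (fst p \<inter> snd p) < card X \<and>
      c * card (snd p - fst p) < rho E' V' (snd p - fst p)" for p
  show False
  proof (cases "\<exists>p. bad p")
    case False
    have "massed c E' V' X" unfolding massed_def
    proof (intro conjI allI impI)
      fix A' B' assume "sep E' V' A' B'" "X \<subseteq> A'" "card (A' \<inter> B') < card X"
      moreover have "\<not> bad (A', B')" using False by blast
      ultimately show "rho E' V' (B' - A') \<le> c * card (B' - A')" by (simp add: bad_def)
    qed (use finV' XV' dense in \<open>auto simp: E'_def V'_def\<close>)
    then have "linked M E' V' X" using IH[OF V'lt two'] XN by simp
    then have "linked M E (if u \<in> V' then insert v V' else V') X"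
      unfolding E'_def by (rule contr_linked) (use vu in \<open>auto simp: V'_def\<close>)
    moreover have "(if u \<in> V' then insert v V' else V') = V" using u uv v by (auto simp: V'_def)
    ultimately show False using not by simp
  next
    case True
    then obtain p where p: "bad p" "\<And>q. bad q \<Longrightarrow> card (fst p \<inter> snd p) \<le> card (fst q \<inter> snd q)"
      using ex_has_least_nat[of bad _ "\<lambda>p. card (fst p \<inter> snd p)"] by blast
    obtain A' B' where pe: "p = (A', B')" by (cases p)
    have s': "sep E' V' A' B'" "X \<subseteq> A'" "card (A' \<inter> B') < card X" "c * card (B' - A') < rho E' V' (B' - A')"
      using p(1) by (auto simp: bad_def pe)
    have AB: "V' = A' \<union> B'" using s'(1) by (auto simp: sep_def)
    have vAB: "v \<notin> A'" "v \<notin> B'" using AB by (auto simp: V'_def)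
    have Ve: "V = insert v (A' \<union> B')" using AB v by (auto simp: V'_def)
    have finAB: "finite A'" "finite B'" using AB finV' by auto
    have m': "massed c E' B' (A' \<inter> B')"
    proof (rule sub_massed[OF finV' _ s'(1,2,4)])
      show "card e = 2" if "e \<in> E'" for e using two' that by blast
      fix A1 B1 assume q: "sep E' V' A1 B1" "X \<subseteq> A1" "card (A1 \<inter> B1) < card (A' \<inter> B')"
      then have "\<not> bad (A1, B1)" using p(2)[of "(A1, B1)"] pe by auto
      then show "rho E' V' (B1 - A1) \<le> c * card (B1 - A1)" using q s'(3) by (simp add: bad_def)
    qed
    have "card B' \<le> card V'" using AB finV' by (intro card_mono) auto
    then have lk': "linked M E' B' (A' \<inter> B')"
      using V'lt s'(3) XN by (intro IH[OF _ two' m']) auto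
    have ne: "B' - A' \<noteq> {}"
    proof
      assume "B' - A' = {}"
      then show False using s'(4) by (simp only: rho_def) simp
    qed
    have cross: "{a, b} \<notin> E" if "a \<in> A'" "a \<notin> B'" "b \<in> B'" "b \<notin> A'" for a b
    proof
      assume "{a, b} \<in> E"
      then have "{a, b} \<in> E'" unfolding E'_def using that vAB by (intro contr_keep) auto
      then show False using sepD[OF s'(1)] that by blast
    qed
    have uAB: "u \<in> A' \<union> B'" using u uv Ve by auto
    consider "u \<notin> B'" | "u \<in> B'" "u \<notin> A'" | "u \<in> A'" "u \<in> B'" by blast
    then show False
    proof cases
      case 1
      have "linked M E B' (A' \<inter> B')"
        using contr_linked[OF lk'[unfolded E'_def] vAB(2) vu] 1 by simp
      moreover have "{v, b} \<notin> E" if "b \<in> B'" "b \<notin> A'" for b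
      proof
        assume "{v, b} \<in> E"
        then have "{u, b} \<in> E'" unfolding E'_def using that 1 by (intro contr_new) auto
        then show False using sepD[OF s'(1), of u b] that 1 uAB by blast
      qed
      then have "sep E V (insert v A') B'" using cross Ve unfolding sep_def by auto
      moreover have "insert v A' \<inter> B' = A' \<inter> B'" using vAB by auto
      moreover have "X \<subseteq> insert v A'" "B' - insert v A' \<noteq> {}" using s'(2) ne vAB by auto
      ultimately show False using rigid[of "insert v A'" B'] s'(3) by simp
    next
      case 2
      have "linked M E (insert v B') (A' \<inter> B')"
        using contr_linked[OF lk'[unfolded E'_def] vAB(2) vu] 2 by simp
      moreover have "{a, v} \<notin> E" if "a \<in> A'" "a \<notin> B'" for a
      proof
        assume "{a, v} \<in> E"
        then have "{v, a} \<in> E" by (simp add: insert_commute)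
        then have "{u, a} \<in> E'" unfolding E'_def using that 2 by (intro contr_new) auto
        then show False using sepD'[OF s'(1), of a u] that 2 by blast
      qed
      then have "sep E V A' (insert v B')" using cross Ve unfolding sep_def by auto
      moreover have "A' \<inter> insert v B' = A' \<inter> B'" using vAB by auto
      moreover have "insert v B' - A' \<noteq> {}" using ne by auto
      ultimately show False using rigid[of A' "insert v B'"] s'(2,3) by simp
    next
      case 3
      \<comment> \<open>Here the linkage of the contracted side does not treat \<open>v\<close> as a
        terminal, so the side with \<open>v\<close> is shown to be massed in the original
        graph.\<close>
      define A where "A = insert v A'"
      define B where "B = insert v B'"
      have sAB: "sep E V A B" using cross Ve unfolding sep_def A_def B_def by auto
      have int: "A \<inter> B = insert v (A' \<inter> B')" by (auto simp: A_def B_def)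
      have diff: "B - A = B' - A'" using vAB by (auto simp: A_def B_def)
      have ord: "card (A \<inter> B) \<le> card X" unfolding int using s'(3) vAB finAB by simp
      have inj: "rho E' V' (B' - A') \<le> rho E V (B - A)"
      proof -
        \<comment> \<open>This undoes the contraction on edges: a new edge \<open>{u, w}\<close>
          returns to \<open>{v, w}\<close>.\<close>
        define g where "g e = (if e \<in> E then e else insert v (e - {u}))" for e
        have new: "\<exists>w. e = {u, w} \<and> w \<noteq> u \<and> {v, w} \<in> E" if "e \<in> E'" "e \<notin> E" for e
          using that by (auto simp: E'_def contr_def)
        have "inj_on g {e \<in> E'. e \<subseteq> V' \<and> e \<inter> (B' - A') \<noteq> {}}"
        proof (rule inj_onI)
          fix e f assume ef: "e \<in> {e \<in> E'. e \<subseteq> V' \<and> e \<inter> (B' - A') \<noteq> {}}"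
            "f \<in> {e \<in> E'. e \<subseteq> V' \<and> e \<inter> (B' - A') \<noteq> {}}" "g e = g f"
          have nv: "v \<notin> e" "v \<notin> f" using ef by (auto simp: V'_def)
          have gE: "v \<in> g h \<longleftrightarrow> h \<notin> E" if "v \<notin> h" for h using that by (simp add: g_def)
          show "e = f"
          proof (cases "e \<in> E")
            case True
            then have "f \<in> E" using gE[OF nv(1)] gE[OF nv(2)] ef(3) by simp
            then show ?thesis using True ef(3) by (simp add: g_def)
          next
            case False
            then have fE: "f \<notin> E" using gE[OF nv(1)] gE[OF nv(2)] ef(3) by simp
            obtain w where w: "e = {u, w}" "w \<noteq> u" using new[of e] False ef(1) by auto
            obtain w' where w': "f = {u, w'}" "w' \<noteq> u" using new[of f] fE ef(2) by auto
            have "g e = {v, w}" "g f = {v, w'}" using w w' False fE by (auto simp: g_def)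
            then have "w = w'" using ef(3) w(1) w'(1) nv by (auto simp: doubleton_eq_iff)
            then show ?thesis using w w' by simp
          qed
        qed
        moreover have "g ` {e \<in> E'. e \<subseteq> V' \<and> e \<inter> (B' - A') \<noteq> {}} \<subseteq> {e \<in> E. e \<subseteq> V \<and> e \<inter> (B - A) \<noteq> {}}"
        proof
          fix f assume "f \<in> g ` {e \<in> E'. e \<subseteq> V' \<and> e \<inter> (B' - A') \<noteq> {}}"
          then obtain e where e: "e \<in> E'" "e \<subseteq> V'" "e \<inter> (B' - A') \<noteq> {}" "f = g e" by blast
          show "f \<in> {e \<in> E. e \<subseteq> V \<and> e \<inter> (B - A) \<noteq> {}}"
          proof (cases "e \<in> E")
            case True then show ?thesis using e diff by (auto simp: g_def V'_def)
          next
            case False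
            then obtain w where w: "e = {u, w}" "w \<noteq> u" "{v, w} \<in> E" using new[of e] e(1) by auto
            then have "f = {v, w}" using e(4) False by (auto simp: g_def)
            moreover have "w \<in> B' - A'" using e(3) w(1) 3 by auto
            ultimately show ?thesis using w(3) diff Ve by auto
          qed
        qed
        ultimately show ?thesis
          unfolding rho_def using rho_fin[OF finV] by (rule card_inj_on_le)
      qed
      have mB: "massed c E B (A \<inter> B)"
      proof (rule sub_massed[OF finV _ sAB])
        show "card e = 2" if "e \<in> E" for e using two that by blast
        show "X \<subseteq> A" using s'(2) by (auto simp: A_def)
        show "c * card (B - A) < rho E V (B - A)" using inj s'(4) unfolding diff by simp
      qed (use ii ord in auto)
      \<comment> \<open>Hence \<open>B\<close> misses a vertex of \<open>X\<close>, and the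
        induction hypothesis applies to it.\<close>
      have "\<not> X \<subseteq> B'"
      proof
        assume "X \<subseteq> B'"
        then have "card X \<le> card (A' \<inter> B')" using s'(2) finAB by (intro card_mono) auto
        then show False using s'(3) by simp
      qed
      then have "B \<subset> V" using Ve XV v by (auto simp: B_def)
      then have "card B < card V" using finV by (rule psubset_card_mono[rotated])
      then have "linked M E B (A \<inter> B)" using IH[OF _ two mB] ord XN by simp
      moreover have "X \<subseteq> A" "B - A \<noteq> {}" using s'(2) ne diff by (auto simp: A_def)
      ultimately show False using rigid[OF sAB _ ord] by simp
    qed
  qed
qed

section \<open>Edge counts and the linking theorem for massed sets\<close>

lemma sepI:
  assumes "A \<union> B = V" "\<And>a b. a \<in> A \<Longrightarrow> a \<notin> B \<Longrightarrow> b \<in> B \<Longrightarrow> b \<notin> A \<Longrightarrow> {a, b} \<notin> E"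
  shows "sep E V A B"
  using assms unfolding sep_def by blast

text \<open>The edge \<open>{v, u}\<close> is lost, and one edge for each further neighbour
  \<open>w\<close> of \<open>v\<close> whose edge merges with \<open>{u, w}\<close> or ends up
  inside \<open>X\<close>. All others survive as distinct edges.\<close>

lemma contr_lost:
  assumes finV: "finite V" and two: "\<And>e. e \<in> E \<Longrightarrow> card e = 2" and v: "v \<in> V - X"
    and u: "u \<in> V" and vu: "{v, u} \<in> E"
  shows "rho E V (V - X) \<le> rho (contr E v u) (V - {v}) (V - {v} - X) + 1 +
    card {w \<in> V. {v, w} \<in> E \<and> w \<noteq> u \<and> ({u, w} \<in> E \<or> u \<in> X \<and> w \<in> X)}"
proof -
  define E' where "E' = contr E v u"
  have noloop: "a \<noteq> b" if "{a, b} \<in> E" for a b using two[OF that] by auto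
  define Nv where "Nv = {w \<in> V. {v, w} \<in> E}"
  define Bad where "Bad = {w \<in> V. {v, w} \<in> E \<and> w \<noteq> u \<and> ({u, w} \<in> E \<or> u \<in> X \<and> w \<in> X)}"
  define Good where "Good = {w \<in> Nv. w \<noteq> u \<and> {u, w} \<notin> E \<and> \<not> (u \<in> X \<and> w \<in> X)}"
  define R where "R = {e \<in> E. e \<subseteq> V - {v} \<and> e \<inter> (V - {v} - X) \<noteq> {}}"
  have finR: "finite R" unfolding R_def by (rule rho_fin) (use finV in simp)
  have finN: "finite Nv" using finV by (simp add: Nv_def)
  have "{e \<in> E. e \<subseteq> V \<and> e \<inter> (V - X) \<noteq> {}} \<subseteq> R \<union> (\<lambda>w. {v, w}) ` Nv"
  proof
    fix e assume "e \<in> {e \<in> E. e \<subseteq> V \<and> e \<inter> (V - X) \<noteq> {}}"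
    then have e: "e \<in> E" "e \<subseteq> V" "e \<inter> (V - X) \<noteq> {}" by auto
    show "e \<in> R \<union> (\<lambda>w. {v, w}) ` Nv"
    proof (cases "v \<in> e")
      case True
      then obtain w where "e = {v, w}" using edge_pair[OF two[OF e(1)]] by metis
      then show ?thesis using e by (auto simp: Nv_def)
    next
      case False
      then show ?thesis using e by (auto simp: R_def)
    qed
  qed
  then have "rho E V (V - X) \<le> card (R \<union> (\<lambda>w. {v, w}) ` Nv)"
    unfolding rho_def using finR finN by (intro card_mono) auto
  also have "\<dots> \<le> card R + card Nv"
    using card_Un_le[of R "(\<lambda>w. {v, w}) ` Nv"] card_image_le[OF finN, of "\<lambda>w. {v, w}"] by linarith
  also have "Nv \<subseteq> insert u (Good \<union> Bad)" by (auto simp: Nv_def Good_def Bad_def)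
  then have "card Nv \<le> card (insert u (Good \<union> Bad))"
    using finV by (intro card_mono) (auto simp: Good_def Bad_def Nv_def)
  also have "\<dots> \<le> Suc (card (Good \<union> Bad))" by (rule card_insert_le_m1) simp_all
  also have "card (Good \<union> Bad) \<le> card Good + card Bad" by (rule card_Un_le)
  finally have 1: "rho E V (V - X) \<le> card R + card Good + card Bad + 1" by simp
  have finG: "finite Good" using finN by (simp add: Good_def)
  have "card R + card Good = card (R \<union> (\<lambda>w. {u, w}) ` Good)"
  proof -
    have "inj_on (\<lambda>w. {u, w}) Good" by (auto simp: inj_on_def doubleton_eq_iff)
    moreover have "R \<inter> (\<lambda>w. {u, w}) ` Good = {}" by (auto simp: R_def Good_def)
    ultimately show ?thesis using finR finG by (simp add: card_Un_disjoint card_image)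
  qed
  also have "\<dots> \<le> rho E' (V - {v}) (V - {v} - X)"
    unfolding rho_def
  proof (intro card_mono rho_fin subsetI)
    fix e assume "e \<in> R \<union> (\<lambda>w. {u, w}) ` Good"
    then show "e \<in> {e \<in> E'. e \<subseteq> V - {v} \<and> e \<inter> (V - {v} - X) \<noteq> {}}"
    proof
      assume e: "e \<in> R"
      then have "e \<in> E'" unfolding E'_def by (intro contr_keep) (auto simp: R_def)
      then show ?thesis using e by (auto simp: R_def)
    next
      assume "e \<in> (\<lambda>w. {u, w}) ` Good"
      then obtain w where w: "e = {u, w}" "w \<in> V" "{v, w} \<in> E" "w \<noteq> u" "\<not> (u \<in> X \<and> w \<in> X)"
        by (auto simp: Good_def Nv_def)
      have "e \<in> E'" unfolding E'_def w(1) by (rule contr_new[OF w(3,4)])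
      then show ?thesis using w u noloop[OF w(3)] noloop[OF vu] by auto
    qed
  qed (use finV in simp)
  finally show ?thesis using 1 by (simp add: E'_def Bad_def)
qed

text \<open>Both sides count the ordered pairs whose underlying edge meets \<open>V - X\<close>.\<close>

lemma degree_sum:
  assumes finV: "finite V" and XV: "X \<subseteq> V" and two: "\<And>e. e \<in> E \<Longrightarrow> card e = 2"
  shows "(\<Sum>v\<in>V - X. card {w \<in> V. {v, w} \<in> E}) + (\<Sum>v\<in>V - X. card {w \<in> X. {v, w} \<in> E}) = 2 * rho E V (V - X)"
proof -
  define A1 where "A1 = Sigma (V - X) (\<lambda>v. {w \<in> V. {v, w} \<in> E})"
  define A2 where "A2 = Sigma (V - X) (\<lambda>v. {w \<in> X. {v, w} \<in> E})"
  define R where "R = {e \<in> E. e \<subseteq> V \<and> e \<inter> (V - X) \<noteq> {}}"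
  have finX: "finite X" using XV finV finite_subset by blast
  have fin: "finite A1" "finite A2" using finV finX by (auto simp: A1_def A2_def)
  have finR: "finite R" unfolding R_def by (rule rho_fin[OF finV])
  define D where "D e = {p. {fst p, snd p} = e}" for e :: "'a set"
  have D2: "finite (D e)" "card (D e) = 2" if "e \<in> R" for e
  proof -
    have "card e = 2" using that two[of e] by (simp add: R_def)
    then obtain a b where ab: "e = {a, b}" "a \<noteq> b" by (auto simp: card_2_iff)
    have "D e = {(a, b), (b, a)}" unfolding D_def ab by (auto simp: doubleton_eq_iff)
    then show "finite (D e)" "card (D e) = 2" using ab(2) by auto
  qed
  have eq: "A1 \<union> prod.swap ` A2 = (\<Union>e\<in>R. D e)"
  proof (rule set_eqI)
    fix p :: "'a \<times> 'a"
    obtain a b where ab: "p = (a, b)" by (cases p)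
    have "p \<in> A1 \<union> prod.swap ` A2 \<longleftrightarrow> {a, b} \<in> E \<and> a \<in> V \<and> b \<in> V \<and> (a \<notin> X \<or> b \<notin> X)"
      using XV unfolding ab by (auto simp: A1_def A2_def insert_commute[of a b])
    also have "\<dots> \<longleftrightarrow> {a, b} \<in> R" by (auto simp: R_def)
    also have "\<dots> \<longleftrightarrow> p \<in> (\<Union>e\<in>R. D e)" by (auto simp: D_def ab)
    finally show "p \<in> A1 \<union> prod.swap ` A2 \<longleftrightarrow> p \<in> (\<Union>e\<in>R. D e)" .
  qed
  have "card A1 + card A2 = card A1 + card (prod.swap ` A2)" by (simp add: card_image)
  also have "\<dots> = card (A1 \<union> prod.swap ` A2)"
    using fin by (intro card_Un_disjoint[symmetric]) (auto simp: A1_def A2_def)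
  also have "\<dots> = (\<Sum>e\<in>R. card (D e))"
    unfolding eq using finR D2(1) by (intro card_UN_disjoint) (auto simp: D_def)
  also have "\<dots> = 2 * card R" using D2(2) by simp
  finally show ?thesis
    using finV finX by (simp add: A1_def A2_def rho_def R_def)
qed

lemma linked_trivial:
  assumes "X \<subseteq> V" "finite X" "card X \<le> 1" shows "linked M E V X"
  unfolding linked_def
proof (intro allI impI)
  fix \<P> assume p: "parts M X \<P>"
  have "linkage E V \<P> (\<lambda>P. P)" unfolding linkage_def
  proof (intro conjI ballI impI)
    fix P assume P: "P \<in> \<P>"
    then have PX: "P \<subseteq> X" "P \<noteq> {}" using p by (auto simp: parts_def)
    then have "card P \<le> 1" "finite P" using assms card_mono[of X P] finite_subset by auto
    then have "card P = 1" using PX(2) by (simp add: le_Suc_eq)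
    then obtain x where "P = {x}" by (rule card_1_singletonE)
    then show "conn E P" by simp
    show "P \<subseteq> P" "P \<subseteq> V" using PX assms(1) by auto
    fix P' assume "P' \<in> \<P>" "P \<noteq> P'"
    then show "P \<inter> P' = {}" using parts_disjoint[OF p P] by blast
  qed
  then show "\<exists>C. linkage E V \<P> C" by (intro exI[of _ "\<lambda>P. P"])
qed

text \<open>In a smallest counterexample a contraction loses at least
  \<open>\<delta> = c + y\<close> edges, where \<open>y\<close> is the excess over
  \<open>c * n\<close>; by \<open>contr_lost\<close> closed neighbourhoods have large degrees
  inside, while an edge count makes the smallest one have fewer than \<open>2 * \<delta>\<close>
  vertices. A linked set \<open>L\<close> in it and a minimal separation between \<open>X\<close>
  and \<open>L\<close> contradict \<open>no_rigid\<close>.\<close>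

lemma massed_linked:
  fixes V :: "'a set"
  assumes "\<forall>e\<in>E. card e = 2" "massed c E V X" "card X \<le> N"
    and N: "3 \<le> N" and Q1: "5 * (N + M) \<le> 2 * c + 20" and Q2: "3 * N \<le> c" and Q3: "2 * (N + M) + 1 \<le> c"
  shows "linked M E V X"
  using assms(1-3)
proof (induction "card V" arbitrary: E V X rule: less_induct)
  case less
  note two = less.prems(1) and m = less.prems(2) and XN = less.prems(3)
  have IH: "linked M E' V' X'"
    if "card V' < card V" "\<forall>e\<in>E'. card e = 2" "massed c E' V' X'" "card X' \<le> N" for E' and V' X' :: "'a set"
    using less.hyps that by blast
  have two': "card e = 2" if "e \<in> E" for e using two that by blast
  have noloop: "a \<noteq> b" if "{a, b} \<in> E" for a b using two'[OF that] by auto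
  have finV: "finite V" and XV: "X \<subseteq> V" and i: "c * card (V - X) < rho E V (V - X)"
    using m by (auto simp: massed_def)
  have finX: "finite X" using XV finV finite_subset by blast
  show ?case
  proof (rule ccontr)
    assume not: "\<not> linked M E V X"
    have X2: "2 \<le> card X"
    proof (rule ccontr)
      assume "\<not> ?thesis"
      then show False using linked_trivial[OF XV finX] not by simp
    qed
    have rigid: False
      if "sep E V A B" "X \<subseteq> A" "card (A \<inter> B) \<le> card X" "B - A \<noteq> {}" "linked M E B (A \<inter> B)" for A B
      by (rule no_rigid[OF _ m two XN not that]) (rule IH)
    define n where "n = card (V - X)"
    obtain y where y: "rho E V (V - X) = c * n + y" "1 \<le> y"
      using i unfolding n_def by (metis add.commute less_iff_Suc_add Suc_eq_plus1 add_Suc_right le_add2)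
    define \<delta> where "\<delta> = c + y"
    have "V - X \<noteq> {}"
    proof
      assume "V - X = {}"
      then show False using i by (simp only: rho_def) simp
    qed
    then have n1: "1 \<le> n" using finV by (simp add: n_def Suc_le_eq card_gt_0_iff)
    \<comment> \<open>After the contraction at most \<open>c * (n - 1)\<close> of the
      \<open>c * n + y\<close> edges are left.\<close>
    have lost: "\<delta> \<le> 1 + card {w \<in> V. {v, w} \<in> E \<and> w \<noteq> u \<and> ({u, w} \<in> E \<or> u \<in> X \<and> w \<in> X)}"
      if v: "v \<in> V - X" and u: "u \<in> V" and vu: "{v, u} \<in> E" for v u
    proof -
      have "rho (contr E v u) (V - {v}) (V - {v} - X) \<le> c * card (V - {v} - X)"
        by (rule contr_sparse[OF _ m two XN not v u vu]) (rule IH)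
      moreover have "V - {v} - X = V - X - {v}" by blast
      then have "card (V - {v} - X) = n - 1" using v finV by (simp add: n_def)
      moreover have "c * n = c * (n - 1) + c" using n1 by (metis Suc_diff_1 add.commute less_eq_Suc_le mult_Suc_right One_nat_def)
      ultimately show ?thesis
        using contr_lost[OF finV two' v u vu] y(1) unfolding \<delta>_def by simp
    qed
    \<comment> \<open>An isolated vertex would be the far side of a separation of order 0, whose
      empty separator is trivially linked.\<close>
    have nbr: "\<exists>u\<in>V. {v, u} \<in> E" if v: "v \<in> V - X" for v
    proof (rule ccontr)
      assume a: "\<not> ?thesis"
      have "linked M E {v} ((V - {v}) \<inter> {v})" by (rule linked_trivial) auto
      moreover have na: "{x, v} \<notin> E" if "x \<in> V" for x using a that insert_commute[of x v "{}"] by auto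
      have "sep E V (V - {v}) {v}"
      proof (rule sepI)
        show "{x, b} \<notin> E" if "x \<in> V - {v}" "b \<in> {v}" for x b using na[of x] that by simp
      qed (use v in blast)
      moreover have "X \<subseteq> V - {v}" "{v} - (V - {v}) \<noteq> {}" "(V - {v}) \<inter> {v} = {}" using v XV by auto
      ultimately show False using rigid[of "V - {v}" "{v}"] by simp
    qed
    obtain v0 where v0: "v0 \<in> V - X"
      and dmin: "\<And>v. v \<in> V - X \<Longrightarrow> card {w \<in> V. {v0, w} \<in> E} \<le> card {w \<in> V. {v, w} \<in> E}"
      using ex_has_least_nat[of "\<lambda>v. v \<in> V - X" _ "\<lambda>v. card {w \<in> V. {v, w} \<in> E}"] \<open>V - X \<noteq> {}\<close> by blast
    define d where "d = card {w \<in> V. {v0, w} \<in> E}"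
    \<comment> \<open>Otherwise \<open>X - {x}\<close> alone separates \<open>X\<close> from the
      dense part, with order below \<open>card X\<close>.\<close>
    have "\<exists>v\<in>V - X. {v, x} \<in> E" if x: "x \<in> X" for x
    proof (rule ccontr)
      assume a: "\<not> ?thesis"
      have na: "{x, b} \<notin> E" if "b \<in> V - X" for b using a that insert_commute[of x b "{}"] by auto
      have "sep E V X (V - {x})"
      proof (rule sepI)
        show "{z, b} \<notin> E" if "z \<in> X" "z \<notin> V - {x}" "b \<in> V - {x}" "b \<notin> X" for z b
          using na[of b] that XV by auto
      qed (use x XV in blast)
      moreover have "X \<inter> (V - {x}) = X - {x}" using XV by blast
      then have "card (X \<inter> (V - {x})) < card X" using card_Diff1_less[OF finX x] by simp
      ultimately have "rho E V (V - {x} - X) \<le> c * card (V - {x} - X)"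
        using m by (simp add: massed_def)
      moreover have "V - {x} - X = V - X" using x by blast
      ultimately show False using i by simp
    qed
    then obtain g where g: "\<And>x. x \<in> X \<Longrightarrow> g x \<in> V - X \<and> {g x, x} \<in> E" by metis
    have "card X = card ((\<lambda>x. (g x, x)) ` X)" by (simp add: card_image inj_on_def)
    also have "\<dots> \<le> card (Sigma (V - X) (\<lambda>v. {w \<in> X. {v, w} \<in> E}))"
      using finV finX g by (intro card_mono) auto
    also have "\<dots> = (\<Sum>v\<in>V - X. card {w \<in> X. {v, w} \<in> E})" using finV finX by simp
    finally have "card X \<le> (\<Sum>v\<in>V - X. card {w \<in> X. {v, w} \<in> E})" .
    moreover have "(\<Sum>v\<in>V - X. d) \<le> (\<Sum>v\<in>V - X. card {w \<in> V. {v, w} \<in> E})"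
      unfolding d_def by (intro sum_mono dmin)
    moreover have "(\<Sum>v\<in>V - X. card {w \<in> V. {v, w} \<in> E}) +
        (\<Sum>v\<in>V - X. card {w \<in> X. {v, w} \<in> E}) = 2 * rho E V (V - X)"
      by (rule degree_sum[OF finV XV two'])
    ultimately have dsum: "n * d + card X \<le> 2 * (c * n + y)"
      using y(1) by (simp add: n_def)
    \<comment> \<open>Edges between \<open>X\<close> and the rest are counted on the rest's side
      only, so the degree sum leaves a slack of at least \<open>card X\<close>. Up to three units of
      it are needed for \<open>hh\<close>.\<close>
    have dle: "d + t \<le> 2 * \<delta>" if t: "t \<le> card X" "t \<le> 3" for t
    proof (rule ccontr)
      assume a: "\<not> ?thesis"
      define z where "z = 2 * y + 1 - t"
      have z: "z + t = 2 * y + 1" using t(2) y(2) by (simp add: z_def)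
      then have "2 * c + z \<le> d" using a by (simp add: \<delta>_def)
      then have "n * (2 * c + z) \<le> n * d" by (rule mult_le_mono2)
      then have "n * z + t \<le> 2 * y" using dsum t(1) by (simp add: algebra_simps)
      moreover have "1 * z \<le> n * z" using n1 by (rule mult_le_mono1)
      ultimately show False using z by simp
    qed
    define H where "H = insert v0 {w \<in> V. {v0, w} \<in> E}"
    \<comment> \<open>For terminals in \<open>H\<close> only the neighbours in \<open>H - Y\<close>
      are controlled, because edges inside \<open>X\<close> do not enter the density.\<close>
    define Y where "Y = X \<inter> H"
    have finH: "finite H" using finV by (simp add: H_def)
    have cH: "card H = Suc d" unfolding H_def d_def using finV noloop[of v0 v0] by (intro card_insert_disjoint) auto
    have HV: "H \<subseteq> V" using v0 by (auto simp: H_def)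
    have v0Y: "v0 \<in> H - Y" using v0 by (auto simp: H_def Y_def)
    have "\<exists>L\<subseteq>H. card X < card L \<and> (\<forall>Z. Y \<inter> L \<subseteq> Z \<longrightarrow> Z \<subseteq> L \<longrightarrow> card Z \<le> card X \<longrightarrow> linked M E L Z)"
    proof (rule dense_contains_linked[OF finH])
      show "card e = 2" if "e \<in> E" for e using that by (rule two')
      show "Y \<subseteq> H" by (simp add: Y_def)
      show "H \<noteq> {}" by (simp add: H_def)
      show "\<delta> \<le> card {w \<in> H. {v, w} \<in> E}" if v: "v \<in> H - Y" for v
      proof (cases "v = v0")
        case True
        obtain u where u: "u \<in> V" "{v0, u} \<in> E" using nbr[OF v0] by blast
        define B where "B = {w \<in> V. {v0, w} \<in> E \<and> w \<noteq> u \<and> ({u, w} \<in> E \<or> u \<in> X \<and> w \<in> X)}"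
        have "Suc (card B) = card (insert u B)" using finV by (simp add: B_def)
        also have "\<dots> \<le> card {w \<in> H. {v, w} \<in> E}"
          using u finH True by (intro card_mono) (auto simp: B_def H_def)
        finally show ?thesis using lost[OF v0 u] by (simp add: B_def)
      next
        case False
        then have u: "v \<in> V" "{v0, v} \<in> E" "v \<notin> X" using v by (auto simp: H_def Y_def)
        define B where "B = {w \<in> V. {v0, w} \<in> E \<and> w \<noteq> v \<and> ({v, w} \<in> E \<or> v \<in> X \<and> w \<in> X)}"
        have "v0 \<notin> B" using noloop[of v0 v0] by (auto simp: B_def)
        then have "Suc (card B) = card (insert v0 B)" using finV by (simp add: B_def)
        also have "\<dots> \<le> card {w \<in> H. {v, w} \<in> E}"
          using u finH by (intro card_mono) (auto simp: B_def H_def insert_commute)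
        finally show ?thesis using lost[OF v0 u(1,2)] by (simp add: B_def)
      qed
      show "\<delta> + 1 \<le> card {w \<in> H - Y. {v, w} \<in> E} + card Y" if v: "v \<in> Y" for v
      proof -
        have u: "v \<in> V" "{v0, v} \<in> E" "v \<in> X" using v v0 by (auto simp: H_def Y_def)
        define B where "B = {w \<in> V. {v0, w} \<in> E \<and> w \<noteq> v \<and> ({v, w} \<in> E \<or> v \<in> X \<and> w \<in> X)}"
        define T where "T = {w \<in> H - Y. {v, w} \<in> E}"
        have finY: "finite Y" using finH by (simp add: Y_def)
        have finT: "finite T" using finH by (simp add: T_def)
        have v0T: "v0 \<in> T" using u v0Y by (auto simp: T_def insert_commute)
        \<comment> \<open>Every other terminal in \<open>H\<close> counts as lost, adjacent to
          \<open>v\<close> or not; hence \<open>card Y\<close> in the degree condition.\<close>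
        have "B \<subseteq> (T - {v0}) \<union> (Y - {v})"
          using noloop[of v0 v0] by (auto simp: B_def T_def H_def Y_def)
        then have "card B \<le> card ((T - {v0}) \<union> (Y - {v}))" using finY finT by (intro card_mono) auto
        also have "\<dots> \<le> card (T - {v0}) + card (Y - {v})" by (rule card_Un_le)
        also have "\<dots> = (card T - 1) + (card Y - 1)" using v0T v by simp
        finally have "card B \<le> (card T - 1) + (card Y - 1)" .
        moreover have "card T > 0" "card Y > 0" using v0T v finT finY by (auto simp: card_gt_0_iff)
        ultimately show ?thesis using lost[OF v0 u(1,2)] by (simp add: B_def T_def)
      qed
      have d\<delta>: "c + 1 \<le> \<delta>" using y by (simp add: \<delta>_def)
      \<comment> \<open>With two terminals the bound on \<open>card H\<close> is weaker by one, but
        then \<open>3 \<le> N\<close> leaves a unit for \<open>card X\<close>.\<close>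
      have hh: "card X + 1 \<le> N \<and> card H + 1 \<le> 2 * \<delta> \<or> card X \<le> N \<and> card H + 2 \<le> 2 * \<delta>"
      proof (cases "3 \<le> card X")
        case True
        then show ?thesis using dle[of 3] cH XN by simp
      next
        case False
        then show ?thesis using dle[of 2] X2 cH N by simp
      qed
      show "5 * (card X + M) + card H \<le> 4 * \<delta> + 16" using hh Q1 d\<delta> by auto
      show "3 * card X + 1 \<le> \<delta>" using XN Q2 d\<delta> by simp
      show "card H + 2 * (card X + M) + 4 \<le> 3 * \<delta>" using hh Q3 d\<delta> by auto
      show "2 * (card X + M) + 2 \<le> \<delta>" using XN Q3 d\<delta> by simp
    qed
    then obtain L where L: "L \<subseteq> H" "card X < card L"
      and lkL: "\<And>Z. Y \<inter> L \<subseteq> Z \<Longrightarrow> Z \<subseteq> L \<Longrightarrow> card Z \<le> card X \<Longrightarrow> linked M E L Z" by blast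
    have LV: "L \<subseteq> V" using L HV by blast
    obtain A B where s: "sep E V A B" "X \<subseteq> A" "L \<subseteq> B"
      and min: "\<And>A' B'. sep E V A' B' \<Longrightarrow> X \<subseteq> A' \<Longrightarrow> L \<subseteq> B' \<Longrightarrow> card (A \<inter> B) \<le> card (A' \<inter> B')"
      using ex_min_sep[OF XV LV] by blast
    obtain Q f where Q: "\<And>z. z \<in> A \<inter> B \<Longrightarrow> Q z \<subseteq> B \<and> conn E (Q z) \<and> z \<in> Q z \<and> Q z \<inter> L = {f z}"
      and dQ: "\<And>z z'. z \<in> A \<inter> B \<Longrightarrow> z' \<in> A \<inter> B \<Longrightarrow> z \<noteq> z' \<Longrightarrow> Q z \<inter> Q z' = {}"
      using min_sep_paths[OF finV two' s min, of thesis] by blast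
    have V: "V = A \<union> B" using s(1) by (auto simp: sep_def)
    have finAB: "finite (A \<inter> B)" using V finV by simp
    have "sep E V X V" using XV by (auto simp: sep_def)
    then have ord: "card (A \<inter> B) \<le> card X" using min[of X V] LV XV by (simp add: Int_absorb2)
    have "linked M E B (A \<inter> B)"
    proof (rule linked_via_paths[OF _ finAB s(3) Q dQ])
      show "linked M E L (f ` (A \<inter> B))"
      proof (rule lkL)
        \<comment> \<open>A terminal in \<open>L\<close> lies in \<open>A \<inter> B\<close> and is
          the end of its own path. So \<open>L\<close> has to link only sets containing
          \<open>Y \<inter> L\<close>.\<close>
        show "Y \<inter> L \<subseteq> f ` (A \<inter> B)"
        proof
          fix z assume z: "z \<in> Y \<inter> L"
          then have zAB: "z \<in> A \<inter> B" using s by (auto simp: Y_def)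
          have e: "Q z \<inter> L = {f z}" and "z \<in> Q z" using Q[OF zAB] by simp_all
          then have "z \<in> Q z \<inter> L" using z by blast
          then have "f z = z" unfolding e by simp
          then show "z \<in> f ` (A \<inter> B)" using zAB by (metis imageI)
        qed
        show "f ` (A \<inter> B) \<subseteq> L"
        proof (rule image_subsetI)
          show "f z \<in> L" if "z \<in> A \<inter> B" for z
          proof -
            have "f z \<in> Q z \<inter> L" using Q[OF that] by simp
            then show ?thesis by simp
          qed
        qed
        show "card (f ` (A \<inter> B)) \<le> card X" using card_image_le[OF finAB, of f] ord by simp
      qed
    qed
    moreover have "B - A \<noteq> {}"
    proof
      assume "B - A = {}"
      then have "L \<subseteq> A \<inter> B" using s(3) by blast
      then have "card L \<le> card (A \<inter> B)" using finAB by (intro card_mono)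
      then show False using ord L(2) by simp
    qed
    ultimately show False using rigid[OF s(1,2) ord] by blast
  qed
qed

section \<open>Steiner trees in multigraphs\<close>

lemma conn_remove_leaf:
  assumes c: "conn E C" and w: "w \<in> C" "w \<noteq> v"
    and leaf: "\<And>x. x \<in> C \<Longrightarrow> x \<noteq> v \<Longrightarrow> {v, x} \<in> E \<Longrightarrow> x = w"
  shows "conn E (C - {v})"
proof (rule connI[of w])
  show "w \<in> C - {v}" using w by simp
  fix W assume W: "W \<subseteq> C - {v}" "w \<in> W" "W \<noteq> C - {v}"
  then obtain y where y: "y \<in> C" "y \<noteq> v" "y \<notin> W" by blast
  obtain a b where ab: "a \<in> C" "a \<in> insert v W" "b \<in> C" "b \<notin> insert v W" "{a, b} \<in> E"
    using conn_cut[OF c, of w "insert v W" y] w W y by blast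
  have "a \<noteq> v"
  proof
    assume "a = v"
    then have "b = w" using leaf[of b] ab by simp
    then show False using ab(4) W(2) by simp
  qed
  then show "\<exists>a\<in>W. \<exists>b\<in>C - {v} - W. {a, b} \<in> E" using ab by blast
qed

text \<open>In a smallest connected subset containing \<open>a\<close> and \<open>b\<close>, pruning
  shows that each of them has a single neighbour. Both can be removed, and these neighbours remain
  because \<open>a\<close> and \<open>b\<close> are not adjacent.\<close>

lemma conn_between:
  assumes c: "conn E C" and fin: "finite C" and ab: "a \<in> C" "b \<in> C" "a \<noteq> b" "{a, b} \<notin> E"
  shows "\<exists>P\<subseteq>C - {a, b}. conn E P \<and> (\<exists>x\<in>P. {a, x} \<in> E) \<and> (\<exists>x\<in>P. {b, x} \<in> E)"
proof -
  define ok where "ok U \<longleftrightarrow> U \<subseteq> C \<and> conn E U \<and> a \<in> U \<and> b \<in> U" for U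
  obtain U where U: "ok U" and min: "\<And>U'. ok U' \<Longrightarrow> card U \<le> card U'"
    using ex_has_least_nat[of ok C card] c ab by (auto simp: ok_def)
  have cU: "conn E U" and UC: "U \<subseteq> C" and abU: "a \<in> U" "b \<in> U" using U by (auto simp: ok_def)
  have finU: "finite U" using UC fin finite_subset by blast
  have uniq: "\<exists>x\<in>U. x \<noteq> v \<and> {v, x} \<in> E \<and> (\<forall>z\<in>U. z \<noteq> v \<longrightarrow> {v, z} \<in> E \<longrightarrow> z = x)"
    if v: "v = a \<and> v' = b \<or> v = b \<and> v' = a" for v v'
  proof -
    have vU: "v \<in> U" "v' \<in> U" "v \<noteq> v'" using v abU ab(3) by auto
    define Nv where "Nv = {w \<in> U - {v}. {v, w} \<in> E}"
    obtain U' where U': "U' \<subseteq> U" "conn E U'" "v \<in> U'" "{v'} \<subseteq> U'" "card U' + card Nv \<le> card U + card {v'}"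
      using conn_prune[OF cU finU vU(1), of "{v'}"] vU unfolding Nv_def by auto
    have "ok U'" using U' UC v by (auto simp: ok_def)
    then have "card Nv \<le> 1" using min[of U'] U'(5) by simp
    moreover obtain a' b' where "a' \<in> U" "a' \<in> {v}" "b' \<in> U" "b' \<notin> {v}" "{a', b'} \<in> E"
      using conn_cut[OF cU, of v "{v}" v'] vU by blast
    then have "b' \<in> Nv" by (simp add: Nv_def)
    moreover have "finite Nv" using finU by (simp add: Nv_def)
    ultimately have "card Nv = 1" by (metis One_nat_def Suc_leI card_gt_0_iff empty_iff le_antisym)
    then obtain x where "Nv = {x}" by (rule card_1_singletonE)
    then show ?thesis unfolding Nv_def by blast
  qed
  obtain x where x: "x \<in> U" "x \<noteq> a" "{a, x} \<in> E" "\<And>z. z \<in> U \<Longrightarrow> z \<noteq> a \<Longrightarrow> {a, z} \<in> E \<Longrightarrow> z = x"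
    using uniq[of a b] by blast
  obtain y where y: "y \<in> U" "y \<noteq> b" "{b, y} \<in> E" "\<And>z. z \<in> U \<Longrightarrow> z \<noteq> b \<Longrightarrow> {b, z} \<in> E \<Longrightarrow> z = y"
    using uniq[of b a] by blast
  have "conn E (U - {a})" by (rule conn_remove_leaf[OF cU x(1,2)]) (rule x(4))
  have ne: "x \<noteq> b" "y \<noteq> a" using x(3) y(3) ab(4) by (auto simp: insert_commute)
  have "conn E (U - {a} - {b})"
  proof (rule conn_remove_leaf[OF \<open>conn E (U - {a})\<close>])
    show "y \<in> U - {a}" "y \<noteq> b" using y(1,2) ne by auto
    show "z = y" if "z \<in> U - {a}" "z \<noteq> b" "{b, z} \<in> E" for z using y(4)[of z] that by simp
  qed
  moreover have "U - {a} - {b} = U - {a, b}" by blast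
  ultimately have "conn E (U - {a, b})" by simp
  moreover have "x \<in> U - {a, b}" "y \<in> U - {a, b}" using x(1,2) y(1,2) ne by simp_all
  moreover have "U - {a, b} \<subseteq> C - {a, b}" using UC by blast
  ultimately show ?thesis using x(3) y(3) by (intro exI[of _ "U - {a, b}"] conjI bexI)
qed

text \<open>Each \<open>F i\<close> is at least as large as the whole index set, so a greedy choice
  never runs out.\<close>

lemma distinct_representatives:
  assumes "finite I" "\<And>i. i \<in> I \<Longrightarrow> finite (F i) \<and> card I \<le> card (F i)"
  shows "\<exists>f. inj_on f I \<and> (\<forall>i\<in>I. f i \<in> F i)"
proof -
  have "\<exists>f. inj_on f J \<and> (\<forall>i\<in>J. f i \<in> F i)" if "finite J" "J \<subseteq> I" for J
    using that
  proof (induction J rule: finite_induct)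
    case (insert j J)
    then obtain f where f: "inj_on f J" "\<forall>i\<in>J. f i \<in> F i" by auto
    have "card (f ` J) \<le> card J" using insert.hyps(1) by (rule card_image_le)
    also have "card J < card (insert j J)" using insert.hyps by simp
    also have "\<dots> \<le> card I" using insert.prems assms(1) by (intro card_mono)
    also have "\<dots> \<le> card (F j)" using assms(2) insert.prems by simp
    finally have "\<not> F j \<subseteq> f ` J" using insert.hyps(1) by (meson card_mono finite_imageI leD)
    then obtain y where y: "y \<in> F j" "y \<notin> f ` J" by blast
    have "inj_on (f(j := y)) (insert j J)" using f(1) y(2) insert.hyps(2) by (auto simp: inj_on_def)
    moreover have "\<forall>i\<in>insert j J. (f(j := y)) i \<in> F i" using f(2) y(1) by auto
    ultimately show ?case by blast
  qed simp
  then show ?thesis using assms(1) by blast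
qed

section \<open>Paths, trees and connectivity in multigraphs\<close>

lemma path_cut:
  assumes p: "is_path G u xs es v" and W: "u \<in> W" "v \<notin> W"
  shows "\<exists>i < length es. xs ! i \<in> W \<and> xs ! Suc i \<notin> W"
proof (rule ccontr)
  assume a: "\<not> ?thesis"
  have len: "length xs = Suc (length es)" and hd: "hd xs = u" and last: "last xs = v"
    using p by (auto simp: is_path_def)
  have ne: "xs \<noteq> []" using len by auto
  have "xs ! i \<in> W" if "i \<le> length es" for i
    using that
  proof (induction i)
    case 0 then show ?case using hd W(1) ne by (simp add: hd_conv_nth)
  next
    case (Suc i) then show ?case using a by auto
  qed
  then have "xs ! length es \<in> W" by simp
  then show False using last W(2) len ne by (simp add: last_conv_nth)
qed

lemma path_edge:
  assumes "is_path G u xs es v" "i < length es"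
  shows "es ! i \<in> edges G" "ends G (es ! i) = {xs ! i, xs ! Suc i}" "xs ! i \<in> verts G" "xs ! Suc i \<in> verts G"
proof -
  have "set xs \<subseteq> verts G" "set es \<subseteq> edges G" "length xs = Suc (length es)"
    using assms(1) by (auto simp: is_path_def)
  moreover have "xs ! i \<in> set xs" "xs ! Suc i \<in> set xs" "es ! i \<in> set es"
    using assms(2) \<open>length xs = Suc (length es)\<close> by (auto intro: nth_mem)
  ultimately show "es ! i \<in> edges G" "xs ! i \<in> verts G" "xs ! Suc i \<in> verts G" by auto
  show "ends G (es ! i) = {xs ! i, xs ! Suc i}" using assms by (simp add: is_path_def)
qed

lemma path_prefix:
  assumes p: "is_path G u xs es v" and x: "x \<in> set xs"
  shows "\<exists>xs' es'. is_path G u xs' es' x"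
proof -
  obtain i where i: "i < length xs" "xs ! i = x" using x by (auto simp: in_set_conv_nth)
  have len: "length xs = Suc (length es)" using p by (simp add: is_path_def)
  have "is_path G u (take (Suc i) xs) (take i es) x"
    unfolding is_path_def
  proof (intro conjI allI impI)
    show "length (take (Suc i) xs) = Suc (length (take i es))" using i len by simp
    have "xs \<noteq> []" using len by auto
    then show "hd (take (Suc i) xs) = u" using p by (simp add: is_path_def hd_take)
    show "last (take (Suc i) xs) = x" using i by (simp add: take_Suc_conv_app_nth)
    show "distinct (take (Suc i) xs)" using p by (simp add: is_path_def)
    show "set (take (Suc i) xs) \<subseteq> verts G" using p set_take_subset[of "Suc i" xs] by (auto simp: is_path_def)
    show "set (take i es) \<subseteq> edges G" using p set_take_subset[of i es] by (auto simp: is_path_def)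
    fix j assume "j < length (take i es)"
    then show "ends G (take i es ! j) = {take (Suc i) xs ! j, take (Suc i) xs ! Suc j}"
      using p by (simp add: is_path_def)
  qed
  then show ?thesis by blast
qed

lemma path_extend:
  assumes p: "is_path G u xs es v" and e: "e \<in> edges G" "ends G e = {v, w}" "w \<in> verts G" "w \<notin> set xs"
  shows "is_path G u (xs @ [w]) (es @ [e]) w"
proof -
  have len: "length xs = Suc (length es)" using p by (simp add: is_path_def)
  have ne: "xs \<noteq> []" using len by auto
  have last: "xs ! length es = v" using p len ne by (simp add: is_path_def last_conv_nth)
  show ?thesis unfolding is_path_def
  proof (intro conjI allI impI)
    show "hd (xs @ [w]) = u" using p ne by (simp add: is_path_def)
    fix i assume "i < length (es @ [e])"
    then consider "i < length es" | "i = length es" by fastforce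
    then show "ends G ((es @ [e]) ! i) = {(xs @ [w]) ! i, (xs @ [w]) ! Suc i}"
    proof cases
      case 1 then show ?thesis using p len by (simp add: is_path_def nth_append)
    next
      case 2 then show ?thesis using e(2) last len by (simp add: nth_append)
    qed
  qed (use p e len in \<open>auto simp: is_path_def\<close>)
qed

text \<open>The bridge from cuts to paths: a path between the sides of a cut crosses it, and no edge
  leaves the set of vertices reachable by paths.\<close>

lemma connected_mgraph_iff:
  "connected_mgraph H \<longleftrightarrow> conn (ends H ` edges H) (verts H)"
proof
  assume c: "connected_mgraph H"
  then obtain u where u: "u \<in> verts H" by (auto simp: connected_mgraph_def)
  show "conn (ends H ` edges H) (verts H)"
  proof (rule connI[OF u])
    fix W assume W: "W \<subseteq> verts H" "u \<in> W" "W \<noteq> verts H"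
    then obtain v where v: "v \<in> verts H" "v \<notin> W" by blast
    have "\<exists>xs es. is_path H u xs es v" using c u v(1) unfolding connected_mgraph_def by blast
    then obtain xs es where p: "is_path H u xs es v" by blast
    obtain i where i: "i < length es" "xs ! i \<in> W" "xs ! Suc i \<notin> W" using path_cut[OF p W(2) v(2)] by blast
    note e = path_edge[OF p i(1)]
    have "{xs ! i, xs ! Suc i} \<in> ends H ` edges H" using e(1,2) by (metis imageI)
    then show "\<exists>a\<in>W. \<exists>b\<in>verts H - W. {a, b} \<in> ends H ` edges H" using i e by blast
  qed
next
  assume c: "conn (ends H ` edges H) (verts H)"
  show "connected_mgraph H"
    unfolding connected_mgraph_def
  proof (intro conjI ballI)
    show "verts H \<noteq> {}" using c by (rule conn_nonempty)
    fix u v assume u: "u \<in> verts H" and v: "v \<in> verts H"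
    define Rch where "Rch = {z \<in> verts H. \<exists>xs es. is_path H u xs es z}"
    have "is_path H u [u] [] u" using u by (simp add: is_path_def)
    then have uR: "u \<in> Rch" using u by (auto simp: Rch_def)
    show "\<exists>xs es. is_path H u xs es v"
    proof (rule ccontr)
      assume "\<not> ?thesis"
      then have "v \<notin> Rch" by (simp add: Rch_def)
      then obtain a b where ab: "a \<in> Rch" "b \<in> verts H" "b \<notin> Rch" "{a, b} \<in> ends H ` edges H"
        using conn_cut[OF c u uR v] by blast
      obtain xs es where p: "is_path H u xs es a" using ab(1) by (auto simp: Rch_def)
      obtain e where e: "e \<in> edges H" "ends H e = {a, b}" using ab(4) by auto
      have "b \<notin> set xs" using path_prefix[OF p] ab(2,3) by (auto simp: Rch_def)
      then have "is_path H u (xs @ [b]) (es @ [e]) b" using path_extend[OF p e ab(2)] by simp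
      then show False using ab(2,3) by (auto simp: Rch_def)
    qed
  qed
qed

text \<open>Take a connected subgraph containing the terminals with as few vertices and edges as possible.\<close>

lemma ex_steiner_tree:
  assumes H: "finite_mgraph H" "connected_mgraph H" and R: "R \<subseteq> verts H" "R \<noteq> {}"
  shows "\<exists>T. subgraph T H \<and> is_tree T \<and> R \<subseteq> verts T \<and> leaves T \<subseteq> R"
proof -
  define ok where "ok T \<longleftrightarrow> subgraph T H \<and> connected_mgraph T \<and> R \<subseteq> verts T" for T
  have "ok H" using H R by (simp add: ok_def subgraph_def)
  then obtain T where T: "ok T" and min: "\<And>T'. ok T' \<Longrightarrow> card (verts T) + card (edges T) \<le> card (verts T') + card (edges T')"
    using ex_has_least_nat[of ok H "\<lambda>T. card (verts T) + card (edges T)"] by blast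
  have sub: "subgraph T H" and RT: "R \<subseteq> verts T" and cT: "conn (ends T ` edges T) (verts T)"
    using T by (auto simp: ok_def connected_mgraph_iff)
  have finT: "finite_mgraph T" using sub by (simp add: subgraph_def)
  then have fin: "finite (verts T)" "finite (edges T)" by (auto simp: finite_mgraph_def)
  have "acyclic_mgraph T"
    unfolding acyclic_mgraph_def
  proof
    assume "\<exists>u v xs es e. is_path T u xs es v \<and> e \<in> edges T \<and> e \<notin> set es \<and> ends T e = {u, v}"
    then obtain u v xs es e where p: "is_path T u xs es v" and e: "e \<in> edges T" "e \<notin> set es" "ends T e = {u, v}"
      by blast
    define T' where "T' = \<lparr>verts = verts T, edges = edges T - {e}, ends = ends T\<rparr>"
    have "conn (ends T ` (edges T - {e})) (verts T)"
      unfolding conn_def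
    proof (intro conjI allI impI)
      show "verts T \<noteq> {}" using RT R(2) by blast
      fix W assume W: "W \<subseteq> verts T \<and> W \<noteq> {} \<and> W \<noteq> verts T"
      then obtain x y where xy: "x \<in> W" "y \<in> verts T" "y \<notin> W" by blast
      then obtain a b where ab: "a \<in> W" "b \<in> verts T" "b \<notin> W" "{a, b} \<in> ends T ` edges T"
        using conn_cut[OF cT, of x W y] W by blast
      then obtain f where f: "f \<in> edges T" "ends T f = {a, b}" by auto
      show "\<exists>a\<in>W. \<exists>b\<in>verts T - W. {a, b} \<in> ends T ` (edges T - {e})"
      proof (cases "f = e")
        case False
        then show ?thesis using f ab by (metis DiffI image_eqI singletonD)
      next
        case True
        \<comment> \<open>If the deleted edge is the one crossing the cut, the path between its ends
          crosses the cut as well.\<close>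
        have on_path: "{xs ! i, xs ! Suc i} \<in> ends T ` (edges T - {e})" if i: "i < length es" for i
        proof -
          have "es ! i \<in> set es" using i by simp
          then have "es ! i \<noteq> e" using e(2) by metis
          then show ?thesis using path_edge(1,2)[OF p i] by (metis DiffI image_eqI singletonD)
        qed
        have "{a, b} = {u, v}" using True f e(3) by simp
        then consider "a = u" "b = v" | "a = v" "b = u" by (auto simp: doubleton_eq_iff)
        then show ?thesis
        proof cases
          case 1
          then obtain i where i: "i < length es" "xs ! i \<in> W" "xs ! Suc i \<notin> W"
            using path_cut[OF p, of W] ab by blast
          then show ?thesis using on_path[OF i(1)] path_edge(4)[OF p i(1)] by blast
        next
          case 2
          then obtain i where i: "i < length es" "xs ! i \<in> - W" "xs ! Suc i \<notin> - W"
            using path_cut[OF p, of "- W"] ab by blast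
          then show ?thesis using on_path[OF i(1)] path_edge(3)[OF p i(1)]
            by (metis Compl_iff DiffI insert_commute)
        qed
      qed
    qed
    then have "connected_mgraph T'" by (simp add: connected_mgraph_iff T'_def)
    moreover have "subgraph T' H" using sub unfolding subgraph_def finite_mgraph_def T'_def by (simp; metis Diff_iff subsetI subset_eq)
    ultimately have "ok T'" using RT by (simp add: ok_def T'_def)
    then have "card (edges T) \<le> card (edges T - {e})" using min[of T'] by (simp add: T'_def)
    then show False using card_Diff1_less[OF fin(2) e(1)] by simp
  qed
  moreover have "leaves T \<subseteq> R"
  proof
    fix v assume "v \<in> leaves T"
    then have v: "v \<in> verts T" "card {e \<in> edges T. v \<in> ends T e} = 1" by (auto simp: leaves_def degree_def)
    obtain e where e: "{e \<in> edges T. v \<in> ends T e} = {e}" using v(2) by (rule card_1_singletonE)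
    show "v \<in> R"
    proof (rule ccontr)
      assume vR: "v \<notin> R"
      define T' where "T' = \<lparr>verts = verts T - {v}, edges = {e \<in> edges T. v \<notin> ends T e}, ends = ends T\<rparr>"
      obtain x where x: "x \<in> R" using R(2) by blast
      have "x \<noteq> v" "x \<in> verts T" using x vR RT by auto
      then obtain w where w: "w \<in> verts T" "w \<noteq> v" "{v, w} \<in> ends T ` edges T"
        using conn_cut[OF cT, of v "{v}" x] v(1) by auto
      have leaf: "z = w" if z: "z \<in> verts T" "z \<noteq> v" "{v, z} \<in> ends T ` edges T" for z
      proof -
        obtain f where f: "f \<in> edges T" "ends T f = {v, z}" using z(3) by auto
        obtain g where g: "g \<in> edges T" "ends T g = {v, w}" using w(3) by auto
        have "f \<in> {e \<in> edges T. v \<in> ends T e}" "g \<in> {e \<in> edges T. v \<in> ends T e}" using f g by auto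
        then have "f = g" unfolding e by simp
        then show ?thesis using f g z(2) w(2) by (auto simp: doubleton_eq_iff)
      qed
      have "conn (ends T ` edges T) (verts T - {v})" by (rule conn_remove_leaf[OF cT w(1,2)]) (rule leaf)
      then have "conn (ends T ` {e \<in> edges T. v \<notin> ends T e}) (verts T - {v})"
      proof (rule conn_mono)
        fix a b assume a: "a \<in> verts T - {v}" "b \<in> verts T - {v}" "{a, b} \<in> ends T ` edges T"
        then obtain f where "f \<in> edges T" "ends T f = {a, b}" by auto
        then show "{a, b} \<in> ends T ` {e \<in> edges T. v \<notin> ends T e}" using a by (intro image_eqI[of _ _ f]) auto
      qed
      then have "connected_mgraph T'" by (simp add: connected_mgraph_iff T'_def)
      moreover have "ends T f \<subseteq> verts T - {v}" if "f \<in> edges T" "v \<notin> ends T f" for f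
        using that finT unfolding finite_mgraph_def by blast
      then have "subgraph T' H" using sub unfolding subgraph_def finite_mgraph_def T'_def by auto
      moreover have "R \<subseteq> verts T'" using RT vR by (auto simp: T'_def)
      ultimately have "ok T'" by (simp add: ok_def)
      then have "card (verts T) + card (edges T) \<le> card (verts T - {v}) + card {e \<in> edges T. v \<notin> ends T e}"
        using min[of T'] by (simp add: T'_def)
      moreover have "card {e \<in> edges T. v \<notin> ends T e} \<le> card (edges T)" using fin(2) by (intro card_mono) auto
      ultimately show False using card_Diff1_less[OF fin(1) v(1)] by linarith
    qed
  qed
  ultimately show ?thesis using sub finT RT T by (auto simp: is_tree_def ok_def)
qed

text \<open>The path edges before and after \<open>x\<close> have different other ends, so they are
  distinct.\<close>

lemma inner_path_degree:
  assumes fin: "finite_mgraph T" and p: "is_path T u xs es v" and x: "x \<in> set xs" "x \<noteq> u" "x \<noteq> v"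
  shows "2 \<le> degree T x"
proof -
  have len: "length xs = Suc (length es)" and dist: "distinct xs" and hd: "hd xs = u" and last: "last xs = v"
    using p by (auto simp: is_path_def)
  have ne: "xs \<noteq> []" using len by auto
  obtain i where i: "i < length xs" "xs ! i = x" using x(1) by (auto simp: in_set_conv_nth)
  have "i \<noteq> 0"
  proof
    assume "i = 0"
    then show False using i(2) x(2) hd ne by (simp add: hd_conv_nth)
  qed
  then obtain j where j: "i = Suc j" by (cases i) auto
  have "i \<noteq> length es"
  proof
    assume "i = length es"
    then show False using i(2) x(3) last ne len by (simp add: last_conv_nth)
  qed
  then have ij: "j < length es" "i < length es" using i(1) j len by auto
  note e1 = path_edge[OF p ij(1)] and e2 = path_edge[OF p ij(2)]
  have "xs ! j \<noteq> xs ! Suc i" using dist i(1) ij len j by (simp add: nth_eq_iff_index_eq)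
  moreover have "xs ! j \<noteq> x" using dist i ij len j by (auto simp: nth_eq_iff_index_eq)
  ultimately have "es ! j \<noteq> es ! i" using e1(2) e2(2) i(2) j by (auto simp: doubleton_eq_iff)
  then have "card {es ! j, es ! i} = 2" by simp
  moreover have "{es ! j, es ! i} \<subseteq> {e \<in> edges T. x \<in> ends T e}" using e1 e2 i(2) j by auto
  moreover have "finite {e \<in> edges T. x \<in> ends T e}" using fin by (simp add: finite_mgraph_def)
  ultimately show ?thesis unfolding degree_def by (metis card_mono)
qed

lemma below_connectivity:
  assumes "S \<subseteq> verts G" "card S < vertex_connectivity G"
  shows "connected_mgraph (delete_verts G S)" "1 < card (verts G - S)"
proof -
  have "\<not> (\<exists>S'. S' \<subseteq> verts G \<and> card S' = card S \<and>
      (\<not> connected_mgraph (delete_verts G S') \<or> card (verts G - S') \<le> 1))"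
    using assms(2) unfolding vertex_connectivity_def by (rule not_less_Least)
  then show "connected_mgraph (delete_verts G S)" "1 < card (verts G - S)" using assms(1) by fastforce+
qed

text \<open>Deleting all neighbours of \<open>v\<close> isolates it, whereas fewer than
  \<open>vertex_connectivity G\<close> deletions leave a connected graph on at least two
  vertices.\<close>

lemma degree_connectivity:
  assumes fin: "finite_mgraph G" and v: "v \<in> verts G"
  shows "vertex_connectivity G \<le> card {w \<in> verts G. {v, w} \<in> ends G ` edges G}"
proof (rule ccontr)
  assume a: "\<not> ?thesis"
  define S where "S = {w \<in> verts G. {v, w} \<in> ends G ` edges G}"
  have S: "S \<subseteq> verts G" "card S < vertex_connectivity G" using a by (auto simp: S_def)
  note b = below_connectivity[OF S]
  have "v \<notin> S"
  proof
    assume "v \<in> S"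
    then obtain e where "e \<in> edges G" "ends G e = {v}" by (auto simp: S_def)
    then show False using fin by (auto simp: finite_mgraph_def)
  qed
  then have vS: "v \<in> verts G - S" using v by simp
  have "verts G - S \<noteq> {v}" using b(2) by auto
  then obtain x where x: "x \<in> verts G - S" "x \<noteq> v" using vS by blast
  have "conn (ends G ` edges (delete_verts G S)) (verts G - S)"
    using b(1) by (simp add: connected_mgraph_iff delete_verts_def)
  then obtain y where "y \<in> verts G - S" "{v, y} \<in> ends G ` edges (delete_verts G S)"
    using conn_cut[of _ "verts G - S" v "{v}" x] vS x by blast
  then show False by (auto simp: S_def delete_verts_def)
qed

section \<open>The auxiliary graph and the disjoint connected sets\<close>

lemma conn_inj_image:
  assumes c: "conn E (f ` U)" and inj: "inj f"
    and e: "\<And>a b. a \<in> U \<Longrightarrow> b \<in> U \<Longrightarrow> {f a, f b} \<in> E \<Longrightarrow> {a, b} \<in> E'"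
  shows "conn E' U"
proof -
  obtain x where x: "x \<in> U" using conn_nonempty[OF c] by blast
  show ?thesis
  proof (rule connI[OF x])
    fix W assume W: "W \<subseteq> U" "x \<in> W" "W \<noteq> U"
    then obtain y where y: "y \<in> U" "y \<notin> W" by blast
    have "f y \<notin> f ` W" using y(2) inj by (auto simp: inj_def)
    then obtain a b where ab: "a \<in> f ` U" "a \<in> f ` W" "b \<in> f ` U" "b \<notin> f ` W" "{a, b} \<in> E"
      using conn_cut[OF c, of "f x" "f ` W" "f y"] x y W(2) by blast
    then obtain a' b' where "a = f a'" "a' \<in> W" "b = f b'" "b' \<in> U" "b' \<notin> W" by blast
    then show "\<exists>a\<in>W. \<exists>b\<in>U - W. {a, b} \<in> E'" using e[of a' b'] ab(5) W(1) by blast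
  qed
qed

text \<open>The last three claims are the numerical conditions of \<open>massed_linked\<close> for
  \<open>N = k + 2 * q\<close>, \<open>M = p + 2 * q\<close> and \<open>c = 5 * k + q - r\<close>.
  The cases \<open>r = 3\<close> and \<open>r = 4\<close> use \<open>q \<le> r\<close>; all three
  claims are equalities for \<open>p = 1\<close> and \<open>q = r = 3\<close>.\<close>

lemma size_arith:
  fixes p q r k :: nat
  assumes "0 < p" "0 < q" "3 \<le> r" "q \<le> r" and k: "k = (p + q) * r - q"
  shows "r \<le> k"
    and "5 * ((k + 2 * q) + (p + 2 * q)) \<le> 2 * (5 * k + q - r) + 20"
    and "3 * (k + 2 * q) \<le> 5 * k + q - r"
    and "2 * ((k + 2 * q) + (p + 2 * q)) + 1 \<le> 5 * k + q - r"
proof -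
  have q: "q \<le> q * r" using assms(3) by simp
  have kq: "k + q = (p + q) * r" unfolding k add_mult_distrib using q by linarith
  have "r \<le> p * r" using assms(1) by simp
  then show rk: "r \<le> k" using kq q unfolding add_mult_distrib by linarith
  have "r = 3 \<or> r = 4 \<or> r = 5 + (r - 5)" using assms(3) by linarith
  then consider "r = 3" | "r = 4" | s where "r = 5 + s" by blast
  then have 1: "2 * r + 5 * p + 20 * q \<le> 5 * k + 20 + 2 * q \<and> 5 * q + r \<le> 2 * k \<and> 2 * p + 7 * q + 1 + r \<le> 3 * k"
  proof cases
    case 1
    then have "k = 3 * p + 2 * q" "q \<le> 3" using kq assms(4) by simp_all
    then show ?thesis using 1 assms(1) by simp
  next
    case 2
    then have "k = 4 * p + 3 * q" "q \<le> 4" using kq assms(4) by simp_all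
    then show ?thesis using 2 assms(1) by simp
  next
    case 3
    have "2 * s \<le> (p + q) * s" using assms(1,2) by (intro mult_le_mono1) simp
    moreover have "k + q = 5 * p + 5 * q + (p + q) * s" using kq 3 by (simp add: algebra_simps)
    ultimately have "5 * p + 4 * q + 2 * s \<le> k" by linarith
    then show ?thesis using 3 assms(1,2) by linarith
  qed
  then have i: "2 * r + 5 * p + 20 * q \<le> 5 * k + 20 + 2 * q" "5 * q + r \<le> 2 * k" "2 * p + 7 * q + 1 + r \<le> 3 * k" by blast+
  obtain d where d: "5 * k + q = r + d" using rk le_Suc_ex[of r "5 * k + q"] by auto
  have d': "5 * k + q - r = d" using d by simp
  show "5 * ((k + 2 * q) + (p + 2 * q)) \<le> 2 * (5 * k + q - r) + 20" unfolding d' using i(1) d by (simp add: algebra_simps)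
  show "3 * (k + 2 * q) \<le> 5 * k + q - r" unfolding d' using i(2) d by (simp add: algebra_simps)
  show "2 * ((k + 2 * q) + (p + 2 * q)) + 1 \<le> 5 * k + q - r" unfolding d' using i(3) d by (simp add: algebra_simps)
qed

text \<open>Connectivity serves twice for the auxiliary graph \<open>Es\<close>: as a degree bound
  it provides the density, and it shows that a separation of order below \<open>card X\<close> has
  nothing behind it. So \<open>massed_linked\<close> applies, and the linkage is read back in
  \<open>G\<close>.\<close>

lemma ex_connected_sets:
  fixes G :: "('v, 'e) mgraph"
  assumes G: "finite_mgraph G" and pos: "0 < p" "0 < q" "3 \<le> r" "q \<le> r"
    and kappa: "10 * ((p + q) * r - q) \<le> vertex_connectivity G"
    and R: "R \<subseteq> verts G" "card R = r"
    and inj_a: "inj_on a {..<q}" and aR: "a ` {..<q} \<subseteq> R" and bR: "b ` {..<q} \<subseteq> R"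
  defines "EG \<equiv> ends G ` edges G" and "W \<equiv> verts G - R"
  shows "\<exists>(U :: nat \<Rightarrow> 'v set) Pt.
    (\<forall>t < p + q. U t \<subseteq> W \<and> conn EG (U t)) \<and>
    (\<forall>j < q. Pt j \<subseteq> W \<and> conn EG (Pt j) \<and> (\<exists>x\<in>Pt j. {a j, x} \<in> EG) \<and> (\<exists>x\<in>Pt j. {b j, x} \<in> EG)) \<and>
    (\<forall>t < p + q. \<forall>t' < p + q. t \<noteq> t' \<longrightarrow> U t \<inter> U t' = {}) \<and>
    (\<forall>j < q. \<forall>j' < q. j \<noteq> j' \<longrightarrow> Pt j \<inter> Pt j' = {}) \<and>
    (\<forall>t < p + q. \<forall>j < q. U t \<inter> Pt j = {}) \<and>
    (\<forall>t < p + q. \<forall>x\<in>R. \<not> (\<exists>j < q. t = p + j \<and> x = b j) \<longrightarrow> (\<exists>z\<in>U t. {x, z} \<in> EG))"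
proof -
  have a: "a j \<in> R" if "j < q" for j using aR that by auto
  have b: "b j \<in> R" if "j < q" for j using bR that by auto
  define k where "k = (p + q) * r - q"
  define c where "c = 5 * k + q - r"
  define N where "N = k + 2 * q"
  define M where "M = p + 2 * q"
  note ar = size_arith[OF pos k_def, folded N_def M_def c_def]
  have k1: "3 \<le> k" using ar(1) pos(3) by simp
  have finV: "finite (verts G)" using G by (simp add: finite_mgraph_def)
  have finR: "finite R" using R(1) finV finite_subset by blast
  have finW: "finite W" using finV by (simp add: W_def)
  have EG2: "card e = 2" "e \<subseteq> verts G" if "e \<in> EG" for e using G that by (auto simp: EG_def finite_mgraph_def)
  define nb where "nb v = {w \<in> verts G. {v, w} \<in> EG}" for v
  have nb10: "10 * k \<le> card (nb v)" if "v \<in> verts G" for v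
    using degree_connectivity[OF G that] kappa unfolding nb_def EG_def k_def by simp
  have finnb: "finite (nb v)" for v using finV by (simp add: nb_def)
  have outside: "\<exists>w\<in>nb v. w \<in> W - T" if v: "v \<in> verts G" and T: "finite T" "card T + r < 10 * k" for v T
  proof (rule ccontr)
    assume "\<not> ?thesis"
    then have "nb v \<subseteq> T \<union> R" by (auto simp: W_def nb_def)
    then have "card (nb v) \<le> card (T \<union> R)" using T(1) finR by (intro card_mono) auto
    also have "\<dots> \<le> card T + r" using card_Un_le[of T R] R(2) by simp
    finally show False using nb10[OF v] T(2) by simp
  qed
  \<comment> \<open>The pair \<open>(x, t)\<close> stands for attaching terminal \<open>x\<close> to
    the set \<open>U t\<close>. The terminal \<open>b j\<close> hangs on \<open>Pt j\<close> instead
    of \<open>U (p + j)\<close>, which leaves \<open>k\<close> pairs.\<close>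
  define I where "I = R \<times> {..<p + q} - (\<lambda>j. (b j, p + j)) ` {..<q}"
  have cardI: "card I = k"
  proof -
    have "(\<lambda>j. (b j, p + j)) ` {..<q} \<subseteq> R \<times> {..<p + q}" using b by auto
    moreover have "card ((\<lambda>j. (b j, p + j)) ` {..<q}) = q" by (simp add: card_image inj_on_def)
    ultimately show ?thesis unfolding I_def k_def by (simp add: card_Diff_subset card_cartesian_product R(2) mult.commute)
  qed
  have finI: "finite I" using finR by (simp add: I_def)
  have "\<exists>y. inj_on y I \<and> (\<forall>i\<in>I. y i \<in> nb (fst i) \<inter> W)"
  proof (rule distinct_representatives[OF finI])
    fix i assume "i \<in> I"
    then have i: "fst i \<in> R" by (auto simp: I_def)
    have "card (nb (fst i)) \<le> card (nb (fst i) \<inter> W \<union> R)"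
      using finnb finR by (intro card_mono) (auto simp: nb_def W_def)
    also have "\<dots> \<le> card (nb (fst i) \<inter> W) + r" using card_Un_le[of "nb (fst i) \<inter> W" R] R(2) by simp
    finally show "finite (nb (fst i) \<inter> W) \<and> card I \<le> card (nb (fst i) \<inter> W)"
      using nb10[of "fst i"] i R(1) ar(1) finnb[of "fst i"] cardI by auto
  qed
  then obtain y where y: "inj_on y I" "\<And>i. i \<in> I \<Longrightarrow> y i \<in> nb (fst i) \<and> y i \<in> W" by auto
  define \<tau> where "\<tau> i = (if i < q then a i else b (i - q))" for i
  have \<tau>R: "\<tau> i \<in> R" if "i < 2 * q" for i using that a b by (auto simp: \<tau>_def)
  text \<open>The vertex \<open>Inr j\<close> is a copy of \<open>a j\<close> and \<open>Inr (q + j)\<close> one of \<open>b j\<close>, for every \<open>j < q\<close>.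
    They are new vertices because a terminal may occur in several pairs.\<close>
  define Es :: "('v + nat) set set" where
    "Es = (\<lambda>e. Inl ` e) ` {e \<in> EG. e \<subseteq> W} \<union> {{Inl w, Inr i} | w i. w \<in> W \<and> i < 2 * q \<and> {\<tau> i, w} \<in> EG}"
  define Vs :: "('v + nat) set" where "Vs = Inl ` W \<union> Inr ` {..<2 * q}"
  define X :: "('v + nat) set" where "X = Inl ` y ` I \<union> Inr ` {..<2 * q}"
  have two: "\<forall>e\<in>Es. card e = 2"
    using EG2(1) by (auto simp: Es_def card_image)
  have EsLL: "{Inl w, Inl w'} \<in> Es \<longleftrightarrow> w \<in> W \<and> w' \<in> W \<and> {w, w'} \<in> EG" for w w'
  proof -
    have eq: "{Inl w, Inl w'} = (Inl ` e :: ('v + nat) set) \<longleftrightarrow> {w, w'} = e" for e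
      using inj_image_eq_iff[OF inj_Inl, of "{w, w'}" e] by simp
    have "{Inl w, Inl w'} \<in> (\<lambda>e. Inl ` e :: ('v + nat) set) ` {e \<in> EG. e \<subseteq> W} \<longleftrightarrow> {w, w'} \<in> {e \<in> EG. e \<subseteq> W}"
      unfolding image_iff eq by blast
    moreover have "{Inl w, Inl w'} \<notin> {{Inl w, Inr i} | w i. w \<in> W \<and> i < 2 * q \<and> {\<tau> i, w} \<in> EG}"
      by (auto simp: doubleton_eq_iff)
    ultimately show ?thesis unfolding Es_def by blast
  qed
  have EsLR: "{Inl w, Inr i} \<in> Es \<longleftrightarrow> w \<in> W \<and> i < 2 * q \<and> {\<tau> i, w} \<in> EG" for w i
    by (auto simp: Es_def doubleton_eq_iff)
  have EsRL: "{Inr i, Inl w} \<in> Es \<longleftrightarrow> w \<in> W \<and> i < 2 * q \<and> {\<tau> i, w} \<in> EG" for w i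
    using EsLR[of w i] by (simp add: insert_commute)
  have EsRR: "{Inr i, Inr i'} \<notin> Es" for i i'
    by (auto simp: Es_def doubleton_eq_iff)
  have finVs: "finite Vs" using finW by (simp add: Vs_def)
  have yW: "y ` I \<subseteq> W" using y(2) by auto
  have XV: "X \<subseteq> Vs" using yW by (auto simp: X_def Vs_def)
  have cardX: "card X = N"
  proof -
    have "card X = card (Inl ` y ` I :: ('v + nat) set) + card (Inr ` {..<2 * q} :: ('v + nat) set)"
      unfolding X_def using finI by (intro card_Un_disjoint) auto
    then show ?thesis using y(1) cardI by (simp add: card_image N_def)
  qed
  have O: "Vs - X = Inl ` (W - y ` I)" using yW by (auto simp: Vs_def X_def)
  \<comment> \<open>A vertex will lose at most \<open>r - q\<close> neighbours; subtracting twice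
    that amount avoids halving an odd number.\<close>
  have c2: "2 * c + 2 * (r - q) = 10 * k" using ar(1) pos(4) by (simp add: c_def)
  have degO: "2 * c \<le> card {z \<in> Vs. {v, z} \<in> Es}" if v: "v \<in> Vs - X" for v
  proof -
    obtain w where w: "v = Inl w" "w \<in> W" using v O by auto
    define NW where "NW = nb w \<inter> W"
    define A where "A = {i. i < q \<and> {a i, w} \<in> EG}"
    have fin: "finite NW" "finite A" using finnb by (auto simp: NW_def A_def)
    \<comment> \<open>Neighbours among the distinct \<open>a j\<close> reappear as copies, so only
      the other \<open>r - q\<close> terminals are lost. Copies of the \<open>b j\<close> are not
      counted, because the \<open>b j\<close> may coincide.\<close>
    have "nb w \<subseteq> NW \<union> (a ` A \<union> (R - a ` {..<q}))"
      by (auto simp: NW_def A_def W_def nb_def insert_commute)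
    then have "card (nb w) \<le> card (NW \<union> (a ` A \<union> (R - a ` {..<q})))" using fin finR by (intro card_mono) auto
    also have "\<dots> \<le> card NW + card (a ` A \<union> (R - a ` {..<q}))" by (rule card_Un_le)
    also have "\<dots> \<le> card NW + (card (a ` A) + card (R - a ` {..<q}))" by (intro add_left_mono card_Un_le)
    also have "card (a ` A) \<le> card A" using fin(2) by (rule card_image_le)
    also have "card (R - a ` {..<q}) = r - q"
      using a inj_a R(2) by (subst card_Diff_subset) (auto simp: card_image)
    finally have "10 * k \<le> card NW + card A + (r - q)" using nb10[of w] w(2) by (simp add: W_def)
    moreover have "card (Inl ` NW \<union> Inr ` A :: ('v + nat) set) \<le> card {z \<in> Vs. {v, z} \<in> Es}"
      using finVs w(2) unfolding w(1)
      by (intro card_mono) (auto simp: EsLL EsLR Vs_def NW_def A_def nb_def \<tau>_def)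
    moreover have "card (Inl ` NW \<union> Inr ` A :: ('v + nat) set) = card NW + card A"
      using fin by (subst card_Un_disjoint) (auto simp: card_image)
    ultimately show ?thesis using c2 by simp
  qed
  have dense: "c * card (Vs - X) < rho Es Vs (Vs - X)"
  proof -
    \<comment> \<open>The degrees alone give a weak inequality; an edge from a private neighbour to
      a vertex outside \<open>X\<close> makes it strict.\<close>
    obtain i0 where i0: "i0 \<in> I" using cardI k1 by (metis card.empty ex_in_conv not_numeral_le_zero)
    have y0: "y i0 \<in> W" using y(2) i0 by simp
    have "card (y ` I) + r < 10 * k" using card_image_le[OF finI, of y] cardI ar(1) k1 by linarith
    then obtain w where w: "w \<in> nb (y i0)" "w \<in> W - y ` I"
      using outside[of "y i0" "y ` I"] y0 finI by (auto simp: W_def)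
    have wO: "Inl w \<in> Vs - X" using w(2) O by auto
    have "Inl (y i0) \<in> {z \<in> X. {Inl w, z} \<in> Es}"
      using i0 w y0 by (auto simp: X_def EsLL nb_def insert_commute)
    then have "0 < card {z \<in> X. {Inl w, z} \<in> Es}"
      using finite_subset[OF XV finVs] by (auto simp: card_gt_0_iff)
    also have "\<dots> \<le> (\<Sum>v\<in>Vs - X. card {z \<in> X. {v, z} \<in> Es})"
      using wO finVs by (intro member_le_sum) auto
    finally have h: "0 < (\<Sum>v\<in>Vs - X. card {z \<in> X. {v, z} \<in> Es})" .
    have "(\<Sum>v\<in>Vs - X. 2 * c) \<le> (\<Sum>v\<in>Vs - X. card {z \<in> Vs. {v, z} \<in> Es})"
      by (intro sum_mono degO)
    moreover have "(\<Sum>v\<in>Vs - X. card {z \<in> Vs. {v, z} \<in> Es}) + (\<Sum>v\<in>Vs - X. card {z \<in> X. {v, z} \<in> Es}) =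
        2 * rho Es Vs (Vs - X)"
      using two by (intro degree_sum[OF finVs XV]) blast
    ultimately have "2 * (c * card (Vs - X)) < 2 * rho Es Vs (Vs - X)" using h by (simp add: mult.commute mult.left_commute)
    then show ?thesis by simp
  qed
  have noBA: "B - A = {}" if s: "sep Es Vs A B" "X \<subseteq> A" "card (A \<inter> B) < card X" for A B
  proof (rule ccontr)
    assume "B - A \<noteq> {}"
    then obtain z where z: "z \<in> B" "z \<notin> A" by blast
    have AB: "A \<union> B = Vs" using s(1) by (simp add: sep_def)
    have "z \<in> Inl ` W" using AB z s(2) unfolding Vs_def X_def by blast
    then obtain w where w: "z = Inl w" "w \<in> W" by blast
    have finAB: "finite (A \<inter> B)" using AB finVs by (metis finite_Int finite_Un)
    \<comment> \<open>Copies in the separator are dropped; its original vertices together with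
      \<open>R\<close> are too few to disconnect \<open>G\<close>.\<close>
    define S1 where "S1 = {w. Inl w \<in> A \<inter> B}"
    have S1c: "finite S1" "card S1 \<le> card (A \<inter> B)"
    proof -
      have "Inl ` S1 \<subseteq> A \<inter> B" by (auto simp: S1_def)
      then have "finite (Inl ` S1 :: ('v + nat) set)" "card (Inl ` S1 :: ('v + nat) set) \<le> card (A \<inter> B)"
        using finAB by (rule finite_subset, intro card_mono)
      then show "finite S1" "card S1 \<le> card (A \<inter> B)" by (auto simp: card_image finite_image_iff)
    qed
    have small: "card S1 + r < 10 * k" using S1c(2) s(3) cardX ar(1) pos(4) k1 unfolding N_def by linarith
    have "\<not> X \<subseteq> B"
    proof
      assume "X \<subseteq> B"
      then have "card X \<le> card (A \<inter> B)" using s(2) finAB by (intro card_mono) auto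
      then show False using s(3) by simp
    qed
    then obtain x where x: "x \<in> X" "x \<notin> B" "x \<in> A" using s(2) by blast
    \<comment> \<open>If the terminal found outside \<open>B\<close> is a copy, one of its
      neighbours that avoids the separator is used.\<close>
    have "\<exists>v. v \<in> W \<and> Inl v \<in> A \<and> Inl v \<notin> B"
    proof (cases x)
      case (Inl v)
      then show ?thesis using x yW by (auto simp: X_def)
    next
      case (Inr i)
      then have i: "i < 2 * q" using x(1) by (auto simp: X_def)
      obtain v where v: "v \<in> nb (\<tau> i)" "v \<in> W - S1"
        using outside[OF _ S1c(1) small, of "\<tau> i"] \<tau>R[OF i] R(1) by blast
      have e: "{x, Inl v} \<in> Es" using v i by (simp add: Inr EsRL nb_def)
      have "Inl v \<in> A"
      proof (rule ccontr)
        assume n: "Inl v \<notin> A"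
        then have "Inl v \<in> B" using AB v(2) by (auto simp: Vs_def)
        then show False using sepD[OF s(1) x(3,2) _ n] e by simp
      qed
      then show ?thesis using v(2) by (auto simp: S1_def)
    qed
    then obtain v where v: "v \<in> W" "Inl v \<in> A" "Inl v \<notin> B" by blast
    have S1W: "S1 \<subseteq> W"
    proof
      fix s assume "s \<in> S1"
      then have "Inl s \<in> Vs" unfolding S1_def AB[symmetric] by simp
      then show "s \<in> W" by (auto simp: Vs_def)
    qed
    have "S1 \<union> R \<subseteq> verts G" using S1W R(1) by (auto simp: W_def)
    moreover have "card (S1 \<union> R) < vertex_connectivity G"
      using card_Un_le[of S1 R] small R(2) kappa unfolding k_def[symmetric] by simp
    ultimately have "connected_mgraph (delete_verts G (S1 \<union> R))" by (rule below_connectivity(1))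
    then have "conn (ends (delete_verts G (S1 \<union> R)) ` edges (delete_verts G (S1 \<union> R))) (verts (delete_verts G (S1 \<union> R)))"
      unfolding connected_mgraph_iff .
    moreover have "ends (delete_verts G (S1 \<union> R)) = ends G" "verts (delete_verts G (S1 \<union> R)) = W - S1"
      unfolding delete_verts_def W_def by auto
    ultimately have cS: "conn (ends G ` edges (delete_verts G (S1 \<union> R))) (W - S1)" by simp
    have "v \<in> W - S1" "w \<in> W - S1" "w \<notin> {v. Inl v \<in> A}"
      using v w z unfolding S1_def by blast+
    then obtain x1 x2 where x12: "x1 \<in> W - S1" "Inl x1 \<in> A" "x2 \<in> W - S1" "Inl x2 \<notin> A"
        "{x1, x2} \<in> ends G ` edges (delete_verts G (S1 \<union> R))"
      using conn_cut[OF cS, of v "{v. Inl v \<in> A}" w] v(2) by blast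
    have "{x1, x2} \<in> EG" using x12(5) by (auto simp: EG_def delete_verts_def)
    then have "{Inl x1, Inl x2} \<in> Es" using x12 by (simp add: EsLL)
    moreover have "Inl x1 \<notin> B" using x12(1,2) unfolding S1_def by blast
    moreover have "Inl x2 \<in> B"
    proof -
      have "Inl x2 \<in> A \<union> B" unfolding AB using x12(3) by (simp add: Vs_def)
      then show ?thesis using x12(4) by blast
    qed
    ultimately show False using sepD[OF s(1) x12(2)] x12(4) by blast
  qed
  have "massed c Es Vs X"
    unfolding massed_def
  proof (intro conjI allI impI)
    fix A B assume "sep Es Vs A B" "X \<subseteq> A" "card (A \<inter> B) < card X"
    then have "B - A = {}" using noBA[of A B] by blast
    then show "rho Es Vs (B - A) \<le> c * card (B - A)" unfolding rho_def by (simp only: Int_empty_right) simp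
  qed (use finVs XV dense in auto)
  then have lk: "linked M Es Vs X"
    using cardX ar(2-4) k1 by (intro massed_linked[OF two, of c _ _ N]) (auto simp: N_def)
  \<comment> \<open>\<open>AP t\<close> collects the private neighbours for tree \<open>t\<close>,
    and \<open>BP j\<close> is the pair of copies to be joined by \<open>Pt j\<close>; this accounts
    for \<open>M = (p + q) + q\<close>.\<close>
  define AP :: "nat \<Rightarrow> ('v + nat) set" where "AP t = Inl ` y ` {i \<in> I. snd i = t}" for t
  define BP :: "nat \<Rightarrow> ('v + nat) set" where "BP j = {Inr j, Inr (q + j)}" for j
  define \<P> where "\<P> = AP ` {..<p + q} \<union> BP ` {..<q}"
  have Iin: "(x, t) \<in> I" if "t < p + q" "x \<in> R" "\<not> (\<exists>j < q. t = p + j \<and> x = b j)" for x t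
    using that by (auto simp: I_def)
  have APne: "AP t \<noteq> {}" if t: "t < p + q" for t
  proof -
    have "\<not> R \<subseteq> {b (t - p)}"
    proof
      assume "R \<subseteq> {b (t - p)}"
      then have "card R \<le> card {b (t - p)}" by (intro card_mono) auto
      then show False using R(2) pos(3) by simp
    qed
    then obtain x where "x \<in> R" "x \<noteq> b (t - p)" by blast
    then have "(x, t) \<in> I" by (intro Iin[OF t]) auto
    then show ?thesis by (auto simp: AP_def)
  qed
  have dAP: "AP t \<inter> AP t' = {}" if "t \<noteq> t'" for t t'
    using that y(1) by (auto simp: AP_def inj_on_def)
  have dBP: "BP j \<inter> BP j' = {}" if "j < q" "j' < q" "j \<noteq> j'" for j j' using that by (auto simp: BP_def)
  have dAB: "AP t \<inter> BP j = {}" for t j by (auto simp: AP_def BP_def)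
  have "parts M X \<P>" unfolding parts_def
  proof (intro conjI ballI)
    fix P assume "P \<in> \<P>"
    then show "P \<noteq> {}" using APne by (auto simp: \<P>_def BP_def)
    show "P \<subseteq> X" using \<open>P \<in> \<P>\<close> by (auto simp: \<P>_def AP_def BP_def X_def)
  next
    show "pairwise disjnt \<P>" unfolding pairwise_def disjnt_def
    proof (intro ballI impI)
      fix P P' assume P: "P \<in> \<P>" "P' \<in> \<P>" "P \<noteq> P'"
      from P(1) consider t where "P = AP t" | j where "j < q" "P = BP j" by (auto simp: \<P>_def)
      then show "P \<inter> P' = {}"
      proof cases
        case 1
        from P(2) consider t' where "P' = AP t'" | j where "P' = BP j" by (auto simp: \<P>_def)
        then show ?thesis
        proof cases
          fix t' assume "P' = AP t'"
          then show ?thesis using 1 P(3) dAP[of t t'] by metis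
        next
          fix j assume "P' = BP j"
          then show ?thesis using 1 dAB by simp
        qed
      next
        case 2
        from P(2) consider t' where "P' = AP t'" | j where "j < q" "P' = BP j" by (auto simp: \<P>_def)
        then show ?thesis
        proof cases
          fix t' assume "P' = AP t'"
          then show ?thesis using 2(2) dAB[of t' j] by (simp add: Int_commute)
        next
          fix j' assume "j' < q" "P' = BP j'"
          then show ?thesis using 2 P(3) dBP[of j j'] by metis
        qed
      qed
    qed
    have fP: "finite \<P>" by (simp add: \<P>_def)
    have "card {P \<in> \<P>. 2 \<le> card P} \<le> card \<P>" using fP by (intro card_mono) auto
    also have "\<dots> \<le> card (AP ` {..<p + q}) + card (BP ` {..<q})" unfolding \<P>_def by (rule card_Un_le)
    also have "\<dots> \<le> (p + q) + q"
      using card_image_le[of "{..<p + q}" AP] card_image_le[of "{..<q}" BP] by simp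
    finally show "card {P \<in> \<P>. 2 \<le> card P} \<le> M" by (simp add: M_def)
  qed
  then obtain C where C: "linkage Es Vs \<P> C" using lk unfolding linked_def by blast
  have AP: "AP t \<in> \<P>" if "t < p + q" for t using that by (simp add: \<P>_def)
  have BP: "BP j \<in> \<P>" if "j < q" for j using that by (simp add: \<P>_def)
  have inBP: "\<exists>j < q. Inr i \<in> BP j" if "i < 2 * q" for i
  proof (cases "i < q")
    case True then show ?thesis by (auto simp: BP_def)
  next
    case False
    then show ?thesis using that by (intro exI[of _ "i - q"]) (auto simp: BP_def)
  qed
  \<comment> \<open>Every copy belongs to some pair, so by disjointness no set of the linkage runs
    through a foreign copy, and the sets translate back to vertices of \<open>G\<close>.\<close>
  have clone: "i = j \<or> i = q + j" if "j < q" "Inr i \<in> C (BP j)" for i j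
  proof -
    have "i < 2 * q" using linkageD(2)[OF C BP[OF that(1)]] that(2) by (auto simp: Vs_def)
    then obtain j' where j': "j' < q" "Inr i \<in> BP j'" using inBP by blast
    have "BP j' = BP j"
    proof (rule ccontr)
      assume "BP j' \<noteq> BP j"
      then have "C (BP j') \<inter> C (BP j) = {}" by (rule linkage_disj[OF C BP[OF j'(1)] BP[OF that(1)]])
      then show False using linkageD(1)[OF C BP[OF j'(1)]] j'(2) that(2) by blast
    qed
    then show ?thesis using j'(2) by (auto simp: BP_def)
  qed
  have noclone: "Inr i \<notin> C (AP t)" if t: "t < p + q" for t i
  proof
    assume i: "Inr i \<in> C (AP t)"
    have "i < 2 * q" using linkageD(2)[OF C AP[OF t]] i by (auto simp: Vs_def)
    then obtain j where j: "j < q" "Inr i \<in> BP j" using inBP by blast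
    have "AP t \<noteq> BP j" using APne[OF t] dAB[of t j] by auto
    then have "C (AP t) \<inter> C (BP j) = {}" by (rule linkage_disj[OF C AP[OF t] BP[OF j(1)]])
    then show False using linkageD(1)[OF C BP[OF j(1)]] j(2) i by blast
  qed
  define U where "U t = {w. Inl w \<in> C (AP t)}" for t
  have UC: "C (AP t) = Inl ` U t" if "t < p + q" for t
  proof (rule set_eqI)
    fix z show "z \<in> C (AP t) \<longleftrightarrow> z \<in> Inl ` U t" using noclone[OF that] by (cases z) (auto simp: U_def)
  qed
  have Uprop: "U t \<subseteq> W \<and> conn EG (U t)" if t: "t < p + q" for t
  proof
    show "U t \<subseteq> W" using linkageD(2)[OF C AP[OF t]] by (auto simp: U_def Vs_def)
    have "conn Es (Inl ` U t)" using linkageD(3)[OF C AP[OF t]] UC[OF t] by simp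
    then show "conn EG (U t)" by (rule conn_inj_image) (simp_all add: EsLL)
  qed
  have "\<exists>P. P \<subseteq> W \<and> Inl ` P \<subseteq> C (BP j) \<and> conn EG P \<and> (\<exists>x\<in>P. {a j, x} \<in> EG) \<and> (\<exists>x\<in>P. {b j, x} \<in> EG)"
    if j: "j < q" for j
  proof -
    note d = linkageD[OF C BP[OF j]]
    have fC: "finite (C (BP j))" using d(2) finVs finite_subset by blast
    have ab: "Inr j \<in> C (BP j)" "Inr (q + j) \<in> C (BP j)" "(Inr j :: 'v + nat) \<noteq> Inr (q + j)"
      using d(1) pos(2) by (auto simp: BP_def)
    \<comment> \<open>Copies are never adjacent in \<open>Es\<close>, so a connected set of original
      vertices remains between the two.\<close>
    obtain P' where P': "P' \<subseteq> C (BP j) - {Inr j, Inr (q + j)}" "conn Es P'"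
        "\<exists>x\<in>P'. {Inr j, x} \<in> Es" "\<exists>x\<in>P'. {Inr (q + j), x} \<in> Es"
      using conn_between[OF d(3) fC ab EsRR] by (elim exE conjE) (rule that)
    define P where "P = {w. Inl w \<in> P'}"
    have PP: "P' = Inl ` P"
    proof (rule set_eqI)
      fix z show "z \<in> P' \<longleftrightarrow> z \<in> Inl ` P"
      proof (cases z)
        case (Inr i)
        have "z \<notin> P'" using clone[OF j, of i] P'(1) unfolding Inr by blast
        then show ?thesis using Inr by auto
      qed (auto simp: P_def)
    qed
    have "conn EG P" using P'(2) unfolding PP by (rule conn_inj_image) (simp_all add: EsLL)
    moreover have "P \<subseteq> W" using P'(1) d(2) by (auto simp: P_def Vs_def)
    moreover have "\<exists>x\<in>P. {a j, x} \<in> EG" using P'(3) j by (auto simp: PP EsRL \<tau>_def)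
    moreover have "\<exists>x\<in>P. {b j, x} \<in> EG" using P'(4) by (auto simp: PP EsRL \<tau>_def)
    ultimately show ?thesis using P'(1) PP by blast
  qed
  then obtain Pt where Pt: "\<And>j. j < q \<Longrightarrow> Pt j \<subseteq> W \<and> Inl ` Pt j \<subseteq> C (BP j) \<and> conn EG (Pt j) \<and>
      (\<exists>x\<in>Pt j. {a j, x} \<in> EG) \<and> (\<exists>x\<in>Pt j. {b j, x} \<in> EG)"
    by metis
  have "U t \<inter> U t' = {}" if "t < p + q" "t' < p + q" "t \<noteq> t'" for t t'
  proof -
    have "AP t \<noteq> AP t'" using dAP[OF that(3)] APne[OF that(1)] by auto
    then show ?thesis using linkage_disj[OF C AP[OF that(1)] AP[OF that(2)]] by (auto simp: U_def)
  qed
  moreover have "Pt j \<inter> Pt j' = {}" if "j < q" "j' < q" "j \<noteq> j'" for j j'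
  proof -
    have "BP j \<noteq> BP j'" using dBP[OF that] by (auto simp: BP_def)
    then have "C (BP j) \<inter> C (BP j') = {}" by (rule linkage_disj[OF C BP[OF that(1)] BP[OF that(2)]])
    then show ?thesis using Pt[OF that(1)] Pt[OF that(2)] by blast
  qed
  moreover have "U t \<inter> Pt j = {}" if "t < p + q" "j < q" for t j
  proof -
    have "AP t \<noteq> BP j" using dAB[of t j] APne[OF that(1)] by auto
    then have "C (AP t) \<inter> C (BP j) = {}" by (rule linkage_disj[OF C AP[OF that(1)] BP[OF that(2)]])
    then show ?thesis using Pt[OF that(2)] unfolding U_def by blast
  qed
  moreover have "\<exists>z\<in>U t. {x, z} \<in> EG" if "t < p + q" "x \<in> R" "\<not> (\<exists>j < q. t = p + j \<and> x = b j)" for t x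
  proof (intro bexI)
    have i: "(x, t) \<in> I" by (rule Iin[OF that])
    then have "Inl (y (x, t)) \<in> AP t" by (force simp: AP_def)
    then show "y (x, t) \<in> U t" using linkageD(1)[OF C AP[OF that(1)]] by (auto simp: U_def)
    show "{x, y (x, t)} \<in> EG" using y(2)[OF i] by (simp add: nb_def)
  qed
  moreover have "Pt j \<subseteq> W \<and> conn EG (Pt j) \<and> (\<exists>x\<in>Pt j. {a j, x} \<in> EG) \<and> (\<exists>x\<in>Pt j. {b j, x} \<in> EG)"
    if "j < q" for j using Pt[OF that] by simp
  ultimately show ?thesis using Uprop by (intro exI[of _ U] exI[of _ Pt] conjI) simp_all
qed

section \<open>Steiner trees built on the connected sets\<close>

lemma conn_attach:
  assumes U: "conn E U" and S: "\<And>x. x \<in> S \<Longrightarrow> \<exists>z\<in>U. {x, z} \<in> E"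
  shows "conn E (U \<union> S)"
proof -
  have "conn E (U \<union> (\<Union>x\<in>S. {x}))"
  proof (rule conn_UN[OF _ U])
    fix x assume "x \<in> S"
    then obtain z where "z \<in> U" "{x, z} \<in> E" using S by blast
    then show "{x} \<inter> U \<noteq> {} \<or> (\<exists>a\<in>U. \<exists>b\<in>{x}. {a, b} \<in> E)" by (auto simp: insert_commute[of x z "{}"])
  qed simp
  then show ?thesis by simp
qed

text \<open>Choosing one edge of \<open>G\<close> for each pair in \<open>F\<close> removes parallel
  edges, so counting pairs bounds the degrees of the tree.\<close>

lemma ex_tree_in:
  assumes G: "finite_mgraph G" and F: "F \<subseteq> ends G ` edges G" "\<And>e. e \<in> F \<Longrightarrow> e \<subseteq> V" and V: "V \<subseteq> verts G"
    and c: "conn F V" and R: "R \<subseteq> V" "R \<noteq> {}"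
  shows "\<exists>T. steiner_tree G R T \<and> verts T \<subseteq> V \<and> ends G ` edges T \<subseteq> F \<and> (\<forall>x. degree T x \<le> card {e \<in> F. x \<in> e})"
proof -
  have "\<forall>l\<in>F. \<exists>e. e \<in> edges G \<and> ends G e = l" using F(1) by blast
  then obtain \<epsilon> where \<epsilon>: "\<And>l. l \<in> F \<Longrightarrow> \<epsilon> l \<in> edges G \<and> ends G (\<epsilon> l) = l" by metis
  define H where "H = \<lparr>verts = V, edges = \<epsilon> ` F, ends = ends G\<rparr>"
  have H: "verts H = V" "edges H = \<epsilon> ` F" "ends H = ends G" by (simp_all add: H_def)
  have finF: "finite F" using F(1) G by (simp add: finite_mgraph_def finite_subset)
  have finH: "finite_mgraph H"
    unfolding finite_mgraph_def H
  proof (intro conjI ballI)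
    show "finite V" using V G by (auto simp: finite_mgraph_def intro: finite_subset)
    show "finite (\<epsilon> ` F)" using finF by simp
    fix e assume "e \<in> \<epsilon> ` F"
    then obtain l where l: "l \<in> F" "e = \<epsilon> l" by blast
    show "ends G e \<subseteq> V" using F(2)[OF l(1)] \<epsilon>[OF l(1)] l(2) by simp
    show "card (ends G e) = 2" using \<epsilon>[OF l(1), THEN conjunct1] l(2) G by (simp add: finite_mgraph_def)
  qed
  have "ends H ` edges H = F" unfolding H image_image using \<epsilon> by (simp cong: image_cong)
  then have "connected_mgraph H" using c by (simp add: connected_mgraph_iff H)
  then obtain T where T: "subgraph T H" "is_tree T" "R \<subseteq> verts T" "leaves T \<subseteq> R"
    using ex_steiner_tree[OF finH, of R] R H(1) by auto
  have endsT: "ends T = ends G" and vT: "verts T \<subseteq> V" and eT: "edges T \<subseteq> \<epsilon> ` F"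
    using T(1) by (auto simp: subgraph_def H)
  have "subgraph T G" unfolding subgraph_def
  proof (intro conjI)
    show "finite_mgraph T" using T(1) by (simp add: subgraph_def)
    show "verts T \<subseteq> verts G" using vT V by blast
    show "edges T \<subseteq> edges G" using eT \<epsilon> by blast
  qed (rule endsT)
  moreover have "ends G ` edges T \<subseteq> F"
  proof
    fix l assume "l \<in> ends G ` edges T"
    then obtain l' where "l' \<in> F" "l = ends G (\<epsilon> l')" using eT by blast
    then show "l \<in> F" using \<epsilon> by simp
  qed
  moreover have "degree T x \<le> card {e \<in> F. x \<in> e}" for x
  proof -
    have "{e \<in> edges T. x \<in> ends T e} \<subseteq> \<epsilon> ` {l \<in> F. x \<in> l}"
    proof
      fix e assume "e \<in> {e \<in> edges T. x \<in> ends T e}"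
      then obtain l where "l \<in> F" "e = \<epsilon> l" "x \<in> ends G e" using eT endsT by auto
      then show "e \<in> \<epsilon> ` {l \<in> F. x \<in> l}" using \<epsilon> by auto
    qed
    then have "degree T x \<le> card (\<epsilon> ` {l \<in> F. x \<in> l})" unfolding degree_def using finF by (intro card_mono) auto
    also have "\<dots> \<le> card {l \<in> F. x \<in> l}" using finF by (intro card_image_le) simp
    finally show ?thesis .
  qed
  ultimately show ?thesis using T vT by (auto simp: steiner_tree_def)
qed

lemma steiner_tree_cut:
  assumes T: "steiner_tree G R T" and x: "x \<in> R" "x \<in> D" and y: "y \<in> R" "y \<notin> D"
  shows "\<exists>e\<in>edges T. \<exists>u w. ends G e = {u, w} \<and> u \<in> D \<and> w \<notin> D"
proof -
  have c: "conn (ends G ` edges T) (verts T)" and R: "R \<subseteq> verts T"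
    using T by (auto simp: steiner_tree_def is_tree_def subgraph_def connected_mgraph_iff)
  obtain u w where uw: "u \<in> D" "w \<notin> D" "{u, w} \<in> ends G ` edges T" using conn_cut[OF c, of x D y] x y R by blast
  then show ?thesis by (metis imageE)
qed

text \<open>\<open>F\<close> offers each terminal a single pair, so its degree is at most 1; a
  second terminal rules out degree 0.\<close>

lemma pendant_tree:
  assumes G: "finite_mgraph G" and R: "R \<subseteq> verts G" "2 \<le> card R"
    and U: "U \<subseteq> verts G - R" "conn (ends G ` edges G) U"
    and z: "\<And>x. x \<in> R \<Longrightarrow> \<exists>z\<in>U. {x, z} \<in> ends G ` edges G"
  shows "\<exists>T. steiner_tree G R T \<and> pendant R T \<and> verts T \<subseteq> U \<union> R \<and>
    (\<forall>e\<in>edges T. ends G e \<inter> U \<noteq> {}) \<and> (\<forall>x\<in>R. degree T x \<le> 1)"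
proof -
  define EG where "EG = ends G ` edges G"
  obtain \<zeta> where \<zeta>: "\<And>x. x \<in> R \<Longrightarrow> \<zeta> x \<in> U \<and> {x, \<zeta> x} \<in> EG" using z unfolding EG_def by metis
  define F where "F = {e \<in> EG. e \<subseteq> U} \<union> (\<lambda>x. {x, \<zeta> x}) ` R"
  have FE: "F \<subseteq> ends G ` edges G" using \<zeta> by (auto simp: F_def EG_def)
  have FV: "e \<subseteq> U \<union> R" if "e \<in> F" for e using that \<zeta> by (auto simp: F_def)
  have "conn F U" using U(2) by (rule conn_mono) (auto simp: F_def EG_def)
  then have c: "conn F (U \<union> R)"
  proof (rule conn_attach)
    fix x assume "x \<in> R"
    then show "\<exists>z\<in>U. {x, z} \<in> F" using \<zeta>[of x] by (intro bexI[of _ "\<zeta> x"]) (auto simp: F_def)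
  qed
  have ne: "R \<noteq> {}" using R(2) by auto
  have UV: "U \<union> R \<subseteq> verts G" using U(1) R(1) by blast
  obtain T where T: "steiner_tree G R T" "verts T \<subseteq> U \<union> R" "ends G ` edges T \<subseteq> F"
    "\<And>x. degree T x \<le> card {e \<in> F. x \<in> e}"
    using ex_tree_in[OF G FE FV UV c _ ne] by auto
  have deg1: "degree T x \<le> 1" if x: "x \<in> R" for x
  proof -
    have "{e \<in> F. x \<in> e} \<subseteq> {{x, \<zeta> x}}" using x \<zeta> U(1) by (auto simp: F_def)
    then have "card {e \<in> F. x \<in> e} \<le> card {{x, \<zeta> x}}" by (intro card_mono) auto
    then show ?thesis using T(4)[of x] by simp
  qed
  have "leaves T = R"
  proof
    show "leaves T \<subseteq> R" using T(1) by (simp add: steiner_tree_def)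
    show "R \<subseteq> leaves T"
    proof
      fix x assume x: "x \<in> R"
      have "\<not> R \<subseteq> {x}"
      proof
        assume "R \<subseteq> {x}"
        then have "card R \<le> card {x}" by (intro card_mono) auto
        then show False using R(2) by simp
      qed
      then obtain y where "y \<in> R" "y \<notin> {x}" by blast
      then obtain e u w where e: "e \<in> edges T" "ends G e = {u, w}" "u \<in> {x}"
        using steiner_tree_cut[OF T(1) x, of "{x}" y] by blast
      have "finite (edges T)" "ends T = ends G" using T(1) by (auto simp: steiner_tree_def subgraph_def finite_mgraph_def)
      then have "0 < degree T x" unfolding degree_def using e by (auto simp: card_gt_0_iff)
      then show "x \<in> leaves T" using deg1[OF x] x T(1) by (auto simp: leaves_def steiner_tree_def)
    qed
  qed
  moreover have "ends G e \<inter> U \<noteq> {}" if e: "e \<in> edges T" for e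
  proof -
    have l: "ends G e \<in> F" using T(3) e by blast
    have "e \<in> edges G" using e T(1) by (auto simp: steiner_tree_def subgraph_def)
    then have "card (ends G e) = 2" using G by (simp add: finite_mgraph_def)
    then have "ends G e \<noteq> {}" by auto
    then show ?thesis using l \<zeta> by (auto simp: F_def)
  qed
  ultimately show ?thesis using T deg1 by (intro exI[of _ T]) (simp add: pendant_def)
qed

text \<open>In \<open>F\<close> every terminal but \<open>a\<close> lies in one pair, while
  \<open>a\<close> lies in \<open>{a, \<alpha>}\<close> towards \<open>P\<close> and in
  \<open>{a, \<zeta> a}\<close> towards \<open>U\<close>. A third terminal forces the tree to go
  from \<open>b\<close> through \<open>a\<close> and to use both.\<close>

lemma non_pendant_tree:
  assumes G: "finite_mgraph G" and R: "R \<subseteq> verts G" "3 \<le> card R" and ab: "a \<in> R" "b \<in> R" "a \<noteq> b"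
    and U: "U \<subseteq> verts G - R" "conn (ends G ` edges G) U"
    and P: "P \<subseteq> verts G - R" "conn (ends G ` edges G) P" "U \<inter> P = {}"
    and Pa: "\<exists>x\<in>P. {a, x} \<in> ends G ` edges G" and Pb: "\<exists>x\<in>P. {b, x} \<in> ends G ` edges G"
    and z: "\<And>x. x \<in> R \<Longrightarrow> x \<noteq> b \<Longrightarrow> \<exists>z\<in>U. {x, z} \<in> ends G ` edges G"
  shows "\<exists>T. steiner_tree G R T \<and> non_pendant R T \<and> verts T \<subseteq> U \<union> P \<union> R \<and>
    (\<forall>e\<in>edges T. ends G e \<inter> (U \<union> P) \<noteq> {}) \<and> (\<forall>x\<in>R - {a}. degree T x \<le> 1)"
proof -
  define EG where "EG = ends G ` edges G"
  have "\<forall>x\<in>R - {b}. \<exists>z. z \<in> U \<and> {x, z} \<in> EG" using z unfolding EG_def by blast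
  then obtain \<zeta> where \<zeta>: "\<And>x. x \<in> R - {b} \<Longrightarrow> \<zeta> x \<in> U \<and> {x, \<zeta> x} \<in> EG" by metis
  obtain \<alpha> \<beta> where \<alpha>: "\<alpha> \<in> P" "{a, \<alpha>} \<in> EG" and \<beta>: "\<beta> \<in> P" "{b, \<beta>} \<in> EG"
    using Pa Pb unfolding EG_def by blast
  define F where "F = {e \<in> EG. e \<subseteq> U} \<union> {e \<in> EG. e \<subseteq> P} \<union> (\<lambda>x. {x, \<zeta> x}) ` (R - {b}) \<union> {{a, \<alpha>}, {b, \<beta>}}"
  have Fcases: thesis if "e \<in> F" "e \<subseteq> U \<Longrightarrow> thesis" "e \<subseteq> P \<Longrightarrow> thesis"
    "\<And>x. x \<in> R \<Longrightarrow> x \<noteq> b \<Longrightarrow> e = {x, \<zeta> x} \<Longrightarrow> \<zeta> x \<in> U \<Longrightarrow> thesis"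
    "e = {a, \<alpha>} \<Longrightarrow> thesis" "e = {b, \<beta>} \<Longrightarrow> thesis" for e thesis
    using that(1) unfolding F_def
  proof (elim UnE insertE emptyE imageE)
    fix x assume "e = {x, \<zeta> x}" "x \<in> R - {b}"
    then show thesis using that(4)[of x] \<zeta>[of x] by simp
  qed (use that in blast)+
  have FE: "F \<subseteq> ends G ` edges G" using \<zeta> \<alpha>(2) \<beta>(2) by (auto simp: F_def EG_def)
  have FV: "e \<subseteq> U \<union> P \<union> R" if "e \<in> F" for e
    using that by (rule Fcases) (use \<alpha>(1) \<beta>(1) ab in auto)
  have "conn F U" using U(2) by (rule conn_mono) (auto simp: F_def EG_def)
  then have c1: "conn F (U \<union> (R - {b}))"
  proof (rule conn_attach)
    fix x assume "x \<in> R - {b}"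
    then show "\<exists>z\<in>U. {x, z} \<in> F" using \<zeta>[of x] by (intro bexI[of _ "\<zeta> x"]) (auto simp: F_def)
  qed
  have "conn F P" using P(2) by (rule conn_mono) (auto simp: F_def EG_def)
  then have c2: "conn F (P \<union> {a, b})"
  proof (rule conn_attach)
    fix x assume "x \<in> {a, b}"
    then show "\<exists>z\<in>P. {x, z} \<in> F" using \<alpha>(1) \<beta>(1) by (auto simp: F_def)
  qed
  have "conn F (U \<union> (R - {b}) \<union> (P \<union> {a, b}))" using ab by (intro conn_Un[OF c1 c2, of a]) auto
  moreover have "U \<union> (R - {b}) \<union> (P \<union> {a, b}) = U \<union> P \<union> R" using ab by blast
  ultimately have c: "conn F (U \<union> P \<union> R)" by simp
  have ne: "R \<noteq> {}" using ab(1) by blast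
  have UV: "U \<union> P \<union> R \<subseteq> verts G" using U(1) P(1) R(1) by blast
  obtain T where T: "steiner_tree G R T" "verts T \<subseteq> U \<union> P \<union> R" "ends G ` edges T \<subseteq> F"
    "\<And>x. degree T x \<le> card {e \<in> F. x \<in> e}"
    using ex_tree_in[OF G FE FV UV c _ ne] by auto
  have dis: "x \<notin> U" "x \<notin> P" if "x \<in> R" for x using that U(1) P(1) by auto
  have deg1: "degree T x \<le> 1" if x: "x \<in> R - {a}" for x
  proof -
    define l where "l = (if x = b then {b, \<beta>} else {x, \<zeta> x})"
    have "e = l" if "e \<in> F" and xe: "x \<in> e" for e
      using \<open>e \<in> F\<close>
    proof (rule Fcases)
      assume "e \<subseteq> U" then show ?thesis using xe dis x by blast
    next
      assume "e \<subseteq> P" then show ?thesis using xe dis x by blast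
    next
      fix y assume "y \<in> R" "y \<noteq> b" "e = {y, \<zeta> y}" "\<zeta> y \<in> U"
      then show ?thesis using xe dis[of x] x by (auto simp: l_def)
    next
      assume "e = {a, \<alpha>}" then show ?thesis using xe dis[of x] x \<alpha>(1) by auto
    next
      assume "e = {b, \<beta>}" then show ?thesis using xe dis[of x] x \<beta>(1) by (auto simp: l_def)
    qed
    then have "{e \<in> F. x \<in> e} \<subseteq> {l}" by blast
    then have "card {e \<in> F. x \<in> e} \<le> card {l}" by (intro card_mono) auto
    then show ?thesis using T(4)[of x] by simp
  qed
  have "\<not> R \<subseteq> {a, b}"
  proof
    assume "R \<subseteq> {a, b}"
    then have "card R \<le> card {a, b}" by (intro card_mono) auto
    then show False using R(2) ab(3) by simp
  qed
  then obtain y where y: "y \<in> R" "y \<noteq> a" "y \<noteq> b" by blast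
  text \<open>The tree must leave \<open>P \<union> {b}\<close> and \<open>P \<union> {a, b}\<close> to reach the terminal \<open>y\<close>.\<close>
  obtain e u w where e: "e \<in> edges T" "ends G e = {u, w}" "u \<in> insert b P" "w \<notin> insert b P"
    using steiner_tree_cut[OF T(1) ab(2), of "insert b P" y] y dis[of y] by blast
  \<comment> \<open>No other pair of \<open>F\<close> joins \<open>P \<union> {b}\<close> to the
    rest.\<close>
  have ea: "ends G e = {a, \<alpha>}"
  proof (rule Fcases)
    show "ends G e \<in> F" using T(3) e(1) by blast
    show ?thesis if "ends G e \<subseteq> U" using that e dis[OF ab(2)] P(3) by auto
    show ?thesis if "ends G e \<subseteq> P" using that e by auto
    show ?thesis if "x \<in> R" "x \<noteq> b" "ends G e = {x, \<zeta> x}" "\<zeta> x \<in> U" for x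
      using that e dis[OF that(1)] dis[OF ab(2)] P(3) by (auto simp: doubleton_eq_iff)
    show ?thesis if "ends G e = {b, \<beta>}" using that e \<beta>(1) by (auto simp: doubleton_eq_iff)
  qed
  obtain f u' w' where f: "f \<in> edges T" "ends G f = {u', w'}" "u' \<in> insert a (insert b P)" "w' \<notin> insert a (insert b P)"
    using steiner_tree_cut[OF T(1) ab(2), of "insert a (insert b P)" y] y dis[of y] by blast
  \<comment> \<open>Only \<open>{a, \<zeta> a}\<close> leaves \<open>P \<union> {a, b}\<close>; it
    is the second edge at \<open>a\<close>.\<close>
  have fa: "a \<in> ends G f" "ends G f \<noteq> {a, \<alpha>}"
  proof -
    have "a \<in> ends G f \<and> ends G f \<noteq> {a, \<alpha>}"
    proof (rule Fcases)
      show "ends G f \<in> F" using T(3) f(1) by blast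
      show ?thesis if "ends G f \<subseteq> U" using that f dis[OF ab(1)] dis[OF ab(2)] P(3) by auto
      show ?thesis if "ends G f \<subseteq> P" using that f by auto
      show ?thesis if x: "x \<in> R" "x \<noteq> b" "ends G f = {x, \<zeta> x}" "\<zeta> x \<in> U" for x
      proof -
        have "\<zeta> x \<noteq> a" "\<zeta> x \<noteq> b" "\<zeta> x \<notin> P" "x \<notin> P" "\<zeta> x \<noteq> \<alpha>"
          using x dis ab P(3) \<alpha>(1) by auto
        then show ?thesis using x f by (auto simp: doubleton_eq_iff)
      qed
      show ?thesis if "ends G f = {a, \<alpha>}" using that f \<alpha>(1) by (auto simp: doubleton_eq_iff)
      show ?thesis if "ends G f = {b, \<beta>}" using that f \<beta>(1) by (auto simp: doubleton_eq_iff)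
    qed
    then show "a \<in> ends G f" "ends G f \<noteq> {a, \<alpha>}" by auto
  qed
  have fin: "finite (edges T)" "ends T = ends G" using T(1) by (auto simp: steiner_tree_def subgraph_def finite_mgraph_def)
  have "e \<noteq> f" using ea fa(2) by auto
  then have "2 = card {e, f}" by simp
  also have "\<dots> \<le> degree T a" unfolding degree_def using e(1) f(1) ea fa(1) fin by (intro card_mono) auto
  finally have "non_pendant R T" using T(1) ab(1) by (auto simp: non_pendant_def inner_verts_def steiner_tree_def)
  moreover have "ends G e \<inter> (U \<union> P) \<noteq> {}" if e: "e \<in> edges T" for e
  proof -
    have l: "ends G e \<in> F" using T(3) e by blast
    have "e \<in> edges G" using e T(1) by (auto simp: steiner_tree_def subgraph_def)
    then have "card (ends G e) = 2" using G by (simp add: finite_mgraph_def)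
    then have ne: "ends G e \<noteq> {}" by auto
    show ?thesis using l by (rule Fcases) (use ne \<alpha>(1) \<beta>(1) in auto)
  qed
  ultimately show ?thesis using T deg1 by (intro exI[of _ T]) simp
qed

text \<open>\<open>\<Omega> t\<close> holds the non-terminals reserved for tree \<open>t\<close>,
  and \<open>Z t\<close> the terminals that may be inner vertices of it. Every edge meets the
  reserved set of its tree, so the trees are edge-disjoint. A common inner vertex of two paths would
  be a terminal of degree at least 2 in both trees, hence in both sets \<open>Z\<close>.\<close>

lemma CIST_family:
  assumes G: "finite_mgraph G" and I: "finite I" and R: "2 \<le> card R"
    and T: "\<And>t. t \<in> I \<Longrightarrow> steiner_tree G R (T t)"
    and vT: "\<And>t. t \<in> I \<Longrightarrow> verts (T t) \<subseteq> \<Omega> t \<union> R"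
    and eT: "\<And>t e. t \<in> I \<Longrightarrow> e \<in> edges (T t) \<Longrightarrow> ends G e \<inter> \<Omega> t \<noteq> {}"
    and deg: "\<And>t x. t \<in> I \<Longrightarrow> x \<in> R - Z t \<Longrightarrow> degree (T t) x \<le> 1"
    and \<Omega>: "\<And>t. t \<in> I \<Longrightarrow> \<Omega> t \<inter> R = {}" "\<And>t t'. t \<in> I \<Longrightarrow> t' \<in> I \<Longrightarrow> t \<noteq> t' \<Longrightarrow> \<Omega> t \<inter> \<Omega> t' = {}"
    and Z: "\<And>t t'. t \<in> I \<Longrightarrow> t' \<in> I \<Longrightarrow> t \<noteq> t' \<Longrightarrow> Z t \<inter> Z t' = {}"
  shows "is_CIST G R (T ` I)" "inj_on T I"
proof -
  have finT: "finite_mgraph (T t)" "ends (T t) = ends G" if "t \<in> I" for t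
    using T[OF that] by (auto simp: steiner_tree_def subgraph_def)
  have edisj: "edges (T t) \<inter> edges (T t') = {}" if t: "t \<in> I" "t' \<in> I" "t \<noteq> t'" for t t'
  proof (rule ccontr)
    assume "\<not> ?thesis"
    then obtain e where e: "e \<in> edges (T t)" "e \<in> edges (T t')" by blast
    obtain w where w: "w \<in> ends G e" "w \<in> \<Omega> t" using eT[OF t(1) e(1)] by blast
    have "w \<in> verts (T t')" using finT[OF t(2)] e(2) w(1) by (auto simp: finite_mgraph_def)
    then show False using vT[OF t(2)] w(2) \<Omega>(1)[OF t(1)] \<Omega>(2)[OF t] by blast
  qed
  \<comment> \<open>With nonempty edge sets, edge-disjointness makes the trees distinct, so the
    family has the required size.\<close>
  have ne: "edges (T t) \<noteq> {}" if "t \<in> I" for t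
  proof -
    have "R \<noteq> {}" using R by auto
    then obtain x where x: "x \<in> R" by blast
    have "\<not> R \<subseteq> {x}"
    proof
      assume "R \<subseteq> {x}"
      then have "card R \<le> card {x}" by (intro card_mono) auto
      then show False using R by simp
    qed
    then obtain y where "y \<in> R" "y \<notin> {x}" by blast
    then show ?thesis using steiner_tree_cut[OF T[OF that] x, of "{x}" y] by blast
  qed
  show "inj_on T I"
  proof (rule inj_onI, rule ccontr)
    fix t t' assume t: "t \<in> I" "t' \<in> I" "T t = T t'" "t \<noteq> t'"
    then show False using edisj[OF t(1,2,4)] ne[OF t(1)] by simp
  qed
  show "is_CIST G R (T ` I)"
    unfolding is_CIST_def
  proof (intro conjI ballI impI allI)
    show "finite (T ` I)" using I by simp
    show "steiner_tree G R S" if "S \<in> T ` I" for S using that T by blast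
    fix u v S S' xs es xs' es'
    assume "S \<in> T ` I" "S' \<in> T ` I" and uv: "u \<noteq> v \<and> S \<noteq> S'"
      and p: "is_path S u xs es v \<and> is_path S' u xs' es' v"
    then obtain t t' where t: "t \<in> I" "t' \<in> I" "S = T t" "S' = T t'" "t \<noteq> t'" by blast
    have "set es \<subseteq> edges (T t)" "set es' \<subseteq> edges (T t')" using p t by (auto simp: is_path_def)
    then show "set es \<inter> set es' = {}" using edisj[OF t(1,2,5)] by blast
    show "(set xs - {u, v}) \<inter> (set xs' - {u, v}) = {}"
    proof (rule ccontr)
      assume "\<not> ?thesis"
      then obtain x where x: "x \<in> set xs" "x \<in> set xs'" "x \<noteq> u" "x \<noteq> v" by blast
      have "x \<in> verts (T t)" "x \<in> verts (T t')" using x(1,2) p t by (auto simp: is_path_def)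
      then have xR: "x \<in> R" using vT[OF t(1)] vT[OF t(2)] \<Omega>(2)[OF t(1,2,5)] by blast
      have "2 \<le> degree (T t) x" "2 \<le> degree (T t') x"
        using inner_path_degree[OF finT(1)[OF t(1)] _ x(1,3,4)] inner_path_degree[OF finT(1)[OF t(2)] _ x(2,3,4)] p t
        by auto
      then have "x \<in> Z t" "x \<in> Z t'" using deg[OF t(1), of x] deg[OF t(2), of x] xR by force+
      then show False using Z[OF t(1,2,5)] by blast
    qed
  qed
qed

theorem theorem4p3:
  fixes G :: "('v, 'e) mgraph" and p q r :: nat
  assumes "finite_mgraph G"
    and "0 < p" and "0 < q" and "3 \<le> r" and "q \<le> r"
    and "10 * ((p + q) * r - q) \<le> vertex_connectivity G"
  shows "\<forall>R. R \<subseteq> verts G \<and> card R = r \<longrightarrow>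
    (\<exists>\<P> \<Q>. card \<P> = p \<and> card \<Q> = q \<and> \<P> \<inter> \<Q> = {} \<and> is_CIST G R (\<P> \<union> \<Q>) \<and>
       (\<forall>T\<in>\<P>. pendant R T) \<and> (\<forall>T\<in>\<Q>. non_pendant R T))"
proof (intro allI impI)
  fix R assume "R \<subseteq> verts G \<and> card R = r"
  then have R: "R \<subseteq> verts G" "card R = r" by auto
  then have R3: "3 \<le> card R" and R2: "2 \<le> card R" using assms(4) by auto
  have finR: "finite R" using R3 by (metis card.infinite not_numeral_le_zero)
  \<comment> \<open>Here \<open>q \<le> r\<close> provides distinct \<open>a j\<close>, so that no
    terminal becomes an inner vertex of two trees. A \<open>b j\<close> has to differ only from its
    own \<open>a j\<close>.\<close>
  obtain a where a0: "inj_on a {..<q}" "a ` {..<q} \<subseteq> R"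
    using card_le_inj[of "{..<q}" R] finR R(2) assms(5) by auto
  have a: "a j \<in> R" if "j < q" for j using a0(2) that by blast
  have "\<exists>y. y \<in> R \<and> y \<noteq> x" for x
  proof (rule ccontr)
    assume "\<not> ?thesis"
    then have "R \<subseteq> {x}" by blast
    then have "card R \<le> card {x}" by (intro card_mono) auto
    then show False using R3 by simp
  qed
  then obtain b' where b': "\<And>x. b' x \<in> R \<and> b' x \<noteq> x" by metis
  define b where "b j = b' (a j)" for j
  have b: "b j \<in> R" "a j \<noteq> b j" for j using b'[of "a j"] by (auto simp: b_def)
  have bR: "b ` {..<q} \<subseteq> R" using b(1) by blast
  obtain U Pt where
    U: "\<forall>t < p + q. U t \<subseteq> verts G - R \<and> conn (ends G ` edges G) (U t)" and
    Pt: "\<forall>j < q. Pt j \<subseteq> verts G - R \<and> conn (ends G ` edges G) (Pt j) \<and>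
      (\<exists>x\<in>Pt j. {a j, x} \<in> ends G ` edges G) \<and> (\<exists>x\<in>Pt j. {b j, x} \<in> ends G ` edges G)" and
    UU: "\<forall>t < p + q. \<forall>t' < p + q. t \<noteq> t' \<longrightarrow> U t \<inter> U t' = {}" and
    PP: "\<forall>j < q. \<forall>j' < q. j \<noteq> j' \<longrightarrow> Pt j \<inter> Pt j' = {}" and
    UP: "\<forall>t < p + q. \<forall>j < q. U t \<inter> Pt j = {}" and
    z: "\<forall>t < p + q. \<forall>x\<in>R. \<not> (\<exists>j < q. t = p + j \<and> x = b j) \<longrightarrow> (\<exists>z\<in>U t. {x, z} \<in> ends G ` edges G)"
    using ex_connected_sets[OF assms R a0 bR] by (elim exE conjE) (rule that)
  \<comment> \<open>Indices below \<open>p\<close> belong to the pendant trees. The tree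
    \<open>p + j\<close> owns \<open>U (p + j)\<close> and \<open>Pt j\<close>, and
    \<open>a j\<close> is the only terminal that may be inner there.\<close>
  define \<Omega> where "\<Omega> t = (if t < p then U t else U t \<union> Pt (t - p))" for t
  define Z where "Z t = (if t < p then {} else {a (t - p)})" for t
  have "\<exists>T. steiner_tree G R T \<and> (if t < p then pendant R T else non_pendant R T) \<and> verts T \<subseteq> \<Omega> t \<union> R \<and>
      (\<forall>e\<in>edges T. ends G e \<inter> \<Omega> t \<noteq> {}) \<and> (\<forall>x\<in>R - Z t. degree T x \<le> 1)" if t: "t < p + q" for t
  proof (cases "t < p")
    case True
    have "\<exists>T. steiner_tree G R T \<and> pendant R T \<and> verts T \<subseteq> U t \<union> R \<and>
        (\<forall>e\<in>edges T. ends G e \<inter> U t \<noteq> {}) \<and> (\<forall>x\<in>R. degree T x \<le> 1)"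
    proof (rule pendant_tree[OF assms(1) R(1) R2])
      show "U t \<subseteq> verts G - R" "conn (ends G ` edges G) (U t)" using U t by auto
      show "\<exists>z\<in>U t. {x, z} \<in> ends G ` edges G" if "x \<in> R" for x using z[rule_format, OF t that] True by simp
    qed
    then show ?thesis using True by (simp add: \<Omega>_def Z_def)
  next
    case False
    define j where "j = t - p"
    have j: "j < q" "t = p + j" using False t by (auto simp: j_def)
    have "\<exists>T. steiner_tree G R T \<and> non_pendant R T \<and> verts T \<subseteq> U t \<union> Pt j \<union> R \<and>
        (\<forall>e\<in>edges T. ends G e \<inter> (U t \<union> Pt j) \<noteq> {}) \<and> (\<forall>x\<in>R - {a j}. degree T x \<le> 1)"
    proof (rule non_pendant_tree[OF assms(1) R(1) R3 a[OF j(1)] b])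
      show "U t \<subseteq> verts G - R" "conn (ends G ` edges G) (U t)" using U t by auto
      show "Pt j \<subseteq> verts G - R" "conn (ends G ` edges G) (Pt j)" "\<exists>x\<in>Pt j. {a j, x} \<in> ends G ` edges G"
        "\<exists>x\<in>Pt j. {b j, x} \<in> ends G ` edges G" using Pt j(1) by auto
      show "U t \<inter> Pt j = {}" using UP t j(1) by blast
      show "\<exists>z\<in>U t. {x, z} \<in> ends G ` edges G" if "x \<in> R" "x \<noteq> b j" for x
        using z[rule_format, OF t that(1)] that(2) j(2) by auto
    qed
    then show ?thesis using False by (simp add: \<Omega>_def Z_def j_def)
  qed
  then obtain T where T: "\<And>t. t < p + q \<Longrightarrow> steiner_tree G R (T t) \<and> (if t < p then pendant R (T t) else non_pendant R (T t)) \<and>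
      verts (T t) \<subseteq> \<Omega> t \<union> R \<and> (\<forall>e\<in>edges (T t). ends G e \<inter> \<Omega> t \<noteq> {}) \<and> (\<forall>x\<in>R - Z t. degree (T t) x \<le> 1)"
    by metis
  have \<Omega>R: "\<Omega> t \<inter> R = {}" if t: "t < p + q" for t
  proof -
    have "U t \<inter> R = {}" using U t by blast
    moreover have "Pt (t - p) \<inter> R = {}" if "\<not> t < p"
    proof -
      have "t - p < q" using that t by simp
      then show ?thesis using Pt by blast
    qed
    ultimately show ?thesis by (auto simp: \<Omega>_def)
  qed
  have \<Omega>\<Omega>: "\<Omega> t \<inter> \<Omega> t' = {}" if t: "t < p + q" "t' < p + q" "t \<noteq> t'" for t t'
  proof -
    have s: "s - p < q" if "\<not> s < p" "s < p + q" for s using that by simp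
    have 1: "U t \<inter> U t' = {}" using UU t by blast
    have 2: "Pt (t - p) \<inter> Pt (t' - p) = {}" if "\<not> t < p" "\<not> t' < p"
      using PP[rule_format, of "t - p" "t' - p"] s that t by simp
    have 3: "U t \<inter> Pt (t' - p) = {}" if "\<not> t' < p" using UP s[OF that t(2)] t(1) by blast
    have 4: "U t' \<inter> Pt (t - p) = {}" if "\<not> t < p" using UP s[OF that t(1)] t(2) by blast
    show ?thesis unfolding \<Omega>_def using 1 2 3 4 by (cases "t < p"; cases "t' < p") (simp_all, blast+)
  qed
  have ZZ: "Z t \<inter> Z t' = {}" if t: "t < p + q" "t' < p + q" "t \<noteq> t'" for t t'
  proof -
    have "a (t - p) \<noteq> a (t' - p)" if "\<not> t < p" "\<not> t' < p"
      using a0(1) that t by (simp add: inj_on_eq_iff)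
    then show ?thesis by (auto simp: Z_def)
  qed
  have fam: "is_CIST G R (T ` {..<p + q})" "inj_on T {..<p + q}"
    by (rule CIST_family[OF assms(1) _ R2, of "{..<p + q}" T \<Omega> Z]; (use T \<Omega>R \<Omega>\<Omega> ZZ in \<open>simp\<close>))+
  show "\<exists>\<P> \<Q>. card \<P> = p \<and> card \<Q> = q \<and> \<P> \<inter> \<Q> = {} \<and> is_CIST G R (\<P> \<union> \<Q>) \<and>
       (\<forall>T\<in>\<P>. pendant R T) \<and> (\<forall>T\<in>\<Q>. non_pendant R T)"
  proof (rule exI[of _ "T ` {..<p}"], rule exI[of _ "T ` {p..<p + q}"], intro conjI ballI)
    have "{..<p} \<subseteq> {..<p + q}" "{p..<p + q} \<subseteq> {..<p + q}" by auto
    then have "inj_on T {..<p}" "inj_on T {p..<p + q}" by (simp_all add: inj_on_subset[OF fam(2)])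
    then show "card (T ` {..<p}) = p" "card (T ` {p..<p + q}) = q" by (simp_all add: card_image)
    have "T ` {..<p} \<inter> T ` {p..<p + q} = T ` ({..<p} \<inter> {p..<p + q})"
      by (rule inj_on_image_Int[OF fam(2), symmetric]) auto
    then show "T ` {..<p} \<inter> T ` {p..<p + q} = {}" by auto
    have "{..<p} \<union> {p..<p + q} = {..<p + q}" by auto
    then have "T ` {..<p} \<union> T ` {p..<p + q} = T ` {..<p + q}" by (metis image_Un)
    then show "is_CIST G R (T ` {..<p} \<union> T ` {p..<p + q})" using fam(1) by simp
    fix S assume "S \<in> T ` {..<p}"
    then obtain t where "t < p" "S = T t" by auto
    then show "pendant R S" using T[of t] by simp
  next
    fix S assume "S \<in> T ` {p..<p + q}"
    then obtain t where "p \<le> t" "t < p + q" "S = T t" by auto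
    then show "non_pendant R S" using T[of t] by simp
  qed
qed

end
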